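(* Let Assumption 1 (stated in the context) hold with $\alpha\in(1,2)$ and $p^*=4$. Assume moreover that $L_4$ is bounded and that the function $\mathcal{L}$ defined in the context satisfies $\mathcal{L}(z)=c+O(z^{-\beta})$ as $z\to\infty$ with $c>0$ and $\beta>0$. Let $\hat\alpha$ be the wavelet local Whittle estimator defined in the context. (1) If $X$ is observed continuously on $[0,T]$, that is, $\mathbf{d}_{j,k}=d_{j,k}$, then the rate of convergence in probability of $\hat\alpha$ is $T^{-\beta/(2\beta+\alpha)}$, obtained for $J_0=\lfloor J/(2\beta+\alpha)\rfloor$ and $J_1=J$; that is, with this choice of $J_0,J_1$, $\hat\alpha-\alpha=O_P\big(T^{-\beta/(2\beta+\alpha)}\big)$ as $T\to\infty$. (2) If $X$ is observed at discrete time points, that is, $\mathbf{d}_{j,k}=d^D_{j,k}$, then the rate of convergence in probability of $\hat\alpha$ is $T^{-\gamma/(2\gamma+\alpha)}$ with $\gamma=\beta\wedge(2-\alpha)$, obtained for $J_0=\lfloor J/(2\gamma+\alpha)\rfloor$ and $J_1=J$; that is, with this choice of $J_0,J_1$, $\hat\alpha-\alpha=O_P\big(T^{-\gamma/(2\gamma+\alpha)}\big)$ as $T\to\infty$.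
   Context: **Assumption 1.** (i) The random vectors $(\eta,U)$, $(\eta_\ell,U_\ell)$, $\ell\in\mathbb{Z}$, are independent with common distribution $\nu$ on $(0,\infty)\times\mathbb{R}$, and are independent of the (unit-rate) homogeneous Poisson point process on the real line with points $\{t_\ell\}_{\ell\in\mathbb{Z}}$, indexed so that $t_\ell<t_{\ell+1}$ for all $\ell$ and $t_{-1}<0\le t_0$. (ii) $p^*$ is a positive integer with $\mathbb{E}[|U|^{p^*}]<\infty$. (iii) There exist a real number $\alpha\in(0,2)$ and positive functions $L_0,\dots,L_{p^*}$, slowly varying at infinity, such that for all $t>0$ and $p=0,\dots,p^*$, $H_p(t):=\mathbb{E}[|U|^p\mathbf{1}_{\{\eta>t\}}]=L_p(t)t^{-\alpha}$. **Process.** The infinite-source Poisson process is $X(t)=\sum_{\ell\in\mathbb{N}}U_\ell\mathbf{1}_{\{t_\ell\le t<t_\ell+\eta_\ell\}}$, $t\ge0$, with $\mathbb{N}=\{0,1,2,\dots\}$. **Wavelets.** Fix $M\ge1$. $\psi:\mathbb{R}\to\mathbb{R}$ is a bounded function with compact support in $[0,M]$ and $\int_0^M\psi(s)\,\mathrm{d}s=0$. For integers $j\ge0$, $k\in\mathbb{Z}$, $\psi_{j,k}(s)=2^{-j/2}\psi(2^{-j}s-k)$. $\phi:\mathbb{R}\to\mathbb{R}$ is a bounded function with compact support included in $[-M+1,1]$ and $\sum_{k\in\mathbb{Z}}\phi(t-k)=1$ for all $t\in\mathbb{R}$. **Wavelet coefficients.** Continuous-time: $X$ is observed on $[0,T]$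 and $d_{j,k}=\int_0^\infty\psi_{j,k}(s)X(s)\,\mathrm{d}s$. Discrete-time: $T$ is a positive integer, $X$ is observed at $T$ consecutive integer times $0,1,\dots,T-1$, and $d^D_{j,k}=\int\psi_{j,k}(s)\,\mathrm{I}_\phi[X](s)\,\mathrm{d}s$, where $\mathrm{I}_\phi[x](t)=\sum_{k\in\mathbb{Z}}x(k)\phi(t-k)$. (For the indices used below, only $X(0),\dots,X(T-1)$ matter.) **The function $\mathcal{L}$.** For $z>0$, $$\mathcal{L}(z):=z^{\alpha}\int_0^\infty\int_{-\infty}^\infty\Big(\int_{-\infty}^\infty\Big\{\int_t^{t+vz^{-1}}\psi(s)\,\mathrm{d}s\Big\}^2\mathrm{d}t\Big)w^2\,\nu(\mathrm{d}v,\mathrm{d}w).$$ **Estimator.** Let $J=\max\{j: 2^j\le(T-M+1)/(M+1)\}$, $n_j=2^{J-j}$, and let $J_0,J_1$ be integers (depending on $T$) with $0<J_0<J_1\le J$. Put $\Delta=\{(j,k): J_0<j\le J_1,\ 0\le k\le n_j-1\}$ and $\delta=\frac1{\#\Delta}\sum_{(j,k)\in\Delta}j$. The contrast is $$\hat W(\alpha')=\log\Big(\sum_{(j,k)\in\Delta}\frac{\mathbf{d}_{j,k}^2}{2^{(2-\alpha')j}}\Big)+\delta\log(2)(2-\alpha'),$$ and $\hat\alpha:=\arg\min_{\alpha'\in(0,2)}\hat W(\alpha')$. $Y_T=O_P(r_T)$ means that $Y_T/r_T$ is bounded in probability as $T\to\infty$. *)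

theory Defs
  imports "HOL-Probability.Probability" "HOL-Library.Landau_Symbols"
begin

definition slowly_varying :: "(real \<Rightarrow> real) \<Rightarrow> bool" where
  "slowly_varying L \<longleftrightarrow>
     L \<in> borel_measurable (restrict_space borel {0<..}) \<and>
     (\<forall>x>0. L x > 0) \<and>
     (\<forall>r>0. ((\<lambda>x. L (r * x) / L x) \<longlongrightarrow> 1) at_top)"

(* The event {|Y_T / r_T| > C} need not be measurable for an arbitrary family Y, and then "measure"
   would silently give it the value 0; it is therefore measured by outer probability. *)
definition bigO_P ::
  "'a measure \<Rightarrow> 'i filter \<Rightarrow> ('i \<Rightarrow> 'a \<Rightarrow> real) \<Rightarrow> ('i \<Rightarrow> real) \<Rightarrow> bool" where
  "bigO_P P F Y r \<longleftrightarrow>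
     (\<forall>\<epsilon>>0. \<exists>C. \<forall>\<^sub>F T in F. \<exists>A\<in>sets P.
        {\<omega>\<in>space P. \<bar>Y T \<omega> / r T\<bar> > C} \<subseteq> A \<and> measure P A \<le> \<epsilon>)"

definition points_in :: "(int \<Rightarrow> 'a \<Rightarrow> real) \<Rightarrow> real set \<Rightarrow> 'a \<Rightarrow> nat" where
  "points_in t B \<omega> = card {l. t l \<omega> \<in> B}"

(* Local finiteness is what makes "card" a genuine count in points_in.
   The Poisson law is written out since poisson_pmf is only specified for a positive rate,
   whereas B may be a null set. *)
definition unit_poisson_points :: "'a measure \<Rightarrow> (int \<Rightarrow> 'a \<Rightarrow> real) \<Rightarrow> bool" where
  "unit_poisson_points P t \<longleftrightarrow>
     (\<forall>l. t l \<in> borel_measurable P) \<and>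
     (AE \<omega> in P. \<forall>l. t l \<omega> < t (l + 1) \<omega>) \<and>
     (AE \<omega> in P. t (-1) \<omega> < 0 \<and> 0 \<le> t 0 \<omega>) \<and>
     (AE \<omega> in P. \<forall>a b. finite {l. t l \<omega> \<in> {a..b}}) \<and>
     (\<forall>B n. B \<in> sets borel \<longrightarrow> bounded B \<longrightarrow>
        measure P {\<omega>\<in>space P. points_in t B \<omega> = n}
          = measure lborel B ^ n / fact n * exp (- measure lborel B)) \<and>
     (\<forall>B :: nat \<Rightarrow> real set. (\<forall>i. B i \<in> sets borel \<and> bounded (B i)) \<longrightarrow> disjoint_family B \<longrightarrow>
        prob_space.indep_vars P (\<lambda>_. count_space UNIV) (\<lambda>i. points_in t (B i)) UNIV)"

(* Expectations of functions of the generic pair (\<eta>, U) are integrals against the common law \<nu>.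
   The two sequences take values in different types, so their independence is stated for the
   sigma-algebras they generate (indep_var needs a single value type). *)
locale infinite_source_poisson = prob_space P
  for P :: "'a measure" +
  fixes t \<eta> U :: "int \<Rightarrow> 'a \<Rightarrow> real"
    and \<nu> :: "(real \<times> real) measure"
    and \<alpha> :: real and pstar :: nat and L :: "nat \<Rightarrow> real \<Rightarrow> real"
  assumes prob_space_\<nu>: "prob_space \<nu>"
    and sets_\<nu>: "sets \<nu> = sets borel"
    and \<nu>_pos: "AE (v, w) in \<nu>. 0 < v"
    and law: "\<And>l. distr P borel (\<lambda>\<omega>. (\<eta> l \<omega>, U l \<omega>)) = \<nu>"
    and marks_indep: "indep_vars (\<lambda>_. borel) (\<lambda>l \<omega>. (\<eta> l \<omega>, U l \<omega>)) UNIV"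
    and poisson: "unit_poisson_points P t"
    and marks_indep_points:
      "indep_set
         (sets (vimage_algebra (space P) (\<lambda>\<omega> l. (\<eta> l \<omega>, U l \<omega>)) (Pi\<^sub>M UNIV (\<lambda>_. borel))))
         (sets (vimage_algebra (space P) (\<lambda>\<omega> l. t l \<omega>) (Pi\<^sub>M UNIV (\<lambda>_. borel))))"
    and pstar_pos: "0 < pstar"
    and moment: "integrable \<nu> (\<lambda>(v, w). \<bar>w\<bar> ^ pstar)"
    and \<alpha>_range: "0 < \<alpha>" "\<alpha> < 2"
    and L_slowly_varying: "\<And>p. p \<le> pstar \<Longrightarrow> slowly_varying (L p)"
    and tail: "\<And>p x. p \<le> pstar \<Longrightarrow> 0 < x \<Longrightarrow>
      (\<integral>(v, w). \<bar>w\<bar> ^ p * indicator {x<..} v \<partial>\<nu>) = L p x * x powr (-\<alpha>)"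

(* Almost surely only finitely many terms are nonzero.  Since 0 \<le> t 0, the formula gives the
   value 0 at negative times, which extends the process to the whole line. *)
definition source_process ::
  "(int \<Rightarrow> 'a \<Rightarrow> real) \<Rightarrow> (int \<Rightarrow> 'a \<Rightarrow> real) \<Rightarrow> (int \<Rightarrow> 'a \<Rightarrow> real) \<Rightarrow> 'a \<Rightarrow> real \<Rightarrow> real" where
  "source_process t \<eta> U \<omega> s =
     (\<Sum>l::nat. U (int l) \<omega> * indicator {t (int l) \<omega> ..< t (int l) \<omega> + \<eta> (int l) \<omega>} s)"

locale wavelet_setting =
  fixes M :: real and \<psi> \<phi> :: "real \<Rightarrow> real"
  assumes M_ge_1: "1 \<le> M"
    and \<psi>_measurable: "\<psi> \<in> borel_measurable borel"
    and \<psi>_bounded: "bounded (range \<psi>)"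
    and \<psi>_support: "\<And>s. s \<notin> {0..M} \<Longrightarrow> \<psi> s = 0"
    and \<psi>_integral: "(LINT s:{0..M}|lborel. \<psi> s) = 0"
    and \<phi>_measurable: "\<phi> \<in> borel_measurable borel"
    and \<phi>_bounded: "bounded (range \<phi>)"
    and \<phi>_support: "\<And>s. s \<notin> {-M+1..1} \<Longrightarrow> \<phi> s = 0"
    and \<phi>_partition: "\<And>s. ((\<lambda>k::int. \<phi> (s - of_int k)) has_sum 1) UNIV"

definition wavelet :: "(real \<Rightarrow> real) \<Rightarrow> nat \<Rightarrow> int \<Rightarrow> real \<Rightarrow> real" where
  "wavelet \<psi> j k s = 2 powr (- real j / 2) * \<psi> (2 powr (- real j) * s - of_int k)"

definition coeff_cont :: "(real \<Rightarrow> real) \<Rightarrow> (real \<Rightarrow> real) \<Rightarrow> nat \<Rightarrow> int \<Rightarrow> real" where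
  "coeff_cont \<psi> x j k = (LINT s:{0..}|lborel. wavelet \<psi> j k s * x s)"

definition interpolate :: "(real \<Rightarrow> real) \<Rightarrow> (real \<Rightarrow> real) \<Rightarrow> real \<Rightarrow> real" where
  "interpolate \<phi> x s = (\<Sum>\<^sub>\<infinity>k::int. x (of_int k) * \<phi> (s - of_int k))"

definition coeff_disc :: "(real \<Rightarrow> real) \<Rightarrow> (real \<Rightarrow> real) \<Rightarrow> (real \<Rightarrow> real) \<Rightarrow> nat \<Rightarrow> int \<Rightarrow> real" where
  "coeff_disc \<psi> \<phi> x j k = (LINT s|lborel. wavelet \<psi> j k s * interpolate \<phi> x s)"

definition scale_fun :: "real \<Rightarrow> (real \<times> real) measure \<Rightarrow> (real \<Rightarrow> real) \<Rightarrow> real \<Rightarrow> real" where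
  "scale_fun \<alpha> \<nu> \<psi> z =
     z powr \<alpha> * (\<integral>(v, w). (\<integral>t. (LINT s:{t..t + v / z}|lborel. \<psi> s)\<^sup>2 \<partial>lborel) * w\<^sup>2 \<partial>\<nu>)"

definition max_scale :: "real \<Rightarrow> real \<Rightarrow> nat" where
  "max_scale M T = Max {j::nat. 2 ^ j \<le> (T - M + 1) / (M + 1)}"

definition scale_indices :: "nat \<Rightarrow> nat \<Rightarrow> nat \<Rightarrow> (nat \<times> int) set" where
  "scale_indices J J0 J1 = {(j, k). J0 < j \<and> j \<le> J1 \<and> 0 \<le> k \<and> k \<le> 2 ^ (J - j) - 1}"

definition mean_scale :: "(nat \<times> int) set \<Rightarrow> real" where
  "mean_scale \<Delta> = (\<Sum>(j, k)\<in>\<Delta>. real j) / real (card \<Delta>)"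

definition whittle_contrast :: "(nat \<Rightarrow> int \<Rightarrow> real) \<Rightarrow> (nat \<times> int) set \<Rightarrow> real \<Rightarrow> real" where
  "whittle_contrast d \<Delta> a =
     ln (\<Sum>(j, k)\<in>\<Delta>. (d j k)\<^sup>2 / 2 powr ((2 - a) * real j)) + mean_scale \<Delta> * ln 2 * (2 - a)"

(* a is a value of the estimator computed from d.  The minimum over the open interval need be
   neither attained nor attained only once: if it is attained, a may be any minimiser; if not,
   a is unrestricted. *)
definition whittle_estimate :: "(nat \<Rightarrow> int \<Rightarrow> real) \<Rightarrow> (nat \<times> int) set \<Rightarrow> real \<Rightarrow> bool" where
  "whittle_estimate d \<Delta> a \<longleftrightarrow>
     ((\<exists>b. is_arg_min (whittle_contrast d \<Delta>) (\<lambda>x. x \<in> {0<..<2}) b) \<longrightarrow>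
      is_arg_min (whittle_contrast d \<Delta>) (\<lambda>x. x \<in> {0<..<2}) a)"

end

theory Submission
  imports Defs
begin

text \<open>A wavelet coefficient is a sum over the marked Poisson points \<open>z = (t, \<eta>, U)\<close> of a kernel
  \<open>f j k z\<close>. The factorial moment formula \<open>E (\<Sum> distinct. g1 z1 \<cdots> gm zm) = \<integral>g1 \<cdots> \<integral>gm\<close> with
  \<open>m \<le> 4\<close> gives the mean and the variance of \<open>\<Sum>k. (d j k)\<^sup>2\<close>. After division by
  \<open>2 powr ((2 - \<alpha>) j)\<close> and with \<open>n = 2 ^ (J - j)\<close>, this sum lies at mean distance
  \<open>O(n (2 powr (-\<gamma> j) + 2 powr ((\<alpha> j - J) / 2)))\<close> from \<open>c n\<close>. The first term is the bias of
  \<open>scale_fun\<close> (and of the interpolation); the second comes from the fourth moment of the kernels,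
  which is where the bound on \<open>L 4\<close> enters. Sources born before time 0 are missing from the
  process, but their contribution is of lower order because \<open>\<alpha> > 1\<close>.

  The contrast is, up to a constant, \<open>ln (\<Sum>j. s j * 2 powr (x (j - m)))\<close> with \<open>x = \<alpha>' - \<alpha>\<close> and
  \<open>m\<close> the mean scale. Since \<open>exp y - 1 - y\<close> is quadratic near 0, this exceeds its value at \<open>x = 0\<close> by
  order \<open>x\<^sup>2\<close>, against a linear error whose slope is the weighted deviation of the \<open>s j\<close> from \<open>c n\<close>.
  Hence minimisers are as close to \<open>\<alpha>\<close> as that deviation, uniformly over the interval \<open>(0, 2)\<close>.\<close>

section \<open>Factorial moments of the marked point process\<close>

text \<open>Lifetimes have infinite variance, so long sources could affect very many coefficients.
  The vanishing integral of the wavelet prevents this: a coefficient only sees sources whose birth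
  or death lies near its support, so for every lifetime the relevant birth times have length O(2^j),
  and each source touches O(1) shifts k. The Poisson hypothesis only speaks of counts in disjoint
  sets. The moment formula is therefore computed for products with disjoint time sides and extended
  by uniqueness of measures, the diagonals being null on both sides. The choice of J0 equalises the
  two errors: with q = \<gamma> / (2\<gamma> + \<alpha>), both 2^(-\<gamma> J0) and 2^((\<alpha> J0
  - J) / 2) are of order 2^(-q J), hence T^(-q). In discrete time, interpolation changes second
  moments of order 2^((2 - \<alpha>) j) by O(1), whence the cap 2 - \<alpha> on \<gamma>. A minimum
  over the open interval might not be attained, and then \<open>whittle_estimate\<close> says
  nothing; existence of a minimiser is proved together with its location.\<close>

lemma sums_nat_times_poisson:
  fixes x :: real
  shows "(\<lambda>n. real n * (x ^ n / fact n * exp (- x))) sums x"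
proof -
  have "(\<lambda>n. x ^ n /\<^sub>R fact n) sums exp x"
    by (rule exp_converges)
  then have "(\<lambda>n. x * exp (- x) * (x ^ n /\<^sub>R fact n)) sums (x * exp (- x) * exp x)"
    by (rule sums_mult)
  moreover have "x * exp (- x) * exp x = x"
    by (simp add: mult.assoc flip: exp_add)
  \<comment> \<open>The factor n cancels against the factorial, which shifts the exponential series
    by one index.\<close>
  moreover have "x * exp (- x) * (x ^ n /\<^sub>R fact n) = real (Suc n) * (x ^ Suc n / fact (Suc n) * exp (- x))" for n
  proof -
    have "real (Suc n) / fact (Suc n) = 1 / (fact n :: real)"
      by (simp add: field_simps del: of_nat_Suc)
    then have "real (Suc n) * (x ^ Suc n / fact (Suc n) * exp (- x)) = (1 / fact n) * x ^ Suc n * exp (- x)"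
      by (metis (no_types, lifting) mult.assoc times_divide_eq_left times_divide_eq_right)
    then show ?thesis by (simp add: field_simps)
  qed
  ultimately have "(\<lambda>n. real (Suc n) * (x ^ Suc n / fact (Suc n) * exp (- x))) sums x"
    by simp
  then show ?thesis
    by (subst (asm) sums_Suc_iff) simp
qed

section \<open>Point counts, marks, and the factorial moment measure on rectangles\<close>

context infinite_source_poisson
begin

definition marked_point :: "int \<Rightarrow> 'a \<Rightarrow> real \<times> real \<times> real" where
  "marked_point l \<omega> = (t l \<omega>, \<eta> l \<omega>, U l \<omega>)"

sublocale \<nu>: prob_space \<nu>
  by (rule prob_space_\<nu>)

lemma sets_\<nu>_pair [measurable_cong]: "sets \<nu> = sets (borel \<Otimes>\<^sub>M borel)"
  using sets_\<nu> by (metis borel_prod)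

lemma space_\<nu> [simp]: "space \<nu> = UNIV"
  using sets_eq_imp_space_eq[OF sets_\<nu>] by simp

text \<open>The mean measure of the marked Poisson process: unit rate in birth time, and the law
  \<nu> for the independent mark.\<close>

definition intensity :: "(real \<times> real \<times> real) measure" where
  "intensity = lborel \<Otimes>\<^sub>M \<nu>"

lemma sets_intensity: "sets intensity = sets (borel \<Otimes>\<^sub>M borel)"
  unfolding intensity_def by (intro sets_pair_measure_cong) (auto simp: sets_\<nu>)

lemma sets_intensity_triple [measurable_cong]: "sets intensity = sets (borel \<Otimes>\<^sub>M borel \<Otimes>\<^sub>M borel)"
  unfolding intensity_def by (intro sets_pair_measure_cong) (simp_all add: sets_\<nu>_pair)

lemma sets_intensity': "sets intensity = sets borel"
  using sets_intensity by (metis borel_prod)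

lemma space_intensity [simp]: "space intensity = UNIV"
  using sets_eq_imp_space_eq[OF sets_intensity'] by simp

sublocale intensity: pair_sigma_finite lborel \<nu> ..

lemma sigma_finite_intensity: "sigma_finite_measure intensity"
  unfolding intensity_def by (rule intensity.P.sigma_finite_measure_axioms)

lemma measurable_marks [measurable]: "(\<lambda>\<omega>. (\<eta> l \<omega>, U l \<omega>)) \<in> borel_measurable P"
  using marks_indep by (auto simp: indep_vars_def)

lemma measurable_points [measurable]: "t l \<in> borel_measurable P"
  using poisson by (auto simp: unit_poisson_points_def)

lemma measurable_marked_point [measurable]: "marked_point l \<in> P \<rightarrow>\<^sub>M (borel \<Otimes>\<^sub>M borel)"
  unfolding marked_point_def by measurable

lemma measurable_points_in:
  assumes "B \<in> sets borel" "bounded B"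
  shows "points_in t B \<in> P \<rightarrow>\<^sub>M count_space UNIV"
proof -
  \<comment> \<open>Measurability of a single count is part of the independence statement for the
    sequence B, {}, {}, ...\<close>
  let ?B = "\<lambda>i::nat. if i = 0 then B else {}"
  have "indep_vars (\<lambda>_. count_space UNIV) (\<lambda>i. points_in t (?B i)) UNIV"
    using poisson assms unfolding unit_poisson_points_def
    by (auto simp: disjoint_family_on_def)
  then show ?thesis
    unfolding indep_vars_def by (metis (mono_tags, lifting) UNIV_I)
qed

lemma nn_integral_points_in:
  assumes B: "B \<in> sets borel" "bounded B"
  shows "(\<integral>\<^sup>+\<omega>. of_nat (points_in t B \<omega>) \<partial>P) = emeasure lborel B"
proof -
  note [measurable] = measurable_points_in[OF B]
  define x where "x = measure lborel B"
  have fin: "emeasure lborel B < \<infinity>"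
    using emeasure_bounded_finite[OF B(2)] by simp
  have pr: "prob {\<omega>\<in>space P. points_in t B \<omega> = n} = x ^ n / fact n * exp (- x)" for n
    using poisson B unfolding unit_poisson_points_def x_def by blast
  have nn: "0 \<le> real n * (x ^ n / fact n * exp (- x))" for n
    by (simp add: x_def)
  have "(\<integral>\<^sup>+\<omega>. of_nat (points_in t B \<omega>) \<partial>P)
      = (\<integral>\<^sup>+\<omega>. (\<Sum>n. of_nat n * indicator {\<omega>\<in>space P. points_in t B \<omega> = n} \<omega>) \<partial>P)"
  proof (intro nn_integral_cong)
    fix \<omega> assume "\<omega> \<in> space P"
    then have "(\<Sum>n. of_nat n * indicator {\<omega>\<in>space P. points_in t B \<omega> = n} \<omega> :: ennreal)
       = (\<Sum>n\<in>{points_in t B \<omega>}. of_nat n * indicator {\<omega>\<in>space P. points_in t B \<omega> = n} \<omega>)"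
      by (intro suminf_finite) (auto simp: indicator_def)
    then show "of_nat (points_in t B \<omega>) = (\<Sum>n. of_nat n * indicator {\<omega>\<in>space P. points_in t B \<omega> = n} \<omega> :: ennreal)"
      using \<open>\<omega> \<in> space P\<close> by simp
  qed
  also have "\<dots> = (\<Sum>n. \<integral>\<^sup>+\<omega>. of_nat n * indicator {\<omega>\<in>space P. points_in t B \<omega> = n} \<omega> \<partial>P)"
    by (intro nn_integral_suminf) measurable
  also have "\<dots> = (\<Sum>n. ennreal (real n * (x ^ n / fact n * exp (- x))))"
  proof (intro suminf_cong)
    fix n
    have "(\<integral>\<^sup>+\<omega>. of_nat n * indicator {\<omega>\<in>space P. points_in t B \<omega> = n} \<omega> \<partial>P)
      = of_nat n * emeasure P {\<omega>\<in>space P. points_in t B \<omega> = n}"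
      by (intro nn_integral_cmult_indicator) measurable
    also have "\<dots> = ennreal (real n * (x ^ n / fact n * exp (- x)))"
      unfolding emeasure_eq_measure pr
      by (subst ennreal_mult') (simp_all add: ennreal_of_nat_eq_real_of_nat)
    finally show "(\<integral>\<^sup>+\<omega>. of_nat n * indicator {\<omega>\<in>space P. points_in t B \<omega> = n} \<omega> \<partial>P)
       = ennreal (real n * (x ^ n / fact n * exp (- x)))" .
  qed
  also have "\<dots> = ennreal x"
    using suminf_ennreal_eq[OF nn sums_nat_times_poisson] .
  also have "\<dots> = emeasure lborel B"
    unfolding x_def using fin by (simp add: emeasure_eq_ennreal_measure)
  finally show ?thesis .
qed

lemma nn_integral_prod_points_in:
  fixes B :: "nat \<Rightarrow> real set"
  assumes I: "finite I" and B: "\<And>i. i \<in> I \<Longrightarrow> B i \<in> sets borel" "\<And>i. i \<in> I \<Longrightarrow> bounded (B i)"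
    and disj: "disjoint_family_on B I"
  shows "(\<integral>\<^sup>+\<omega>. (\<Prod>i\<in>I. of_nat (points_in t (B i) \<omega>)) \<partial>P) = (\<Prod>i\<in>I. emeasure lborel (B i))"
proof -
  \<comment> \<open>Padding with empty sets turns a finite disjoint family into a full sequence, for
    which independence of the counts is available.\<close>
  let ?B = "\<lambda>i. if i \<in> I then B i else {}"
  have "indep_vars (\<lambda>_. count_space UNIV) (\<lambda>i. points_in t (?B i)) UNIV"
    using poisson B disj unfolding unit_poisson_points_def
    by (auto simp: disjoint_family_on_def)
  then have "indep_vars (\<lambda>_. borel) (\<lambda>i. of_nat \<circ> points_in t (?B i)) UNIV"
    by (rule indep_vars_compose) simp
  then have "indep_vars (\<lambda>_. borel) (\<lambda>i \<omega>. (of_nat (points_in t (?B i) \<omega>) :: ennreal)) I"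
    unfolding comp_def by (rule indep_vars_subset) simp
  then have "(\<integral>\<^sup>+\<omega>. (\<Prod>i\<in>I. of_nat (points_in t (?B i) \<omega>)) \<partial>P)
     = (\<Prod>i\<in>I. \<integral>\<^sup>+\<omega>. of_nat (points_in t (?B i) \<omega>) \<partial>P)"
    by (intro indep_vars_nn_integral I) auto
  also have "\<dots> = (\<Prod>i\<in>I. emeasure lborel (B i))"
    by (intro prod.cong) (auto simp: nn_integral_points_in B)
  finally show ?thesis by (simp cong: prod.cong)
qed

text \<open>The two independence assumptions combine: marks against points, then marks of distinct
  indices among themselves. The indices are deterministic here; randomness in which points hit the
  sets enters only when all index tuples are summed.\<close>

lemma prob_marked_rectangle:
  fixes l :: "nat \<Rightarrow> int"
  assumes I: "finite I" "inj_on l I"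
    and B: "\<And>i. i \<in> I \<Longrightarrow> B i \<in> sets borel" and C: "\<And>i. i \<in> I \<Longrightarrow> C i \<in> sets borel"
  shows "emeasure P {\<omega>\<in>space P. \<forall>i\<in>I. marked_point (l i) \<omega> \<in> B i \<times> C i}
    = (\<Prod>i\<in>I. emeasure \<nu> (C i)) * emeasure P {\<omega>\<in>space P. \<forall>i\<in>I. t (l i) \<omega> \<in> B i}"
proof (cases "I = {}")
  case True
  then show ?thesis by simp
next
  case False
  define mk where "mk = (\<lambda>l \<omega>. (\<eta> l \<omega>, U l \<omega>))"
  define TE where "TE = {\<omega>\<in>space P. \<forall>i\<in>I. t (l i) \<omega> \<in> B i}"
  define ME where "ME = {\<omega>\<in>space P. \<forall>i\<in>I. mk (l i) \<omega> \<in> C i}"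
  have [measurable]: "mk l \<in> P \<rightarrow>\<^sub>M borel" for l unfolding mk_def by measurable
  \<comment> \<open>Independence of marks and points is stated for generated sigma-algebras, so both
    events have to be exhibited as preimages of product-measurable sets.\<close>
  have ME: "ME \<in> sets (vimage_algebra (space P) (\<lambda>\<omega> l. (\<eta> l \<omega>, U l \<omega>)) (Pi\<^sub>M UNIV (\<lambda>_. borel)))"
  proof -
    have "{m \<in> space (Pi\<^sub>M UNIV (\<lambda>_. borel)). \<forall>i\<in>I. m (l i) \<in> C i} \<in> sets (Pi\<^sub>M UNIV (\<lambda>_. borel :: (real \<times> real) measure))"
      using C I by measurable
    from in_vimage_algebra[OF this, of "\<lambda>\<omega> l. (\<eta> l \<omega>, U l \<omega>)" "space P"]
    show ?thesis
      by (rule back_subst[where P="\<lambda>x. x \<in> _"]) (auto simp: ME_def mk_def space_PiM)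
  qed
  have TE: "TE \<in> sets (vimage_algebra (space P) (\<lambda>\<omega> l. t l \<omega>) (Pi\<^sub>M UNIV (\<lambda>_. borel)))"
  proof -
    have "{m \<in> space (Pi\<^sub>M UNIV (\<lambda>_. borel)). \<forall>i\<in>I. m (l i) \<in> B i} \<in> sets (Pi\<^sub>M UNIV (\<lambda>_. borel :: real measure))"
      using B I by measurable
    from in_vimage_algebra[OF this, of "\<lambda>\<omega> l. t l \<omega>" "space P"]
    show ?thesis
      by (rule back_subst[where P="\<lambda>x. x \<in> _"]) (auto simp: TE_def space_PiM)
  qed
  have eq: "{\<omega>\<in>space P. \<forall>i\<in>I. marked_point (l i) \<omega> \<in> B i \<times> C i} = ME \<inter> TE"
    by (auto simp: marked_point_def ME_def TE_def mk_def)
  \<comment> \<open>The family of marks is indexed by integers; injectivity of \<open>l\<close>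
    allows the sets to be re-indexed along \<open>l\<close>.\<close>
  define D where "D = (\<lambda>m. C (the_inv_into I l m))"
  have D: "D (l i) = C i" if "i \<in> I" for i
    unfolding D_def using that I by (simp add: the_inv_into_f_f)
  have "prob ME = prob (\<Inter>m\<in>l`I. mk m -` D m \<inter> space P)"
    using False D by (intro arg_cong[where f=prob]) (auto simp: ME_def)
  also have "\<dots> = (\<Prod>m\<in>l`I. prob (mk m -` D m \<inter> space P))"
    using marks_indep False I C D unfolding mk_def
    by (intro indep_varsD[where M'="\<lambda>_. borel"]) auto
  also have "\<dots> = (\<Prod>i\<in>I. prob (mk (l i) -` C i \<inter> space P))"
    using I D by (simp add: prod.reindex)
  also have "\<dots> = (\<Prod>i\<in>I. measure \<nu> (C i))"
  proof (intro prod.cong refl)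
    fix i assume "i \<in> I"
    have "measure \<nu> (C i) = measure (distr P borel (mk (l i))) (C i)"
      using law[of "l i"] by (simp add: mk_def)
    also have "\<dots> = prob (mk (l i) -` C i \<inter> space P)"
      using C[OF \<open>i \<in> I\<close>] by (intro measure_distr) auto
    finally show "prob (mk (l i) -` C i \<inter> space P) = measure \<nu> (C i)" ..
  qed
  finally have pME: "prob ME = (\<Prod>i\<in>I. measure \<nu> (C i))" .
  have "prob (ME \<inter> TE) = prob ME * prob TE"
    using marks_indep_points ME TE by (rule indep_setD)
  then show ?thesis
    unfolding eq TE_def[symmetric] emeasure_eq_measure \<nu>.emeasure_eq_measure
    by (simp add: pME ennreal_mult' prod_nonneg prod_ennreal)
qed

text \<open>Distinct indices make the moments factorial ones. Extensionality keeps the set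
  countable, which Fubini against a counting measure needs.\<close>

definition index_tuples :: "nat set \<Rightarrow> (nat \<Rightarrow> int) set" where
  "index_tuples I = {l \<in> I \<rightarrow>\<^sub>E UNIV. inj_on l I}"

lemma countable_index_tuples: "finite I \<Longrightarrow> countable (index_tuples I)"
  unfolding index_tuples_def
  by (rule countable_subset[of _ "I \<rightarrow>\<^sub>E UNIV"]) (auto intro: countable_PiE)

lemma sigma_finite_index_tuples:
  "finite I \<Longrightarrow> sigma_finite_measure (count_space (index_tuples I))"
  by (intro sigma_finite_measure_count_space_countable countable_index_tuples)

definition point_tuple :: "nat set \<Rightarrow> (nat \<Rightarrow> int) \<times> 'a \<Rightarrow> nat \<Rightarrow> real \<times> real \<times> real" where
  "point_tuple I = (\<lambda>(l, \<omega>). \<lambda>i\<in>I. marked_point (l i) \<omega>)"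

lemma measurable_point_tuple:
  assumes "finite I"
  shows "point_tuple I \<in> (count_space (index_tuples I) \<Otimes>\<^sub>M P) \<rightarrow>\<^sub>M Pi\<^sub>M I (\<lambda>_. borel \<Otimes>\<^sub>M borel)"
  unfolding point_tuple_def
  by (intro measurable_pair_measure_countable1 countable_index_tuples assms) simp

text \<open>Its value on a set is the expected number of tuples of distinct points lying there: the
  factorial moment measure of order \<open>card I\<close>.\<close>

definition tuple_measure :: "nat set \<Rightarrow> (nat \<Rightarrow> real \<times> real \<times> real) measure" where
  "tuple_measure I = distr (count_space (index_tuples I) \<Otimes>\<^sub>M P) (Pi\<^sub>M I (\<lambda>_. borel \<Otimes>\<^sub>M borel)) (point_tuple I)"

lemma AE_points_inj: "AE \<omega> in P. inj (\<lambda>l. t l \<omega>)"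
proof -
  have "AE \<omega> in P. \<forall>l. t l \<omega> < t (l + 1) \<omega>"
    using poisson by (auto simp: unit_poisson_points_def)
  then show ?thesis
  proof eventually_elim
    case (elim \<omega>)
    have *: "t l \<omega> < t (l + int (Suc n)) \<omega>" for l n
    proof (induction n)
      case (Suc n)
      have "t (l + int (Suc n)) \<omega> < t (l + int (Suc n) + 1) \<omega>"
        using elim by blast
      also have "l + int (Suc n) + 1 = l + int (Suc (Suc n))" by simp
      finally show ?case using Suc by simp
    qed (use elim in simp)
    have "strict_mono (\<lambda>l. t l \<omega>)"
    proof (rule strict_monoI)
      fix x y :: int assume "x < y"
      then have "y = x + int (Suc (nat (y - x) - 1))" by simp
      then show "t x \<omega> < t y \<omega>" using * by metis
    qed
    then show ?case by (rule strict_mono_imp_inj_on)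
  qed
qed

lemma AE_points_finite: "AE \<omega> in P. \<forall>B. bounded B \<longrightarrow> finite {l. t l \<omega> \<in> B}"
proof -
  have "AE \<omega> in P. \<forall>a b. finite {l. t l \<omega> \<in> {a..b}}"
    using poisson by (auto simp: unit_poisson_points_def)
  then show ?thesis
  proof eventually_elim
    case (elim \<omega>)
    show ?case
    proof (intro allI impI)
      fix B :: "real set" assume "bounded B"
      then obtain a where "\<forall>x\<in>B. \<bar>x\<bar> \<le> a" by (auto simp: bounded_iff)
      then have "{l. t l \<omega> \<in> B} \<subseteq> {l. t l \<omega> \<in> {-a..a}}" by force
      then show "finite {l. t l \<omega> \<in> B}" using elim finite_subset by blast
    qed
  qed
qed

text \<open>When the time sides are disjoint, one index cannot serve two coordinates. Distinctness
  is then automatic, and the number of tuples is a product of counts, which are independent with the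
  lengths as means.\<close>

lemma tuple_measure_rectangle:
  assumes I: "finite I" and B: "\<And>i. i \<in> I \<Longrightarrow> B i \<in> sets borel" "\<And>i. i \<in> I \<Longrightarrow> bounded (B i)"
    and disj: "disjoint_family_on B I" and C: "\<And>i. i \<in> I \<Longrightarrow> C i \<in> sets borel"
  shows "emeasure (tuple_measure I) (\<Pi>\<^sub>E i\<in>I. B i \<times> C i) = emeasure (Pi\<^sub>M I (\<lambda>_. intensity)) (\<Pi>\<^sub>E i\<in>I. B i \<times> C i)"
proof -
  let ?R = "\<Pi>\<^sub>E i\<in>I. B i \<times> C i" and ?N = "count_space (index_tuples I)"
  interpret N: sigma_finite_measure ?N by (rule sigma_finite_index_tuples[OF I])
  interpret NP: pair_sigma_finite ?N P ..
  have R: "?R \<in> sets (Pi\<^sub>M I (\<lambda>_. borel \<Otimes>\<^sub>M borel))"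
    using I B C by (intro sets_PiM_I_finite) auto
  note pt [measurable] = measurable_point_tuple[OF I]
  have [measurable]: "{\<omega>\<in>space P. \<forall>i\<in>I. t (l i) \<omega> \<in> B i} \<in> sets P" for l
    using I B by measurable
  have "emeasure (tuple_measure I) ?R = emeasure (?N \<Otimes>\<^sub>M P) (point_tuple I -` ?R \<inter> space (?N \<Otimes>\<^sub>M P))"
    unfolding tuple_measure_def by (rule emeasure_distr[OF pt R])
  also have "\<dots> = (\<integral>\<^sup>+l. emeasure P (Pair l -` (point_tuple I -` ?R \<inter> space (?N \<Otimes>\<^sub>M P))) \<partial>?N)"
    using measurable_sets[OF pt R] by (rule emeasure_pair_measure_alt)
  also have "\<dots> = (\<integral>\<^sup>+l. (\<Prod>i\<in>I. emeasure \<nu> (C i)) * emeasure P {\<omega>\<in>space P. \<forall>i\<in>I. t (l i) \<omega> \<in> B i} \<partial>?N)"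
  proof (intro nn_integral_cong)
    fix l assume l: "l \<in> space ?N"
    then have "Pair l -` (point_tuple I -` ?R \<inter> space (?N \<Otimes>\<^sub>M P)) = {\<omega>\<in>space P. \<forall>i\<in>I. marked_point (l i) \<omega> \<in> B i \<times> C i}"
      by (auto simp: point_tuple_def space_pair_measure PiE_iff)
    with l show "emeasure P (Pair l -` (point_tuple I -` ?R \<inter> space (?N \<Otimes>\<^sub>M P)))
       = (\<Prod>i\<in>I. emeasure \<nu> (C i)) * emeasure P {\<omega>\<in>space P. \<forall>i\<in>I. t (l i) \<omega> \<in> B i}"
      using prob_marked_rectangle[OF I, of l B C] B C by (simp add: index_tuples_def)
  qed
  also have "\<dots> = (\<Prod>i\<in>I. emeasure \<nu> (C i)) * (\<integral>\<^sup>+l. emeasure P {\<omega>\<in>space P. \<forall>i\<in>I. t (l i) \<omega> \<in> B i} \<partial>?N)"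
    by (intro nn_integral_cmult) simp
  also have "(\<integral>\<^sup>+l. emeasure P {\<omega>\<in>space P. \<forall>i\<in>I. t (l i) \<omega> \<in> B i} \<partial>?N)
      = (\<integral>\<^sup>+l. \<integral>\<^sup>+\<omega>. indicator {\<omega>\<in>space P. \<forall>i\<in>I. t (l i) \<omega> \<in> B i} \<omega> \<partial>P \<partial>?N)"
    by simp
  \<comment> \<open>Exchanging the order turns a sum of probabilities over fixed indices into the
    expectation of a random number of tuples.\<close>
  also have "\<dots> = (\<integral>\<^sup>+\<omega>. \<integral>\<^sup>+l. indicator {\<omega>\<in>space P. \<forall>i\<in>I. t (l i) \<omega> \<in> B i} \<omega> \<partial>?N \<partial>P)"
    by (intro NP.Fubini'[symmetric] measurable_pair_measure_countable1 countable_index_tuples I) simp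
  also have "\<dots> = (\<integral>\<^sup>+\<omega>. (\<Prod>i\<in>I. of_nat (points_in t (B i) \<omega>)) \<partial>P)"
  proof (rule nn_integral_cong_AE)
    show "AE \<omega> in P. (\<integral>\<^sup>+l. indicator {\<omega>\<in>space P. \<forall>i\<in>I. t (l i) \<omega> \<in> B i} \<omega> \<partial>?N) = (\<Prod>i\<in>I. of_nat (points_in t (B i) \<omega>))"
      using AE_points_finite AE_space
    proof eventually_elim
      case (elim \<omega>)
      let ?A = "\<lambda>i. {m. t m \<omega> \<in> B i}"
      have fin: "finite (?A i)" if "i \<in> I" for i using elim B that by blast
      have inj: "inj_on l I" if "l \<in> PiE I ?A" for l
      proof (rule inj_onI, rule ccontr)
        fix i j assume ij: "i \<in> I" "j \<in> I" "l i = l j" "i \<noteq> j"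
        then have "t (l i) \<omega> \<in> B i \<inter> B j" using that by (force simp: PiE_iff)
        then show False using disj ij by (auto simp: disjoint_family_on_def)
      qed
      have "(\<integral>\<^sup>+l. indicator {\<omega>\<in>space P. \<forall>i\<in>I. t (l i) \<omega> \<in> B i} \<omega> \<partial>?N) = (\<integral>\<^sup>+l. indicator (PiE I ?A) l \<partial>?N)"
        using elim by (intro nn_integral_cong) (auto simp: index_tuples_def indicator_def PiE_iff)
      also have "\<dots> = emeasure ?N (PiE I ?A)"
        using inj by (intro nn_integral_indicator) (auto simp: index_tuples_def)
      also have "\<dots> = of_nat (card (PiE I ?A))"
        using inj fin I by (subst emeasure_count_space_finite) (auto simp: index_tuples_def intro!: finite_PiE)
      also have "\<dots> = (\<Prod>i\<in>I. of_nat (points_in t (B i) \<omega>))"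
        by (simp add: card_PiE[OF I] points_in_def)
      finally show ?case .
    qed
  qed
  also have "\<dots> = (\<Prod>i\<in>I. emeasure lborel (B i))"
    using I B disj by (rule nn_integral_prod_points_in)
  also have "(\<Prod>i\<in>I. emeasure \<nu> (C i)) * \<dots> = (\<Prod>i\<in>I. emeasure intensity (B i \<times> C i))"
    unfolding prod.distrib[symmetric] intensity_def
    by (intro prod.cong refl) (simp add: \<nu>.emeasure_pair_measure_Times B C sets_\<nu> mult.commute)
  also have "\<dots> = emeasure (Pi\<^sub>M I (\<lambda>_. intensity)) ?R"
  proof -
    interpret product_sigma_finite "\<lambda>_::nat. intensity"
      by (simp add: product_sigma_finite_def sigma_finite_intensity)
    show ?thesis
      using I B C by (intro emeasure_PiM[symmetric]) (auto simp: sets_intensity)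
  qed
  finally show ?thesis .
qed

end

lemma bounded_greaterThanLessThan: "bounded {a<..<b::real}"
  by (rule bounded_subset[of "{a..b}"]) auto

section \<open>Identification of the factorial moment measure\<close>

context infinite_source_poisson
begin

definition off_diagonal :: "nat set \<Rightarrow> (nat \<Rightarrow> real \<times> real \<times> real) set" where
  "off_diagonal I = {x \<in> I \<rightarrow>\<^sub>E UNIV. inj_on (\<lambda>i. fst (x i)) I}"

text \<open>Only for disjoint time sides is the moment known directly. These sets generate the
  sigma-algebra off the diagonal and nothing across it, which is why the diagonal is split
  off.\<close>

definition rectangles :: "nat set \<Rightarrow> (nat \<Rightarrow> real \<times> real \<times> real) set set" where
  "rectangles I = {\<Pi>\<^sub>E i\<in>I. B i \<times> C i | B C. (\<forall>i\<in>I. B i \<in> sets borel \<and> bounded (B i) \<and> C i \<in> sets borel)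
     \<and> disjoint_family_on B I}"

text \<open>Index set of a countable cover of the off-diagonal set by boxes of finite measure, as
  uniqueness of measures requires.\<close>

definition rational_boxes :: "nat set \<Rightarrow> (nat \<Rightarrow> rat \<times> rat) set" where
  "rational_boxes I = {q \<in> I \<rightarrow>\<^sub>E UNIV. disjoint_family_on (\<lambda>i. {of_rat (fst (q i)) <..< of_rat (snd (q i)) :: real}) I}"

lemma countable_rational_boxes: "finite I \<Longrightarrow> countable (rational_boxes I)"
  unfolding rational_boxes_def
  by (rule countable_subset[of _ "I \<rightarrow>\<^sub>E UNIV"]) (auto intro: countable_PiE)

lemma rational_boxes_cover:
  assumes I: "finite I" and x: "x \<in> off_diagonal I"
  obtains q where "q \<in> rational_boxes I" "\<And>i. i \<in> I \<Longrightarrow> fst (x i) \<in> {of_rat (fst (q i)) <..< of_rat (snd (q i))}"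
proof -
  define y where "y = (\<lambda>i. fst (x i))"
  have inj: "inj_on y I" using x by (auto simp: off_diagonal_def y_def)
  have "\<exists>d>0. \<forall>i\<in>I. \<forall>j\<in>I. i \<noteq> j \<longrightarrow> 2 * d \<le> \<bar>y i - y j\<bar>"
  proof -
    \<comment> \<open>The added 1 keeps the set nonempty when \<open>I\<close> has at most one
      element.\<close>
    let ?D = "insert 1 ((\<lambda>(i, j). \<bar>y i - y j\<bar>) ` {(i, j) \<in> I \<times> I. i \<noteq> j})"
    have fin: "finite ?D" using I by (auto intro: finite_subset[of _ "I \<times> I"])
    have pos: "Min ?D > 0" using fin inj by (subst Min_gr_iff) (auto simp: inj_on_def)
    show ?thesis
    proof (intro exI[of _ "Min ?D / 2"] conjI ballI impI)
      fix i j assume "i \<in> I" "j \<in> I" "i \<noteq> j"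
      then have "Min ?D \<le> \<bar>y i - y j\<bar>" using fin by (intro Min_le) auto
      then show "2 * (Min ?D / 2) \<le> \<bar>y i - y j\<bar>" by simp
    qed (use pos in simp)
  qed
  then obtain d where d: "d > 0" "\<And>i j. i \<in> I \<Longrightarrow> j \<in> I \<Longrightarrow> i \<noteq> j \<Longrightarrow> 2 * d \<le> \<bar>y i - y j\<bar>" by blast
  \<comment> \<open>Intervals of radius d about points at mutual distance at least 2 d are
    disjoint.\<close>
  have "\<exists>a b. y i - d < real_of_rat a \<and> real_of_rat a < y i \<and> y i < real_of_rat b \<and> real_of_rat b < y i + d" for i
    using of_rat_dense[of "y i - d" "y i"] of_rat_dense[of "y i" "y i + d"] d by auto
  then obtain a b where ab: "\<And>i. y i - d < real_of_rat (a i)" "\<And>i. real_of_rat (a i) < y i"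
     "\<And>i. y i < real_of_rat (b i)" "\<And>i. real_of_rat (b i) < y i + d" by metis
  let ?q = "\<lambda>i\<in>I. (a i, b i)"
  have "?q \<in> rational_boxes I"
    unfolding rational_boxes_def disjoint_family_on_def
  proof (intro CollectI conjI ballI impI)
    fix i j assume ij: "i \<in> I" "j \<in> I" "i \<noteq> j"
    show "{real_of_rat (fst (?q i))<..<real_of_rat (snd (?q i))} \<inter> {real_of_rat (fst (?q j))<..<real_of_rat (snd (?q j))} = {}"
      using ij d(2)[OF ij] ab(1)[of i] ab(4)[of i] ab(1)[of j] ab(4)[of j] by (auto simp: abs_if split: if_splits)
  qed auto
  then show thesis
    using ab by (intro that[of ?q]) (auto simp: y_def)
qed

lemma rectangles_subset: "rectangles I \<subseteq> Pow (off_diagonal I)"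
proof -
  have "inj_on (\<lambda>i. fst (x i)) I" if "disjoint_family_on B I" "x \<in> (\<Pi>\<^sub>E i\<in>I. B i \<times> C i)" for B and C :: "nat \<Rightarrow> (real \<times> real) set" and x :: "nat \<Rightarrow> real \<times> real \<times> real"
  proof (rule inj_onI, rule ccontr)
    fix i j assume ij: "i \<in> I" "j \<in> I" "fst (x i) = fst (x j)" "i \<noteq> j"
    then have "fst (x i) \<in> B i \<inter> B j" using that by (force simp: PiE_iff)
    then show False using that ij by (auto simp: disjoint_family_on_def)
  qed
  then show ?thesis
    unfolding rectangles_def off_diagonal_def by (auto simp: PiE_iff)
qed

lemma rectangles_Int_stable: "Int_stable (rectangles I)"
proof (rule Int_stableI)
  fix X Y assume "X \<in> rectangles I" "Y \<in> rectangles I"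
  then obtain B C B' C' where X: "X = (\<Pi>\<^sub>E i\<in>I. B i \<times> C i)" "\<forall>i\<in>I. B i \<in> sets borel \<and> bounded (B i) \<and> C i \<in> sets borel" "disjoint_family_on B I"
    and Y: "Y = (\<Pi>\<^sub>E i\<in>I. B' i \<times> C' i)" "\<forall>i\<in>I. B' i \<in> sets borel \<and> bounded (B' i) \<and> C' i \<in> sets borel"
    unfolding rectangles_def by blast
  have "X \<inter> Y = (\<Pi>\<^sub>E i\<in>I. (B i \<inter> B' i) \<times> (C i \<inter> C' i))"
    unfolding X Y by (auto simp: PiE_iff mem_Times_iff)
  moreover have "disjoint_family_on (\<lambda>i. B i \<inter> B' i) I"
    using X(3) unfolding disjoint_family_on_def by blast
  ultimately show "X \<inter> Y \<in> rectangles I"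
    unfolding rectangles_def using X(2) Y(2)
    by (intro CollectI exI[of _ "\<lambda>i. B i \<inter> B' i"] exI[of _ "\<lambda>i. C i \<inter> C' i"]) (auto intro: bounded_subset)
qed

text \<open>It is enough that the identity, read coordinatewise, is measurable for the generated
  sigma-algebra. A condition on one coordinate becomes a countable union of rectangles by
  intersecting it with every rational box.\<close>

lemma sets_off_diagonal:
  assumes I: "finite I" and X: "X \<in> sets (Pi\<^sub>M I (\<lambda>_. borel \<Otimes>\<^sub>M borel))"
  shows "X \<inter> off_diagonal I \<in> sigma_sets (off_diagonal I) (rectangles I)"
proof -
  let ?S = "sigma (off_diagonal I) (rectangles I)"
  have space: "space ?S = off_diagonal I"
    using rectangles_subset by simp
  have sets: "sets ?S = sigma_sets (off_diagonal I) (rectangles I)"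
    using rectangles_subset by simp
  have "(\<lambda>x. \<lambda>i\<in>I. (fst (x i), snd (x i))) \<in> ?S \<rightarrow>\<^sub>M Pi\<^sub>M I (\<lambda>_. borel \<Otimes>\<^sub>M borel)"
  proof (intro measurable_restrict measurable_Pair)
    have *: "{x \<in> off_diagonal I. fst (x i) \<in> A \<and> snd (x i) \<in> D} \<in> sets ?S"
      if i: "i \<in> I" and A: "A \<in> sets borel" and D: "D \<in> sets borel" for i A D
    proof -
      let ?J = "\<lambda>q i. {real_of_rat (fst (q i)) <..< real_of_rat (snd (q i))}"
      let ?R = "\<lambda>q. \<Pi>\<^sub>E j\<in>I. (if j = i then ?J q j \<inter> A else ?J q j) \<times> (if j = i then D else UNIV)"
      have rect: "?R q \<in> rectangles I" if q: "q \<in> rational_boxes I" for q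
      proof -
        define B where "B = (\<lambda>j. if j = i then ?J q j \<inter> A else ?J q j)"
        define C where "C = (\<lambda>j. if j = i then D else UNIV)"
        have sub: "B j \<subseteq> ?J q j" for j by (simp add: B_def)
        have "disjoint_family_on (?J q) I" using q by (simp add: rational_boxes_def)
        then have "disjoint_family_on B I"
          using sub unfolding disjoint_family_on_def by blast
        moreover have "B j \<in> sets borel" "bounded (B j)" "C j \<in> sets borel" for j
          using A D bounded_subset[OF bounded_greaterThanLessThan sub] by (simp_all add: B_def C_def)
        ultimately have "(\<Pi>\<^sub>E j\<in>I. B j \<times> C j) \<in> rectangles I"
          unfolding rectangles_def by blast
        then show ?thesis by (simp add: B_def C_def)
      qed
      have "(\<Union>q\<in>rational_boxes I. ?R q) \<in> sets ?S"
        unfolding sets using rect by (intro sigma_sets_UNION countable_image countable_rational_boxes I) blast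
      moreover have "(\<Union>q\<in>rational_boxes I. ?R q) = {x \<in> off_diagonal I. fst (x i) \<in> A \<and> snd (x i) \<in> D}"
      proof (intro equalityI subsetI)
        fix x assume "x \<in> (\<Union>q\<in>rational_boxes I. ?R q)"
        then obtain q where "q \<in> rational_boxes I" "x \<in> ?R q" by blast
        moreover from this have "x \<in> off_diagonal I"
          using rect rectangles_subset by blast
        ultimately show "x \<in> {x \<in> off_diagonal I. fst (x i) \<in> A \<and> snd (x i) \<in> D}"
          using i by (auto simp: PiE_iff mem_Times_iff dest!: bspec[of _ _ i])
      next
        fix x assume x: "x \<in> {x \<in> off_diagonal I. fst (x i) \<in> A \<and> snd (x i) \<in> D}"
        then obtain q where q: "q \<in> rational_boxes I" "\<And>i. i \<in> I \<Longrightarrow> fst (x i) \<in> ?J q i"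
          using rational_boxes_cover[OF I] by blast
        have "x \<in> ?R q" using q(2) x i by (auto simp: PiE_iff off_diagonal_def mem_Times_iff)
        then show "x \<in> (\<Union>q\<in>rational_boxes I. ?R q)" using q by blast
      qed
      ultimately show ?thesis by simp
    qed
    fix i assume i: "i \<in> I"
    show "(\<lambda>x. fst (x i)) \<in> ?S \<rightarrow>\<^sub>M borel"
    proof (rule measurableI)
      fix A :: "real set" assume A: "A \<in> sets borel"
      have "(\<lambda>x. fst (x i)) -` A \<inter> space ?S = {x \<in> off_diagonal I. fst (x i) \<in> A \<and> snd (x i) \<in> UNIV}"
        unfolding space by auto
      with *[OF i, of "A" UNIV] A show "(\<lambda>x. fst (x i)) -` A \<inter> space ?S \<in> sets ?S"
        by simp
    qed simp
    show "(\<lambda>x. snd (x i)) \<in> ?S \<rightarrow>\<^sub>M borel"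
    proof (rule measurableI)
      fix A :: "(real \<times> real) set" assume A: "A \<in> sets borel"
      have "(\<lambda>x. snd (x i)) -` A \<inter> space ?S = {x \<in> off_diagonal I. fst (x i) \<in> UNIV \<and> snd (x i) \<in> A}"
        unfolding space by auto
      with *[OF i, of UNIV A] A show "(\<lambda>x. snd (x i)) -` A \<inter> space ?S \<in> sets ?S"
        by simp
    qed simp
  qed
  from measurable_sets[OF this X]
  have "(\<lambda>x. \<lambda>i\<in>I. (fst (x i), snd (x i))) -` X \<inter> off_diagonal I \<in> sets ?S"
    unfolding space .
  also have "(\<lambda>x. \<lambda>i\<in>I. (fst (x i), snd (x i))) -` X \<inter> off_diagonal I = X \<inter> off_diagonal I"
  proof -
    have "(\<lambda>i\<in>I. (fst (x i), snd (x i))) = x" if "x \<in> off_diagonal I" for x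
      using that by (auto simp: off_diagonal_def PiE_iff extensional_def fun_eq_iff)
    then show ?thesis by auto
  qed
  finally show ?thesis unfolding sets .
qed

lemma measurable_same_time [measurable (raw)]:
  assumes "i \<in> I" "j \<in> I"
  shows "Measurable.pred (Pi\<^sub>M I (\<lambda>_. borel \<Otimes>\<^sub>M borel :: (real \<times> real \<times> real) measure)) (\<lambda>x. fst (x i) = fst (x j))"
proof -
  have "(\<lambda>x. fst (x k)) \<in> borel_measurable (Pi\<^sub>M I (\<lambda>_. borel \<Otimes>\<^sub>M borel :: (real \<times> real \<times> real) measure))" if "k \<in> I" for k
    using that by measurable
  from this[OF assms(1)] this[OF assms(2)] show ?thesis
    unfolding pred_def by (rule borel_measurable_eq)
qed

lemma off_diagonal_sets:
  assumes I: "finite I"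
  shows "off_diagonal I \<in> sets (Pi\<^sub>M I (\<lambda>_. borel \<Otimes>\<^sub>M borel))"
proof -
  have "off_diagonal I = {x \<in> space (Pi\<^sub>M I (\<lambda>_. borel \<Otimes>\<^sub>M borel)). \<forall>i\<in>I. \<forall>j\<in>I. i \<noteq> j \<longrightarrow> \<not> fst (x i) = fst (x j)}"
    by (auto simp: off_diagonal_def inj_on_def space_PiM space_pair_measure)
  also have "\<dots> \<in> sets (Pi\<^sub>M I (\<lambda>_. borel \<Otimes>\<^sub>M borel))"
    using I by (intro sets.sets_Collect_finite_All sets.sets_Collect_imp sets.sets_Collect_const sets.sets_Collect_neg)
      (auto simp: pred_def[symmetric] intro: measurable_same_time)
  finally show ?thesis .
qed

text \<open>Birth time has no atoms: with the other coordinates fixed, a coincidence confines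
  coordinate \<open>i\<close> to a null set.\<close>

lemma AE_PiM_off_diagonal:
  assumes I: "finite I"
  shows "AE x in Pi\<^sub>M I (\<lambda>_. intensity). x \<in> off_diagonal I"
proof -
  interpret product_sigma_finite "\<lambda>_::nat. intensity"
    by (simp add: product_sigma_finite_def sigma_finite_intensity)
  have null: "emeasure intensity {z. fst z = a} = 0" for a
  proof -
    have "{z. fst z = a} = {a} \<times> (UNIV :: (real \<times> real) set)" by auto
    then show ?thesis
      by (simp add: intensity_def \<nu>.emeasure_pair_measure_Times sets_\<nu>)
  qed
  have "AE x in Pi\<^sub>M I (\<lambda>_. intensity). fst (x i) \<noteq> fst (x j)" if ij: "i \<in> I" "j \<in> I" "i \<noteq> j" for i j
  proof -
    have meas: "{x \<in> space (Pi\<^sub>M I (\<lambda>_. intensity)). fst (x i) = fst (x j)} \<in> sets (Pi\<^sub>M I (\<lambda>_. intensity))"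
    proof -
      have "(\<lambda>x. fst (x k)) \<in> borel_measurable (Pi\<^sub>M I (\<lambda>_. intensity))" if "k \<in> I" for k
        using that by measurable
      from this[OF ij(1)] this[OF ij(2)] show ?thesis by (rule borel_measurable_eq)
    qed
    have "emeasure (Pi\<^sub>M I (\<lambda>_. intensity)) {x \<in> space (Pi\<^sub>M I (\<lambda>_. intensity)). fst (x i) = fst (x j)}
       = (\<integral>\<^sup>+x. indicator {x \<in> space (Pi\<^sub>M I (\<lambda>_. intensity)). fst (x i) = fst (x j)} x \<partial>Pi\<^sub>M (insert i (I - {i})) (\<lambda>_. intensity))"
      using meas ij by (simp add: insert_absorb)
    also have "\<dots> = (\<integral>\<^sup>+x. \<integral>\<^sup>+y. indicator {x \<in> space (Pi\<^sub>M I (\<lambda>_. intensity)). fst (x i) = fst (x j)} (x(i := y)) \<partial>intensity \<partial>Pi\<^sub>M (I - {i}) (\<lambda>_. intensity))"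
      using meas ij I by (intro product_nn_integral_insert) (auto simp: insert_absorb)
    also have "\<dots> \<le> (\<integral>\<^sup>+x. \<integral>\<^sup>+y. indicator {z. fst z = fst (x j)} y \<partial>intensity \<partial>Pi\<^sub>M (I - {i}) (\<lambda>_. intensity))"
      using ij by (intro nn_integral_mono) (auto simp: indicator_def)
    also have "\<dots> = 0"
    proof -
      have "{z. fst z = a} \<in> sets intensity" for a
      proof -
        have "{z. fst z = a} = {a} \<times> (UNIV :: (real \<times> real) set)" by auto
        also have "\<dots> \<in> sets intensity" unfolding sets_intensity by (intro pair_measureI) auto
        finally show ?thesis .
      qed
      then show ?thesis by (simp add: null)
    qed
    finally have "emeasure (Pi\<^sub>M I (\<lambda>_. intensity)) {x \<in> space (Pi\<^sub>M I (\<lambda>_. intensity)). fst (x i) = fst (x j)} = 0"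
      by simp
    then show ?thesis
      using meas by (intro AE_I[of _ _ "{x \<in> space (Pi\<^sub>M I (\<lambda>_. intensity)). fst (x i) = fst (x j)}"]) auto
  qed
  then have "AE x in Pi\<^sub>M I (\<lambda>_. intensity). \<forall>i\<in>I. \<forall>j\<in>I. i \<noteq> j \<longrightarrow> fst (x i) \<noteq> fst (x j)"
    using I by (simp add: AE_finite_all)
  then show ?thesis
    using AE_space by eventually_elim (auto simp: off_diagonal_def space_PiM inj_on_def)
qed

lemma AE_tuple_measure_off_diagonal:
  assumes I: "finite I"
  shows "AE x in tuple_measure I. x \<in> off_diagonal I"
proof -
  let ?N = "count_space (index_tuples I)"
  interpret N: sigma_finite_measure ?N by (rule sigma_finite_index_tuples[OF I])
  interpret NP: pair_sigma_finite ?N P ..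
  note pt [measurable] = measurable_point_tuple[OF I]
  have meas: "{x \<in> space (Pi\<^sub>M I (\<lambda>_. borel \<Otimes>\<^sub>M borel)). x \<in> off_diagonal I} \<in> sets (Pi\<^sub>M I (\<lambda>_. borel \<Otimes>\<^sub>M borel))"
    using off_diagonal_sets[OF I] by simp
  have "AE z in ?N \<Otimes>\<^sub>M P. point_tuple I z \<in> off_diagonal I"
  proof (rule NP.AE_pair_measure)
    show "{z \<in> space (?N \<Otimes>\<^sub>M P). point_tuple I z \<in> off_diagonal I} \<in> sets (?N \<Otimes>\<^sub>M P)"
      using off_diagonal_sets[OF I] by measurable
    show "AE l in ?N. AE \<omega> in P. point_tuple I (l, \<omega>) \<in> off_diagonal I"
    proof (rule AE_I2)
      fix l assume l: "l \<in> space ?N"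
      show "AE \<omega> in P. point_tuple I (l, \<omega>) \<in> off_diagonal I"
        using AE_points_inj
      proof eventually_elim
        case (elim \<omega>)
        then show ?case
          using l by (auto simp: point_tuple_def off_diagonal_def marked_point_def index_tuples_def inj_on_def)
      qed
    qed
  qed
  then show ?thesis
    unfolding tuple_measure_def using meas by (subst AE_distr_iff[OF pt]) auto
qed

text \<open>The rectangles are stable under intersection and generate the trace off the diagonal,
  the rational boxes supply sigma-finiteness, and neither measure charges the diagonal.\<close>

theorem tuple_measure_eq:
  assumes I: "finite I"
  shows "tuple_measure I = Pi\<^sub>M I (\<lambda>_. intensity)"
proof -
  let ?Q = "Pi\<^sub>M I (\<lambda>_. intensity)" and ?\<Omega> = "off_diagonal I"
  let ?Z = "Pi\<^sub>M I (\<lambda>_. borel \<Otimes>\<^sub>M borel :: (real \<times> real \<times> real) measure)"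
  have sQ: "sets ?Q = sets ?Z" by (intro sets_PiM_cong refl sets_intensity)
  have sT: "sets (tuple_measure I) = sets ?Z" by (simp add: tuple_measure_def)
  note \<Omega> = off_diagonal_sets[OF I]
  have sets: "sets (restrict_space M ?\<Omega>) = sigma_sets ?\<Omega> (rectangles I)" if M: "sets M = sets ?Z" for M
  proof
    show "sets (restrict_space M ?\<Omega>) \<subseteq> sigma_sets ?\<Omega> (rectangles I)"
      using sets_off_diagonal[OF I] unfolding sets_restrict_space M by (auto simp: Int_commute)
    have "rectangles I \<subseteq> sets (restrict_space M ?\<Omega>)"
    proof
      fix X assume X: "X \<in> rectangles I"
      then have "X \<subseteq> ?\<Omega>" using rectangles_subset by auto
      moreover from X have "X \<in> sets ?Z"
        unfolding rectangles_def using I by (auto intro!: sets_PiM_I_finite)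
      ultimately show "X \<in> sets (restrict_space M ?\<Omega>)"
        unfolding sets_restrict_space M by auto
    qed
    moreover have "space (restrict_space M ?\<Omega>) = ?\<Omega>"
      using \<Omega> sets.sets_into_space[of ?\<Omega> M] M by (auto simp: space_restrict_space)
    ultimately show "sigma_sets ?\<Omega> (rectangles I) \<subseteq> sets (restrict_space M ?\<Omega>)"
      by (metis sets.sigma_sets_subset)
  qed
  have "restrict_space (tuple_measure I) ?\<Omega> = restrict_space ?Q ?\<Omega>"
  proof (rule measure_eqI_generator_eq_countable[OF rectangles_Int_stable rectangles_subset _ sets[OF sT] sets[OF sQ]])
    have eq: "emeasure (restrict_space M ?\<Omega>) X = emeasure M X" if "X \<in> rectangles I" "sets M = sets ?Z" for M X
      using that \<Omega> rectangles_subset sets.sets_into_space[of ?\<Omega> M] by (intro emeasure_restrict_space) auto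
    show "emeasure (restrict_space (tuple_measure I) ?\<Omega>) X = emeasure (restrict_space ?Q ?\<Omega>) X" if "X \<in> rectangles I" for X
      using that tuple_measure_rectangle[OF I] by (auto simp: eq[OF that sT] eq[OF that sQ] rectangles_def)
    let ?R = "\<lambda>q. \<Pi>\<^sub>E j\<in>I. {real_of_rat (fst (q j)) <..< real_of_rat (snd (q j))} \<times> (UNIV :: (real \<times> real) set)"
    show "?R ` rational_boxes I \<subseteq> rectangles I"
    proof safe
      fix q assume "q \<in> rational_boxes I"
      then show "?R q \<in> rectangles I"
        unfolding rectangles_def rational_boxes_def
        by (intro CollectI exI[of _ "\<lambda>j. {real_of_rat (fst (q j)) <..< real_of_rat (snd (q j))}"] exI[of _ "\<lambda>_. UNIV"]) auto
    qed
    then show "\<Union>(?R ` rational_boxes I) = ?\<Omega>"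
    proof (intro equalityI subsetI)
      fix x assume x: "x \<in> ?\<Omega>"
      then obtain q where q: "q \<in> rational_boxes I" "\<And>i. i \<in> I \<Longrightarrow> fst (x i) \<in> {real_of_rat (fst (q i)) <..< real_of_rat (snd (q i))}"
        using rational_boxes_cover[OF I] by blast
      have "x \<in> ?R q" using x q(2) by (auto simp: PiE_iff off_diagonal_def mem_Times_iff)
      then show "x \<in> \<Union>(?R ` rational_boxes I)" using q(1) by blast
    qed (use rectangles_subset in blast)
    show "countable (?R ` rational_boxes I)"
      using countable_rational_boxes[OF I] by simp
    fix a assume "a \<in> ?R ` rational_boxes I"
    then obtain q where q: "q \<in> rational_boxes I" "a = ?R q" by blast
    have a: "a \<in> rectangles I" using q \<open>?R ` rational_boxes I \<subseteq> rectangles I\<close> by blast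
    have "emeasure (restrict_space (tuple_measure I) ?\<Omega>) a = emeasure ?Q a"
      using tuple_measure_rectangle[OF I, of "\<lambda>j. {real_of_rat (fst (q j)) <..< real_of_rat (snd (q j))}" "\<lambda>_. UNIV"] q(1)
      unfolding eq[OF a sT] unfolding q(2) rational_boxes_def by auto
    also have "\<dots> = (\<Prod>j\<in>I. emeasure intensity ({real_of_rat (fst (q j)) <..< real_of_rat (snd (q j))} \<times> UNIV))"
    proof -
      interpret product_sigma_finite "\<lambda>_::nat. intensity"
        by (simp add: product_sigma_finite_def sigma_finite_intensity)
      show ?thesis
        unfolding q(2) using I by (intro emeasure_PiM) (auto simp: sets_intensity)
    qed
    also have "\<dots> = (\<Prod>j\<in>I. emeasure lborel {real_of_rat (fst (q j)) <..< real_of_rat (snd (q j))})"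
      using \<nu>.emeasure_space_1
      by (intro prod.cong refl) (simp add: intensity_def \<nu>.emeasure_pair_measure_Times sets_\<nu>)
    also have "\<dots> = ennreal (\<Prod>j\<in>I. measure lborel {real_of_rat (fst (q j)) <..< real_of_rat (snd (q j))})"
      using emeasure_bounded_finite[OF bounded_greaterThanLessThan]
      by (subst prod_ennreal[symmetric]) (auto intro!: prod.cong emeasure_eq_ennreal_measure simp: less_top[symmetric] simp del: emeasure_lborel_Ioo)
    also have "\<dots> < \<infinity>" by simp
    finally show "emeasure (restrict_space (tuple_measure I) ?\<Omega>) a \<noteq> \<infinity>" by simp
  qed
  then have eq: "emeasure (tuple_measure I) (X \<inter> ?\<Omega>) = emeasure ?Q (X \<inter> ?\<Omega>)" if "X \<in> sets ?Z" for X
    using that \<Omega> sQ sT emeasure_restrict_space[of ?\<Omega> "tuple_measure I" "X \<inter> ?\<Omega>"] emeasure_restrict_space[of ?\<Omega> ?Q "X \<inter> ?\<Omega>"]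
    by (metis inf.cobounded2 sets.Int_space_eq2)
  show ?thesis
  proof (rule measure_eqI)
    show "sets (tuple_measure I) = sets ?Q" using sT sQ by simp
    fix X assume "X \<in> sets (tuple_measure I)"
    then have X: "X \<in> sets ?Z" using sT by simp
    have "emeasure M X = emeasure M (X \<inter> ?\<Omega>)" if "sets M = sets ?Z" "AE x in M. x \<in> ?\<Omega>" for M
      using that X \<Omega> by (intro emeasure_eq_AE) auto
    then show "emeasure (tuple_measure I) X = emeasure ?Q X"
      using eq[OF X] sQ sT AE_PiM_off_diagonal[OF I] AE_tuple_measure_off_diagonal[OF I] by simp
  qed
qed

text \<open>The sum over distinct points is one marginal of an integral over counting measure times
  \<open>P\<close>. Its total is the integral of a product function against the factorial moment
  measure, which factorises.\<close>

lemma factorial_moment: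
  fixes g :: "nat \<Rightarrow> real \<times> real \<times> real \<Rightarrow> real"
  assumes I: "finite I" and g: "\<And>i. i \<in> I \<Longrightarrow> integrable intensity (g i)"
  shows "integrable P (\<lambda>\<omega>. \<integral>l. (\<Prod>i\<in>I. g i (marked_point (l i) \<omega>)) \<partial>count_space (index_tuples I))"
    and "(\<integral>\<omega>. (\<integral>l. (\<Prod>i\<in>I. g i (marked_point (l i) \<omega>)) \<partial>count_space (index_tuples I)) \<partial>P) = (\<Prod>i\<in>I. integral\<^sup>L intensity (g i))"
proof -
  interpret product_sigma_finite "\<lambda>_::nat. intensity"
    by (simp add: product_sigma_finite_def sigma_finite_intensity)
  let ?N = "count_space (index_tuples I)"
  let ?Z = "Pi\<^sub>M I (\<lambda>_. borel \<Otimes>\<^sub>M borel :: (real \<times> real \<times> real) measure)"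
  interpret N: sigma_finite_measure ?N by (rule sigma_finite_index_tuples[OF I])
  interpret NP: pair_sigma_finite ?N P ..
  note pt [measurable] = measurable_point_tuple[OF I]
  have "integrable (Pi\<^sub>M I (\<lambda>_. intensity)) (\<lambda>x. \<Prod>i\<in>I. g i (x i))"
    using I g by (rule product_integrable_prod)
  then have int: "integrable (tuple_measure I) (\<lambda>x. \<Prod>i\<in>I. g i (x i))"
    by (simp add: tuple_measure_eq[OF I])
  have [measurable]: "(\<lambda>x. \<Prod>i\<in>I. g i (x i)) \<in> borel_measurable ?Z"
    using int by (simp add: tuple_measure_def borel_measurable_integrable)
  have eq: "(\<Prod>i\<in>I. g i (point_tuple I (l, \<omega>) i)) = (\<Prod>i\<in>I. g i (marked_point (l i) \<omega>))" for l \<omega>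
    by (intro prod.cong) (auto simp: point_tuple_def)
  have eq': "(\<lambda>(l, \<omega>). \<Prod>i\<in>I. g i (marked_point (l i) \<omega>)) = (\<lambda>z. \<Prod>i\<in>I. g i (point_tuple I z i))"
    by (rule ext) (simp only: eq split_paired_all prod.case)
  have "integrable (?N \<Otimes>\<^sub>M P) (\<lambda>z. \<Prod>i\<in>I. g i (point_tuple I z i))"
    using int unfolding tuple_measure_def by (subst (asm) integrable_distr_eq) simp_all
  then have int': "integrable (?N \<Otimes>\<^sub>M P) (\<lambda>(l, \<omega>). \<Prod>i\<in>I. g i (marked_point (l i) \<omega>))"
    by (simp add: eq')
  have "integral\<^sup>L (?N \<Otimes>\<^sub>M P) (\<lambda>(l, \<omega>). \<Prod>i\<in>I. g i (marked_point (l i) \<omega>)) = integral\<^sup>L (tuple_measure I) (\<lambda>x. \<Prod>i\<in>I. g i (x i))"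
    unfolding tuple_measure_def by (subst integral_distr) (simp_all add: eq' )
  also have "\<dots> = (\<Prod>i\<in>I. integral\<^sup>L intensity (g i))"
    unfolding tuple_measure_eq[OF I] using I g by (rule product_integral_prod)
  finally have val: "integral\<^sup>L (?N \<Otimes>\<^sub>M P) (\<lambda>(l, \<omega>). \<Prod>i\<in>I. g i (marked_point (l i) \<omega>)) = (\<Prod>i\<in>I. integral\<^sup>L intensity (g i))" .
  show "integrable P (\<lambda>\<omega>. \<integral>l. (\<Prod>i\<in>I. g i (marked_point (l i) \<omega>)) \<partial>?N)"
    using NP.integrable_snd[OF int'] .
  show "(\<integral>\<omega>. (\<integral>l. (\<Prod>i\<in>I. g i (marked_point (l i) \<omega>)) \<partial>?N) \<partial>P) = (\<Prod>i\<in>I. integral\<^sup>L intensity (g i))"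
    using NP.integral_snd[OF int'] val by simp
qed

end

section \<open>Variance of a sum of squares\<close>

text \<open>Cauchy-Schwarz over the nonzero terms only. Under bounded overlap the factor is then a
  constant and does not grow with \<open>K\<close>.\<close>

lemma sum_power2_le_card:
  fixes a :: "'k \<Rightarrow> real"
  assumes "finite K"
  shows "(\<Sum>k\<in>K. a k)\<^sup>2 \<le> real (card {k\<in>K. a k \<noteq> 0}) * (\<Sum>k\<in>K. (a k)\<^sup>2)"
proof -
  let ?K = "{k\<in>K. a k \<noteq> 0}"
  have "(\<Sum>k\<in>K. a k)\<^sup>2 = (\<Sum>k\<in>?K. 1 * a k)\<^sup>2"
    using assms by (intro arg_cong[where f="\<lambda>x. x\<^sup>2"]) (auto intro!: sum.mono_neutral_right)
  also have "\<dots> \<le> (\<Sum>k\<in>?K. 1\<^sup>2) * (\<Sum>k\<in>?K. (a k)\<^sup>2)"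
    by (rule Cauchy_Schwarz_ineq_sum)
  also have "\<dots> \<le> real (card ?K) * (\<Sum>k\<in>K. (a k)\<^sup>2)"
    using assms by (auto intro!: mult_left_mono sum_mono2)
  finally show ?thesis .
qed

section \<open>Sums over tuples of distinct points\<close>

definition injections :: "nat \<Rightarrow> 'b set \<Rightarrow> (nat \<Rightarrow> 'b) set" where
  "injections m S = {l \<in> {..<m} \<rightarrow>\<^sub>E S. inj_on l {..<m}}"

definition distinct_sum :: "'b set \<Rightarrow> ('b \<Rightarrow> 'c) \<Rightarrow> ('c \<Rightarrow> real) list \<Rightarrow> real" where
  "distinct_sum S x gs = (\<Sum>l\<in>injections (length gs) S. \<Prod>i<length gs. (gs ! i) (x (l i)))"

lemma finite_injections: "finite S \<Longrightarrow> finite (injections m S)"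
  unfolding injections_def by (rule finite_subset[of _ "{..<m} \<rightarrow>\<^sub>E S"]) (auto intro: finite_PiE)

lemma injections_Suc:
  "injections (Suc m) S = (\<lambda>(l, a). l(m := a)) ` (SIGMA l:injections m S. S - l ` {..<m})"
proof (intro equalityI subsetI)
  fix l assume l: "l \<in> injections (Suc m) S"
  have inj: "inj_on l {..<Suc m}" using l by (simp add: injections_def)
  have "(l(m := undefined))(m := l m) = l" by simp
  moreover have "l(m := undefined) \<in> injections m S"
    using l by (auto simp: injections_def PiE_iff extensional_def inj_on_def)
  moreover have "l m \<in> S - (l(m := undefined)) ` {..<m}"
  proof -
    have "l m \<noteq> l i" if "i < m" for i
      using that inj by (metis inj_on_eq_iff lessThan_iff less_SucI lessI nat_neq_iff)
    then show ?thesis using l by (auto simp: injections_def PiE_iff)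
  qed
  ultimately show "l \<in> (\<lambda>(l, a). l(m := a)) ` (SIGMA l:injections m S. S - l ` {..<m})"
    by (intro image_eqI[of _ _ "(l(m := undefined), l m)"]) auto
next
  fix l assume "l \<in> (\<lambda>(l, a). l(m := a)) ` (SIGMA l:injections m S. S - l ` {..<m})"
  then obtain k a where "l = k(m := a)" "k \<in> injections m S" "a \<in> S" "a \<notin> k ` {..<m}" by auto
  then show "l \<in> injections (Suc m) S"
    by (auto simp: injections_def PiE_iff extensional_def inj_on_def less_Suc_eq)
qed

lemma inj_on_extend: "inj_on (\<lambda>(l, a). l(m := a)) (SIGMA l:injections m S. A l)"
proof (rule inj_onI, clarsimp)
  fix l a l' a' assume l: "l \<in> injections m S" "l' \<in> injections m S" and eq: "l(m := a) = l'(m := a')"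
  have "l i = l' i" for i
  proof (cases "i = m")
    case True
    then show ?thesis using l by (auto simp: injections_def PiE_iff extensional_def)
  next
    case False
    then show ?thesis using fun_cong[OF eq, of i] by simp
  qed
  then show "l = l' \<and> a = a'" using fun_cong[OF eq, of m] by (auto simp: fun_eq_iff)
qed

text \<open>The new index either differs from all indices of the tuple, which lengthens the list, or
  equals exactly one of them, which multiplies \<open>f\<close> into that entry.\<close>

lemma distinct_sum_mult:
  assumes S: "finite S"
  shows "(\<Sum>a\<in>S. f (x a)) * distinct_sum S x gs
     = distinct_sum S x (gs @ [f]) + (\<Sum>i<length gs. distinct_sum S x (gs[i := \<lambda>z. (gs ! i) z * f z]))"
proof -
  let ?m = "length gs"
  let ?p = "\<lambda>l. \<Prod>i<?m. (gs ! i) (x (l i))"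
  have "distinct_sum S x (gs @ [f])
      = (\<Sum>l\<in>injections ?m S. \<Sum>a\<in>S - l ` {..<?m}. ?p l * f (x a))"
  proof -
    have "distinct_sum S x (gs @ [f]) = (\<Sum>l\<in>injections (Suc ?m) S. ?p l * f (x (l ?m)))"
      unfolding distinct_sum_def by (simp add: nth_append)
    also have "\<dots> = (\<Sum>(l, a)\<in>(SIGMA l:injections ?m S. S - l ` {..<?m}). ?p l * f (x a))"
      unfolding injections_Suc
      by (subst sum.reindex[OF inj_on_extend]) (auto intro!: sum.cong prod.cong simp: case_prod_unfold)
    also have "\<dots> = (\<Sum>l\<in>injections ?m S. \<Sum>a\<in>S - l ` {..<?m}. ?p l * f (x a))"
      using S by (subst sum.Sigma) (auto intro: finite_injections)
    finally show ?thesis .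
  qed
  also have "\<dots> = (\<Sum>l\<in>injections ?m S. ?p l * (\<Sum>a\<in>S. f (x a)) - (\<Sum>i<?m. ?p l * f (x (l i))))"
  proof (intro sum.cong refl)
    fix l assume l: "l \<in> injections ?m S"
    have "(\<Sum>a\<in>S - l ` {..<?m}. f (x a)) = (\<Sum>a\<in>S. f (x a)) - (\<Sum>a\<in>l ` {..<?m}. f (x a))"
      using l S by (intro sum_diff) (auto simp: injections_def)
    also have "(\<Sum>a\<in>l ` {..<?m}. f (x a)) = (\<Sum>i<?m. f (x (l i)))"
      using l by (subst sum.reindex) (auto simp: injections_def)
    finally show "(\<Sum>a\<in>S - l ` {..<?m}. ?p l * f (x a)) = ?p l * (\<Sum>a\<in>S. f (x a)) - (\<Sum>i<?m. ?p l * f (x (l i)))"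
      by (simp add: sum_distrib_left[symmetric] right_diff_distrib)
  qed
  also have "\<dots> = (\<Sum>a\<in>S. f (x a)) * distinct_sum S x gs - (\<Sum>i<?m. \<Sum>l\<in>injections ?m S. ?p l * f (x (l i)))"
    unfolding sum_subtractf distinct_sum_def
    by (subst sum.swap) (simp add: sum_distrib_left sum_distrib_right mult.commute)
  also have "(\<Sum>i<?m. \<Sum>l\<in>injections ?m S. ?p l * f (x (l i))) = (\<Sum>i<?m. distinct_sum S x (gs[i := \<lambda>z. (gs ! i) z * f z]))"
  proof (intro sum.cong refl)
    fix i assume i: "i \<in> {..<?m}"
    have "?p l * f (x (l i)) = (\<Prod>j<?m. (gs[i := \<lambda>z. (gs ! i) z * f z] ! j) (x (l j)))" for l
      using i by (simp add: prod.remove[of "{..<?m}" i] nth_list_update mult_ac)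
    then show "(\<Sum>l\<in>injections ?m S. ?p l * f (x (l i))) = distinct_sum S x (gs[i := \<lambda>z. (gs ! i) z * f z])"
      by (simp add: distinct_sum_def)
  qed
  finally show ?thesis by simp
qed

context infinite_source_poisson
begin

text \<open>The summation runs over all tuples of integers, so that the moment formula applies as it
  stands. When the functions live on a bounded time interval it reduces, almost surely, to a finite
  sum, where the product rule is available.\<close>

definition point_sum :: "(real \<times> real \<times> real \<Rightarrow> real) list \<Rightarrow> 'a \<Rightarrow> real" where
  "point_sum gs \<omega> = (\<integral>l. (\<Prod>i<length gs. (gs ! i) (marked_point (l i) \<omega>)) \<partial>count_space (index_tuples {..<length gs}))"

lemma point_sum_moment:
  assumes "\<And>g. g \<in> set gs \<Longrightarrow> integrable intensity g"
  shows "integrable P (point_sum gs)" "expectation (point_sum gs) = prod_list (map (integral\<^sup>L intensity) gs)"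
proof -
  have "integrable intensity (gs ! i)" if "i \<in> {..<length gs}" for i
    using assms that by simp
  note * = factorial_moment[OF _ this, of "{..<length gs}", simplified]
  show "integrable P (point_sum gs)"
    unfolding point_sum_def using * by simp
  show "expectation (point_sum gs) = prod_list (map (integral\<^sup>L intensity) gs)"
    unfolding point_sum_def using * by (simp add: prod.list_conv_set_nth atLeast0LessThan)
qed

definition window :: "real \<Rightarrow> 'a \<Rightarrow> int set" where
  "window b \<omega> = {l. t l \<omega> \<in> {0..b}}"

lemma AE_finite_window: "AE \<omega> in P. \<forall>b. finite (window b \<omega>)"
  using AE_points_finite unfolding window_def by eventually_elim (use bounded_closed_interval in blast)

lemma point_sum_eq_distinct_sum:
  assumes supp: "\<And>g z. g \<in> set gs \<Longrightarrow> g z \<noteq> 0 \<Longrightarrow> fst z \<in> {0..b}" and fin: "finite (window b \<omega>)"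
  shows "point_sum gs \<omega> = distinct_sum (window b \<omega>) (\<lambda>l. marked_point l \<omega>) gs"
proof -
  let ?f = "\<lambda>l. \<Prod>i<length gs. (gs ! i) (marked_point (l i) \<omega>)"
  have sub: "{l \<in> index_tuples {..<length gs}. ?f l \<noteq> 0} \<subseteq> injections (length gs) (window b \<omega>)"
  proof safe
    fix l assume l: "l \<in> index_tuples {..<length gs}" "?f l \<noteq> 0"
    have "l i \<in> window b \<omega>" if "i < length gs" for i
      using l(2) that supp[of "gs ! i" "marked_point (l i) \<omega>"] by (auto simp: window_def marked_point_def)
    then show "l \<in> injections (length gs) (window b \<omega>)"
      using l(1) by (auto simp: index_tuples_def injections_def PiE_iff)
  qed
  have sub': "injections (length gs) (window b \<omega>) \<subseteq> index_tuples {..<length gs}"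
    by (auto simp: index_tuples_def injections_def PiE_iff)
  have fin': "finite (injections (length gs) (window b \<omega>))"
    using fin by (rule finite_injections)
  have "point_sum gs \<omega> = (\<Sum>l | l \<in> index_tuples {..<length gs} \<and> ?f l \<noteq> 0. ?f l)"
    unfolding point_sum_def
    by (rule lebesgue_integral_count_space_finite_support) (rule finite_subset[OF sub fin'])
  also have "\<dots> = (\<Sum>l\<in>injections (length gs) (window b \<omega>). ?f l)"
    using sub sub' fin' by (intro sum.mono_neutral_left) auto
  finally show ?thesis by (simp add: distinct_sum_def)
qed

lemma point_sum_singleton:
  assumes supp: "\<And>z. f z \<noteq> 0 \<Longrightarrow> fst z \<in> {0..b}" and fin: "finite (window b \<omega>)"
  shows "point_sum [f] \<omega> = (\<Sum>l\<in>window b \<omega>. f (marked_point l \<omega>))"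
proof -
  have "distinct_sum (window b \<omega>) (\<lambda>l. marked_point l \<omega>) ([] @ [f])
     = (\<Sum>l\<in>window b \<omega>. f (marked_point l \<omega>)) * distinct_sum (window b \<omega>) (\<lambda>l. marked_point l \<omega>) []"
    using distinct_sum_mult[OF fin, of f "\<lambda>l. marked_point l \<omega>" "[]"] by simp
  also have "injections 0 (window b \<omega>) = {\<lambda>_. undefined}"
    by (auto simp: injections_def)
  then have "distinct_sum (window b \<omega>) (\<lambda>l. marked_point l \<omega>) [] = 1"
    by (simp add: distinct_sum_def)
  finally show ?thesis
    using point_sum_eq_distinct_sum[of "[f]" b \<omega>] supp fin by simp
qed

lemma point_sum_mult:
  assumes supp: "\<And>g z. g \<in> set gs \<Longrightarrow> g z \<noteq> 0 \<Longrightarrow> fst z \<in> {0..b}" "\<And>z. f z \<noteq> 0 \<Longrightarrow> fst z \<in> {0..b}"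
    and fin: "finite (window b \<omega>)"
  shows "point_sum [f] \<omega> * point_sum gs \<omega>
    = point_sum (gs @ [f]) \<omega> + (\<Sum>i<length gs. point_sum (gs[i := \<lambda>z. (gs ! i) z * f z]) \<omega>)"
proof -
  let ?D = "distinct_sum (window b \<omega>) (\<lambda>l. marked_point l \<omega>)"
  \<comment> \<open>A merged entry still vanishes outside the window, so it too may be evaluated as
    a finite sum.\<close>
  have upd: "point_sum (gs[i := \<lambda>z. (gs ! i) z * f z]) \<omega> = ?D (gs[i := \<lambda>z. (gs ! i) z * f z])" for i
  proof (rule point_sum_eq_distinct_sum[OF _ fin])
    fix g z assume g: "g \<in> set (gs[i := \<lambda>z. (gs ! i) z * f z])" "g z \<noteq> 0"
    have "g \<in> insert (\<lambda>z. (gs ! i) z * f z) (set gs)"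
      using g(1) set_update_subset_insert by (rule subsetD[rotated])
    then show "fst z \<in> {0..b}" using supp g(2) by (elim insertE) simp_all
  qed
  have app: "point_sum (gs @ [f]) \<omega> = ?D (gs @ [f])"
    by (rule point_sum_eq_distinct_sum[OF _ fin]) (use supp in auto)
  have one: "point_sum [f] \<omega> = (\<Sum>l\<in>window b \<omega>. f (marked_point l \<omega>))"
    by (rule point_sum_singleton[OF _ fin]) (use supp in auto)
  have gs: "point_sum gs \<omega> = ?D gs"
    by (rule point_sum_eq_distinct_sum[OF _ fin]) (use supp in auto)
  show ?thesis
    unfolding upd app one gs
    by (rule distinct_sum_mult[OF fin])
qed

text \<open>The intensity has infinite mass, so constants are not integrable and order 0 is
  excluded. Between orders 1 and 4 a power is at most the sum of the first and the fourth
  power.\<close>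

lemma integrable_moments2:
  fixes f g :: "real \<times> real \<times> real \<Rightarrow> real"
  assumes meas: "f \<in> borel_measurable intensity" "g \<in> borel_measurable intensity"
    and int: "integrable intensity f" "integrable intensity g" "integrable intensity (\<lambda>z. f z ^ 4)" "integrable intensity (\<lambda>z. g z ^ 4)"
    and ab: "1 \<le> a + b" "a + b \<le> 4"
  shows "integrable intensity (\<lambda>z. f z ^ a * g z ^ b)"
proof (rule Bochner_Integration.integrable_bound)
  show "integrable intensity (\<lambda>z. \<bar>f z\<bar> + \<bar>g z\<bar> + (f z ^ 4 + g z ^ 4))"
    using int by auto
  show "(\<lambda>z. f z ^ a * g z ^ b) \<in> borel_measurable intensity"
    using meas by measurable
  have pow: "x ^ n \<le> x + x ^ 4" if "0 \<le> x" "1 \<le> n" "n \<le> 4" for x :: real and n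
  proof (cases "x \<le> 1")
    case True
    then have "x ^ n \<le> x ^ 1" using that by (intro power_decreasing) auto
    then show ?thesis by (simp add: add_increasing2)
  next
    case False
    then have "x ^ n \<le> x ^ 4" using that by (intro power_increasing) auto
    then show ?thesis using that by simp
  qed
  show "AE z in intensity. norm (f z ^ a * g z ^ b) \<le> norm (\<bar>f z\<bar> + \<bar>g z\<bar> + (f z ^ 4 + g z ^ 4))"
  proof (rule AE_I2)
    fix z
    \<comment> \<open>Bounding both factors by the larger one reduces the mixed moment to a single
      power.\<close>
    define m where "m = max \<bar>f z\<bar> \<bar>g z\<bar>"
    have "\<bar>f z\<bar> ^ a * \<bar>g z\<bar> ^ b \<le> m ^ a * m ^ b"
      unfolding m_def by (intro mult_mono power_mono) auto
    also have "\<dots> = m ^ (a + b)" by (simp add: power_add)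
    also have "\<dots> \<le> m + m ^ 4" using ab by (intro pow) (auto simp: m_def)
    also have "\<dots> \<le> \<bar>f z\<bar> + \<bar>g z\<bar> + (f z ^ 4 + g z ^ 4)"
      unfolding m_def by (auto simp: max_def)
    finally show "norm (f z ^ a * g z ^ b) \<le> norm (\<bar>f z\<bar> + \<bar>g z\<bar> + (f z ^ 4 + g z ^ 4))"
      by (simp add: abs_mult power_abs)
  qed
qed

text \<open>Repeated use of the product rule turns the product into sums over distinct points
  indexed by the 15 set partitions of the four factors f, f, g, g. Each block contributes the
  integral of the product of its members.\<close>

lemma fourth_mixed_moment:
  assumes int: "integrable intensity f" "integrable intensity g" "integrable intensity (\<lambda>z. f z ^ 4)" "integrable intensity (\<lambda>z. g z ^ 4)"
    and supp: "\<And>z. f z \<noteq> 0 \<Longrightarrow> fst z \<in> {0..b}" "\<And>z. g z \<noteq> 0 \<Longrightarrow> fst z \<in> {0..b}"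
  defines "\<mu> \<equiv> \<lambda>i j. \<integral>z. f z ^ i * g z ^ j \<partial>intensity"
  shows "integrable P (\<lambda>\<omega>. (point_sum [f] \<omega>)\<^sup>2)"
    and "expectation (\<lambda>\<omega>. (point_sum [f] \<omega>)\<^sup>2) = \<mu> 2 0 + (\<mu> 1 0)\<^sup>2"
    and "integrable P (\<lambda>\<omega>. (point_sum [f] \<omega>)\<^sup>2 * (point_sum [g] \<omega>)\<^sup>2)"
    and "expectation (\<lambda>\<omega>. (point_sum [f] \<omega>)\<^sup>2 * (point_sum [g] \<omega>)\<^sup>2)
      = (\<mu> 2 0 + (\<mu> 1 0)\<^sup>2) * (\<mu> 0 2 + (\<mu> 0 1)\<^sup>2) + \<mu> 2 2 + 2 * \<mu> 0 1 * \<mu> 2 1 + 2 * \<mu> 1 0 * \<mu> 1 2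
        + 2 * (\<mu> 1 1)\<^sup>2 + 4 * \<mu> 1 0 * \<mu> 0 1 * \<mu> 1 1"
proof -
  have meas: "f \<in> borel_measurable intensity" "g \<in> borel_measurable intensity"
    using int by auto
  note ii = integrable_moments2[OF meas int]
  have i: "integrable intensity (\<lambda>z. f z * f z)" "integrable intensity (\<lambda>z. g z * g z)"
    "integrable intensity (\<lambda>z. g z * f z)" "integrable intensity (\<lambda>z. g z * f z * f z)"
    "integrable intensity (\<lambda>z. g z * g z * f z)" "integrable intensity (\<lambda>z. g z * g z * f z * f z)"
    using ii[of 2 0] ii[of 0 2] ii[of 1 1] ii[of 2 1] ii[of 1 2] ii[of 2 2]
    by (simp_all add: power2_eq_square mult_ac)
  have m: "(\<integral>z. f z * f z \<partial>intensity) = \<mu> 2 0" "(\<integral>z. g z * g z \<partial>intensity) = \<mu> 0 2"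
    "(\<integral>z. g z * f z \<partial>intensity) = \<mu> 1 1" "(\<integral>z. g z * f z * f z \<partial>intensity) = \<mu> 2 1"
    "(\<integral>z. g z * g z * f z \<partial>intensity) = \<mu> 1 2" "(\<integral>z. g z * g z * f z * f z \<partial>intensity) = \<mu> 2 2"
    "(\<integral>z. f z \<partial>intensity) = \<mu> 1 0" "(\<integral>z. g z \<partial>intensity) = \<mu> 0 1"
    by (simp_all add: \<mu>_def power2_eq_square mult_ac)
  have pm: "integrable P (point_sum gs)" "expectation (point_sum gs) = prod_list (map (integral\<^sup>L intensity) gs)"
    if "set gs \<subseteq> {f, g, \<lambda>z. f z * f z, \<lambda>z. g z * g z, \<lambda>z. g z * f z, \<lambda>z. g z * f z * f z, \<lambda>z. g z * g z * f z, \<lambda>z. g z * g z * f z * f z}" for gs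
    using point_sum_moment[of gs] that i int by auto
  have [measurable]: "point_sum gs \<in> borel_measurable P"
    if "set gs \<subseteq> {f, g, \<lambda>z. f z * f z, \<lambda>z. g z * g z, \<lambda>z. g z * f z, \<lambda>z. g z * f z * f z, \<lambda>z. g z * g z * f z, \<lambda>z. g z * g z * f z * f z}" for gs
    using pm(1)[OF that] by auto
  have [measurable]: "point_sum [f] \<in> borel_measurable P" "point_sum [g] \<in> borel_measurable P"
    by auto
  define D where "D = point_sum"
  have ae: "AE \<omega> in P. (D [f] \<omega>)\<^sup>2 = D [f, f] \<omega> + D [\<lambda>z. f z * f z] \<omega>"
    using AE_finite_window
  proof eventually_elim
    case (elim \<omega>)
    have "D [f] \<omega> * D [f] \<omega> = D [f, f] \<omega> + D [\<lambda>z. f z * f z] \<omega>"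
      using point_sum_mult[of "[f]" b f \<omega>] elim supp by (auto simp: D_def)
    then show ?case by (simp add: power2_eq_square)
  qed
  have "integrable P (\<lambda>\<omega>. D [f, f] \<omega> + D [\<lambda>z. f z * f z] \<omega>)"
    unfolding D_def by (intro Bochner_Integration.integrable_add pm) auto
  then show "integrable P (\<lambda>\<omega>. (point_sum [f] \<omega>)\<^sup>2)"
    using ae unfolding D_def by (subst integrable_cong_AE[OF _ _ ae[unfolded D_def]]) auto
  have "expectation (\<lambda>\<omega>. (D [f] \<omega>)\<^sup>2) = expectation (\<lambda>\<omega>. D [f, f] \<omega> + D [\<lambda>z. f z * f z] \<omega>)"
    by (intro integral_cong_AE ae) (auto simp: D_def)
  also have "\<dots> = expectation (D [f, f]) + expectation (D [\<lambda>z. f z * f z])"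
    unfolding D_def by (intro Bochner_Integration.integral_add pm) auto
  also have "\<dots> = \<mu> 2 0 + (\<mu> 1 0)\<^sup>2"
    unfolding D_def using m by (subst (1 2) pm(2)) (auto simp: power2_eq_square)
  finally show "expectation (\<lambda>\<omega>. (point_sum [f] \<omega>)\<^sup>2) = \<mu> 2 0 + (\<mu> 1 0)\<^sup>2"
    by (simp add: D_def)
  let ?ff = "\<lambda>z. f z * f z" and ?gg = "\<lambda>z. g z * g z" and ?gf = "\<lambda>z. g z * f z"
    and ?gff = "\<lambda>z. g z * f z * f z" and ?ggf = "\<lambda>z. g z * g z * f z" and ?ggff = "\<lambda>z. g z * g z * f z * f z"
  \<comment> \<open>The 15 partitions, grouped by the sum to which the last factor \<open>f\<close>
    is multiplied.\<close>
  let ?R = "\<lambda>\<omega>. (D [g, g, f, f] \<omega> + D [?gf, g, f] \<omega> + D [g, ?gf, f] \<omega> + D [g, g, ?ff] \<omega>)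
     + (D [?gf, g, f] \<omega> + D [?gff, g] \<omega> + D [?gf, ?gf] \<omega>)
     + (D [g, ?gf, f] \<omega> + D [?gf, ?gf] \<omega> + D [g, ?gff] \<omega>)
     + (D [?gg, f, f] \<omega> + D [?ggf, f] \<omega> + D [?gg, ?ff] \<omega>) + (D [?ggf, f] \<omega> + D [?ggff] \<omega>)"
  have ae4: "AE \<omega> in P. (D [f] \<omega>)\<^sup>2 * (D [g] \<omega>)\<^sup>2 = ?R \<omega>"
    using AE_finite_window
  proof eventually_elim
    case (elim \<omega>)
    have M: "D [h] \<omega> * D gs \<omega> = D (gs @ [h]) \<omega> + (\<Sum>i<length gs. D (gs[i := \<lambda>z. (gs ! i) z * h z]) \<omega>)"
      if "set gs \<subseteq> {f, g, ?ff, ?gg, ?gf, ?gff, ?ggf, ?ggff}" "h \<in> {f, g}" for h gs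
    proof -
      have "k z \<noteq> 0 \<Longrightarrow> fst z \<in> {0..b}" if "k \<in> {f, g, ?ff, ?gg, ?gf, ?gff, ?ggf, ?ggff}" for k z
        using that supp(1)[of z] supp(2)[of z] by fastforce
      then show ?thesis
        unfolding D_def using elim that by (intro point_sum_mult[of gs b]) blast+
    qed
    have 1: "D [g] \<omega> * D [g] \<omega> = D [g, g] \<omega> + D [?gg] \<omega>"
      by (subst M) auto
    have 2: "D [f] \<omega> * D [g, g] \<omega> = D [g, g, f] \<omega> + D [?gf, g] \<omega> + D [g, ?gf] \<omega>"
      by (subst M) (auto simp: lessThan_Suc)
    have 3: "D [f] \<omega> * D [?gg] \<omega> = D [?gg, f] \<omega> + D [?ggf] \<omega>"
      by (subst M) (auto simp: lessThan_Suc)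
    have 4: "D [f] \<omega> * D [g, g, f] \<omega> = D [g, g, f, f] \<omega> + D [?gf, g, f] \<omega> + D [g, ?gf, f] \<omega> + D [g, g, ?ff] \<omega>"
      by (subst M) (auto simp: lessThan_Suc)
    have 5: "D [f] \<omega> * D [?gf, g] \<omega> = D [?gf, g, f] \<omega> + D [?gff, g] \<omega> + D [?gf, ?gf] \<omega>"
      by (subst M) (auto simp: lessThan_Suc)
    have 6: "D [f] \<omega> * D [g, ?gf] \<omega> = D [g, ?gf, f] \<omega> + D [?gf, ?gf] \<omega> + D [g, ?gff] \<omega>"
      by (subst M) (auto simp: lessThan_Suc)
    have 7: "D [f] \<omega> * D [?gg, f] \<omega> = D [?gg, f, f] \<omega> + D [?ggf, f] \<omega> + D [?gg, ?ff] \<omega>"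
      by (subst M) (auto simp: lessThan_Suc)
    have 8: "D [f] \<omega> * D [?ggf] \<omega> = D [?ggf, f] \<omega> + D [?ggff] \<omega>"
      by (subst M) (auto simp: lessThan_Suc)
    have "(D [f] \<omega>)\<^sup>2 * (D [g] \<omega>)\<^sup>2 = D [f] \<omega> * (D [f] \<omega> * (D [g] \<omega> * D [g] \<omega>))"
      by (simp add: power2_eq_square)
    also have "\<dots> = ?R \<omega>"
      unfolding 1 distrib_left 2 3 4 5 6 7 8 by simp
    finally show ?case .
  qed
  have R: "integrable P ?R"
    unfolding D_def by (intro Bochner_Integration.integrable_add pm) auto
  then show "integrable P (\<lambda>\<omega>. (point_sum [f] \<omega>)\<^sup>2 * (point_sum [g] \<omega>)\<^sup>2)"
    unfolding D_def by (subst integrable_cong_AE[OF _ _ ae4[unfolded D_def]]) auto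
  have pmD: "integrable P (D gs)"
    if "set gs \<subseteq> {f, g, \<lambda>z. f z * f z, \<lambda>z. g z * g z, \<lambda>z. g z * f z, \<lambda>z. g z * f z * f z, \<lambda>z. g z * g z * f z, \<lambda>z. g z * g z * f z * f z}" for gs
    unfolding D_def using that by (rule pm)
  have ED: "expectation (D gs) = prod_list (map (integral\<^sup>L intensity) gs)"
    if "set gs \<subseteq> {f, g, \<lambda>z. f z * f z, \<lambda>z. g z * g z, \<lambda>z. g z * f z, \<lambda>z. g z * f z * f z, \<lambda>z. g z * g z * f z, \<lambda>z. g z * g z * f z * f z}" for gs
    unfolding D_def using that by (rule pm)
  have "expectation (\<lambda>\<omega>. (D [f] \<omega>)\<^sup>2 * (D [g] \<omega>)\<^sup>2) = expectation ?R"
    using R by (intro integral_cong_AE ae4) (auto simp: D_def)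
  also have "\<dots> = (expectation (D [g, g, f, f]) + expectation (D [?gf, g, f]) + expectation (D [g, ?gf, f]) + expectation (D [g, g, ?ff]))
     + (expectation (D [?gf, g, f]) + expectation (D [?gff, g]) + expectation (D [?gf, ?gf]))
     + (expectation (D [g, ?gf, f]) + expectation (D [?gf, ?gf]) + expectation (D [g, ?gff]))
     + (expectation (D [?gg, f, f]) + expectation (D [?ggf, f]) + expectation (D [?gg, ?ff])) + (expectation (D [?ggf, f]) + expectation (D [?ggff]))"
    by (simp add: Bochner_Integration.integral_add Bochner_Integration.integrable_add pmD)
  also have "\<dots> = (\<mu> 2 0 + (\<mu> 1 0)\<^sup>2) * (\<mu> 0 2 + (\<mu> 0 1)\<^sup>2) + \<mu> 2 2 + 2 * \<mu> 0 1 * \<mu> 2 1 + 2 * \<mu> 1 0 * \<mu> 1 2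
        + 2 * (\<mu> 1 1)\<^sup>2 + 4 * \<mu> 1 0 * \<mu> 0 1 * \<mu> 1 1"
    by (simp add: ED m) (simp add: power2_eq_square algebra_simps)
  finally show "expectation (\<lambda>\<omega>. (point_sum [f] \<omega>)\<^sup>2 * (point_sum [g] \<omega>)\<^sup>2)
      = (\<mu> 2 0 + (\<mu> 1 0)\<^sup>2) * (\<mu> 0 2 + (\<mu> 0 1)\<^sup>2) + \<mu> 2 2 + 2 * \<mu> 0 1 * \<mu> 2 1 + 2 * \<mu> 1 0 * \<mu> 1 2
        + 2 * (\<mu> 1 1)\<^sup>2 + 4 * \<mu> 1 0 * \<mu> 0 1 * \<mu> 1 1"
    by (simp add: D_def)
qed

text \<open>The products of second moments cancel in the variance. Apart from the squared
  covariances, the remaining terms are collected under one integral, so that bounded overlap can be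
  applied pointwise afterwards.\<close>

lemma variance_sum_squares:
  fixes f :: "'k \<Rightarrow> real \<times> real \<times> real \<Rightarrow> real"
  assumes K: "finite K"
    and int: "\<And>k. k \<in> K \<Longrightarrow> integrable intensity (f k)" "\<And>k. k \<in> K \<Longrightarrow> integrable intensity (\<lambda>z. f k z ^ 4)"
    and supp: "\<And>k z. k \<in> K \<Longrightarrow> f k z \<noteq> 0 \<Longrightarrow> fst z \<in> {0..b}"
  defines "m \<equiv> \<lambda>k. integral\<^sup>L intensity (f k)" and "v \<equiv> \<lambda>k k'. \<integral>z. f k z * f k' z \<partial>intensity"
    and "F \<equiv> \<lambda>\<omega>. \<Sum>k\<in>K. (point_sum [f k] \<omega>)\<^sup>2"
  shows "integrable P F" and "expectation F = (\<Sum>k\<in>K. v k k + (m k)\<^sup>2)"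
    and "integrable P (\<lambda>\<omega>. (F \<omega>)\<^sup>2)"
    and "variance F \<le> (\<integral>z. 3 * (\<Sum>k\<in>K. (f k z)\<^sup>2)\<^sup>2 + 6 * (\<Sum>k\<in>K. m k * f k z)\<^sup>2 \<partial>intensity) + 2 * (\<Sum>k\<in>K. \<Sum>k'\<in>K. (v k k')\<^sup>2)"
proof -
  define \<mu> where "\<mu> = (\<lambda>k k' i j. \<integral>z. f k z ^ i * f k' z ^ j \<partial>intensity)"
  have fm: "integrable P (\<lambda>\<omega>. (point_sum [f k] \<omega>)\<^sup>2)"
    "expectation (\<lambda>\<omega>. (point_sum [f k] \<omega>)\<^sup>2) = \<mu> k k' 2 0 + (\<mu> k k' 1 0)\<^sup>2"
    "integrable P (\<lambda>\<omega>. (point_sum [f k] \<omega>)\<^sup>2 * (point_sum [f k'] \<omega>)\<^sup>2)"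
    "expectation (\<lambda>\<omega>. (point_sum [f k] \<omega>)\<^sup>2 * (point_sum [f k'] \<omega>)\<^sup>2)
      = (\<mu> k k' 2 0 + (\<mu> k k' 1 0)\<^sup>2) * (\<mu> k k' 0 2 + (\<mu> k k' 0 1)\<^sup>2) + \<mu> k k' 2 2
        + 2 * \<mu> k k' 0 1 * \<mu> k k' 2 1 + 2 * \<mu> k k' 1 0 * \<mu> k k' 1 2
        + 2 * (\<mu> k k' 1 1)\<^sup>2 + 4 * \<mu> k k' 1 0 * \<mu> k k' 0 1 * \<mu> k k' 1 1"
    if k: "k \<in> K" "k' \<in> K" for k k'
    unfolding \<mu>_def
    by (rule fourth_mixed_moment[OF int(1)[OF k(1)] int(1)[OF k(2)] int(2)[OF k(1)] int(2)[OF k(2)]];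
      use supp k in blast)+
  have meas: "f k \<in> borel_measurable intensity" if "k \<in> K" for k
    using int(1)[OF that] by auto
  have ii: "integrable intensity (\<lambda>z. f k z ^ i * f k' z ^ j)"
    if "k \<in> K" "k' \<in> K" "1 \<le> i + j" "i + j \<le> 4" for k k' i j
    using that by (intro integrable_moments2 meas int)
  have \<mu>10: "\<mu> k k' 1 0 = m k" "\<mu> k k' 0 1 = m k'" for k k' by (simp_all add: \<mu>_def m_def)
  have \<mu>11: "\<mu> k k' 1 1 = v k k'" "\<mu> k k' 2 0 = v k k" "\<mu> k k' 0 2 = v k' k'" for k k'
    by (simp_all add: \<mu>_def v_def power2_eq_square)
  have sq: "integrable P (\<lambda>\<omega>. (point_sum [f k] \<omega>)\<^sup>2)" "expectation (\<lambda>\<omega>. (point_sum [f k] \<omega>)\<^sup>2) = v k k + (m k)\<^sup>2"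
    if "k \<in> K" for k
    using fm(1,2)[OF that that] by (simp_all add: \<mu>11 \<mu>10[simplified])
  show F: "integrable P F" unfolding F_def using sq by (intro Bochner_Integration.integrable_sum) auto
  show EF: "expectation F = (\<Sum>k\<in>K. v k k + (m k)\<^sup>2)"
    unfolding F_def using sq by (subst Bochner_Integration.integral_sum) auto
  have F2: "(F \<omega>)\<^sup>2 = (\<Sum>k\<in>K. \<Sum>k'\<in>K. (point_sum [f k] \<omega>)\<^sup>2 * (point_sum [f k'] \<omega>)\<^sup>2)" for \<omega>
    unfolding F_def by (simp add: power2_eq_square[of "sum _ _"] sum_product)
  have pi: "integrable P (\<lambda>\<omega>. (point_sum [f k] \<omega>)\<^sup>2 * (point_sum [f k'] \<omega>)\<^sup>2)" if "k \<in> K" "k' \<in> K" for k k'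
    using that by (rule fm(3))
  show iF2: "integrable P (\<lambda>\<omega>. (F \<omega>)\<^sup>2)"
    unfolding F2 using pi by (intro Bochner_Integration.integrable_sum) auto
  have EF2: "expectation (\<lambda>\<omega>. (F \<omega>)\<^sup>2) = (\<Sum>k\<in>K. \<Sum>k'\<in>K. (v k k + (m k)\<^sup>2) * (v k' k' + (m k')\<^sup>2) + \<mu> k k' 2 2 + 2 * m k' * \<mu> k k' 2 1 + 2 * m k * \<mu> k k' 1 2
        + 2 * (v k k')\<^sup>2 + 4 * m k * m k' * v k k')"
  proof -
    have "expectation (\<lambda>\<omega>. (F \<omega>)\<^sup>2) = (\<Sum>k\<in>K. \<Sum>k'\<in>K. expectation (\<lambda>\<omega>. (point_sum [f k] \<omega>)\<^sup>2 * (point_sum [f k'] \<omega>)\<^sup>2))"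
      unfolding F2 using pi by (subst Bochner_Integration.integral_sum) (auto intro!: sum.cong Bochner_Integration.integral_sum)
    also have "\<dots> = (\<Sum>k\<in>K. \<Sum>k'\<in>K. (v k k + (m k)\<^sup>2) * (v k' k' + (m k')\<^sup>2) + \<mu> k k' 2 2 + 2 * m k' * \<mu> k k' 2 1 + 2 * m k * \<mu> k k' 1 2
        + 2 * (v k k')\<^sup>2 + 4 * m k * m k' * v k k')"
      using fm(4) by (intro sum.cong refl) (simp add: \<mu>10[simplified] \<mu>11[simplified])
    finally show ?thesis .
  qed
  let ?h = "\<lambda>z. \<Sum>k\<in>K. (f k z)\<^sup>2" and ?q = "\<lambda>z. \<Sum>k\<in>K. m k * f k z"
  have sw: "(\<Sum>k\<in>K. \<Sum>k'\<in>K. a k k') = (\<Sum>k'\<in>K. \<Sum>k\<in>K. a k k')" for a :: "'k \<Rightarrow> 'k \<Rightarrow> real"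
    by (rule sum.swap)
  have hh: "(?h z)\<^sup>2 = (\<Sum>k\<in>K. \<Sum>k'\<in>K. f k z ^ 2 * f k' z ^ 2)" for z
    by (simp add: power2_eq_square[of "sum _ _"] sum_product)
  have hq: "?h z * ?q z = (\<Sum>k\<in>K. \<Sum>k'\<in>K. m k' * (f k z ^ 2 * f k' z ^ 1))" for z
    unfolding sum_product by (intro sum.cong refl) (simp add: mult_ac)
  have qq: "(?q z)\<^sup>2 = (\<Sum>k\<in>K. \<Sum>k'\<in>K. m k * m k' * (f k z ^ 1 * f k' z ^ 1))" for z
    unfolding power2_eq_square sum_product by (intro sum.cong refl) (simp add: mult_ac)
  have ihh: "integrable intensity (\<lambda>z. (?h z)\<^sup>2)" "(\<integral>z. (?h z)\<^sup>2 \<partial>intensity) = (\<Sum>k\<in>K. \<Sum>k'\<in>K. \<mu> k k' 2 2)"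
  proof -
    show "integrable intensity (\<lambda>z. (?h z)\<^sup>2)"
      unfolding hh using ii by (intro Bochner_Integration.integrable_sum) auto
    show "(\<integral>z. (?h z)\<^sup>2 \<partial>intensity) = (\<Sum>k\<in>K. \<Sum>k'\<in>K. \<mu> k k' 2 2)"
      unfolding hh \<mu>_def using ii
      by (subst Bochner_Integration.integral_sum) (auto intro!: sum.cong Bochner_Integration.integral_sum Bochner_Integration.integrable_sum)
  qed
  have ihq: "integrable intensity (\<lambda>z. ?h z * ?q z)" "(\<integral>z. ?h z * ?q z \<partial>intensity) = (\<Sum>k\<in>K. \<Sum>k'\<in>K. m k' * \<mu> k k' 2 1)"
  proof -
    have *: "integrable intensity (\<lambda>z. m k' * (f k z ^ 2 * f k' z ^ 1))" if "k \<in> K" "k' \<in> K" for k k'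
      using that by (intro integrable_mult_right ii) auto
    show "integrable intensity (\<lambda>z. ?h z * ?q z)"
      unfolding hq by (intro Bochner_Integration.integrable_sum *)
    have "(\<integral>z. ?h z * ?q z \<partial>intensity) = (\<Sum>k\<in>K. \<Sum>k'\<in>K. \<integral>z. m k' * (f k z ^ 2 * f k' z ^ 1) \<partial>intensity)"
      unfolding hq using *
      by (subst Bochner_Integration.integral_sum) (auto intro!: sum.cong Bochner_Integration.integral_sum Bochner_Integration.integrable_sum simp del: power_one_right)
    then show "(\<integral>z. ?h z * ?q z \<partial>intensity) = (\<Sum>k\<in>K. \<Sum>k'\<in>K. m k' * \<mu> k k' 2 1)"
      by (simp add: \<mu>_def)
  qed
  have iqq: "integrable intensity (\<lambda>z. (?q z)\<^sup>2)" "(\<integral>z. (?q z)\<^sup>2 \<partial>intensity) = (\<Sum>k\<in>K. \<Sum>k'\<in>K. m k * m k' * v k k')"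
  proof -
    have *: "integrable intensity (\<lambda>z. m k * m k' * (f k z ^ 1 * f k' z ^ 1))" if "k \<in> K" "k' \<in> K" for k k'
      using that by (intro integrable_mult_right ii) auto
    show "integrable intensity (\<lambda>z. (?q z)\<^sup>2)"
      unfolding qq by (intro Bochner_Integration.integrable_sum *)
    have "(\<integral>z. (?q z)\<^sup>2 \<partial>intensity) = (\<Sum>k\<in>K. \<Sum>k'\<in>K. \<integral>z. m k * m k' * (f k z ^ 1 * f k' z ^ 1) \<partial>intensity)"
      unfolding qq using *
      by (subst Bochner_Integration.integral_sum) (auto intro!: sum.cong Bochner_Integration.integral_sum Bochner_Integration.integrable_sum simp del: power_one_right)
    then show "(\<integral>z. (?q z)\<^sup>2 \<partial>intensity) = (\<Sum>k\<in>K. \<Sum>k'\<in>K. m k * m k' * v k k')"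
      by (simp add: v_def)
  qed
  have \<mu>12: "\<mu> k k' 1 2 = \<mu> k' k 2 1" for k k'
    by (simp add: \<mu>_def mult.commute)
  have s12: "(\<Sum>k\<in>K. \<Sum>k'\<in>K. m k * \<mu> k k' 1 2) = (\<Sum>k\<in>K. \<Sum>k'\<in>K. m k' * \<mu> k k' 2 1)"
    unfolding \<mu>12 by (rule sw)
  have sdl: "(\<Sum>k\<in>K. \<Sum>k'\<in>K. c * a k k') = c * (\<Sum>k\<in>K. \<Sum>k'\<in>K. a k k')" for c and a :: "'k \<Rightarrow> 'k \<Rightarrow> real"
    by (simp add: sum_distrib_left)
  have "variance F = expectation (\<lambda>\<omega>. (F \<omega>)\<^sup>2) - (expectation F)\<^sup>2"
    using F iF2 by (rule variance_eq)
  also have "\<dots> = (\<Sum>k\<in>K. \<Sum>k'\<in>K. \<mu> k k' 2 2 + 2 * (m k' * \<mu> k k' 2 1) + 2 * (m k * \<mu> k k' 1 2)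
        + 2 * (v k k')\<^sup>2 + 4 * (m k * m k' * v k k'))"
    unfolding EF2 EF power2_eq_square[of "sum _ _"] sum_product sum_subtractf[symmetric]
    by (intro sum.cong refl) (simp add: algebra_simps)
  also have "\<dots> = (\<integral>z. (?h z)\<^sup>2 \<partial>intensity) + 4 * (\<integral>z. ?h z * ?q z \<partial>intensity) + 2 * (\<Sum>k\<in>K. \<Sum>k'\<in>K. (v k k')\<^sup>2) + 4 * (\<integral>z. (?q z)\<^sup>2 \<partial>intensity)"
    unfolding sum.distrib sdl s12 ihh(2) ihq(2) iqq(2) by simp
  \<comment> \<open>The cross term 4 h q is at most 2 h^2 + 2 q^2; hence the coefficients 3 = 1 + 2
    and 6 = 4 + 2.\<close>
  also have "\<dots> \<le> (\<integral>z. 3 * (?h z)\<^sup>2 + 6 * (?q z)\<^sup>2 \<partial>intensity) + 2 * (\<Sum>k\<in>K. \<Sum>k'\<in>K. (v k k')\<^sup>2)"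
  proof -
    have "0 \<le> (\<integral>z. (?h z - ?q z)\<^sup>2 \<partial>intensity)" by simp
    also have "\<dots> = (\<integral>z. (?h z)\<^sup>2 + (?q z)\<^sup>2 - 2 * (?h z * ?q z) \<partial>intensity)"
      by (simp add: power2_diff mult.assoc)
    also have "\<dots> = (\<integral>z. (?h z)\<^sup>2 \<partial>intensity) + (\<integral>z. (?q z)\<^sup>2 \<partial>intensity) - 2 * (\<integral>z. ?h z * ?q z \<partial>intensity)"
      using ihh(1) ihq(1) iqq(1) by simp
    finally have "2 * (\<integral>z. ?h z * ?q z \<partial>intensity) \<le> (\<integral>z. (?h z)\<^sup>2 \<partial>intensity) + (\<integral>z. (?q z)\<^sup>2 \<partial>intensity)" by simp
    moreover have "(\<integral>z. 3 * (?h z)\<^sup>2 + 6 * (?q z)\<^sup>2 \<partial>intensity) = 3 * (\<integral>z. (?h z)\<^sup>2 \<partial>intensity) + 6 * (\<integral>z. (?q z)\<^sup>2 \<partial>intensity)"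
      using ihh(1) iqq(1) by simp
    ultimately show ?thesis by simp
  qed
  finally show "variance F \<le> (\<integral>z. 3 * (?h z)\<^sup>2 + 6 * (?q z)\<^sup>2 \<partial>intensity) + 2 * (\<Sum>k\<in>K. \<Sum>k'\<in>K. (v k k')\<^sup>2)" .
qed

text \<open>The variance bound is linear in \<open>card K\<close> although there is a quadratic
  number of covariances. Bounded overlap controls the part under the integral. In a squared
  covariance one factor is bounded by \<open>A2\<close>, and the other is summed over all k' under
  the integral, against the envelope \<open>h\<close>.\<close>

lemma mean_deviation_sum_squares:
  fixes f :: "'k \<Rightarrow> real \<times> real \<times> real \<Rightarrow> real" and c A1 A2 A4 B :: real
  assumes K: "finite K"
    and int: "\<And>k. k \<in> K \<Longrightarrow> integrable intensity (f k)" "\<And>k. k \<in> K \<Longrightarrow> integrable intensity (\<lambda>z. f k z ^ 4)"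
    and supp: "\<And>k z. k \<in> K \<Longrightarrow> f k z \<noteq> 0 \<Longrightarrow> fst z \<in> {0..b}"
    and overlap: "\<And>z. real (card {k\<in>K. f k z \<noteq> 0}) \<le> c"
    and A1: "\<And>k. k \<in> K \<Longrightarrow> (integral\<^sup>L intensity (f k))\<^sup>2 \<le> A1"
    and A2: "\<And>k. k \<in> K \<Longrightarrow> (\<integral>z. (f k z)\<^sup>2 \<partial>intensity) \<le> A2"
    and A4: "\<And>k. k \<in> K \<Longrightarrow> (\<integral>z. f k z ^ 4 \<partial>intensity) \<le> A4"
    and h: "\<And>z. (\<Sum>k\<in>K. \<bar>f k z\<bar>) \<le> h z"
    and B: "\<And>k. k \<in> K \<Longrightarrow> integrable intensity (\<lambda>z. \<bar>f k z\<bar> * h z)" "\<And>k. k \<in> K \<Longrightarrow> (\<integral>z. \<bar>f k z\<bar> * h z \<partial>intensity) \<le> B"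
  defines "F \<equiv> \<lambda>\<omega>. \<Sum>k\<in>K. (point_sum [f k] \<omega>)\<^sup>2"
  shows "expectation (\<lambda>\<omega>. \<bar>F \<omega> - expectation F\<bar>) \<le> sqrt (card K * (3 * c * A4 + 6 * c * A1 * A2 + 2 * A2 * B))"
proof -
  define m where "m = (\<lambda>k. integral\<^sup>L intensity (f k))"
  define v where "v = (\<lambda>k k'. \<integral>z. f k z * f k' z \<partial>intensity)"
  have V: "integrable P F" "integrable P (\<lambda>\<omega>. (F \<omega>)\<^sup>2)"
    "variance F \<le> (\<integral>z. 3 * (\<Sum>k\<in>K. (f k z)\<^sup>2)\<^sup>2 + 6 * (\<Sum>k\<in>K. m k * f k z)\<^sup>2 \<partial>intensity) + 2 * (\<Sum>k\<in>K. \<Sum>k'\<in>K. (v k k')\<^sup>2)"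
    unfolding F_def m_def v_def
    by (rule variance_sum_squares[where b=b]; use K int supp in blast)+
  have meas: "f k \<in> borel_measurable intensity" if "k \<in> K" for k
    using int(1)[OF that] by auto
  have ii: "integrable intensity (\<lambda>z. f k z ^ i * f k' z ^ j)"
    if "k \<in> K" "k' \<in> K" "1 \<le> i + j" "i + j \<le> 4" for k k' i j
    using that by (intro integrable_moments2 meas int)
  have i2: "integrable intensity (\<lambda>z. (f k z)\<^sup>2)" if "k \<in> K" for k
    using ii[of k k 2 0] that by simp
  have i11: "integrable intensity (\<lambda>z. f k z * f k' z)" if "k \<in> K" "k' \<in> K" for k k'
    using ii[of k k' 1 1] that by simp
  have c0: "0 \<le> c" using order_trans[OF _ overlap] by simp
  have card_le: "real (card {k\<in>K. a k * f k z \<noteq> 0}) \<le> c" for a z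
  proof -
    have "card {k\<in>K. a k * f k z \<noteq> 0} \<le> card {k\<in>K. f k z \<noteq> 0}"
      using K by (intro card_mono) auto
    then show ?thesis using overlap[of z] by linarith
  qed
  have ptw: "3 * (\<Sum>k\<in>K. (f k z)\<^sup>2)\<^sup>2 + 6 * (\<Sum>k\<in>K. m k * f k z)\<^sup>2
    \<le> 3 * c * (\<Sum>k\<in>K. f k z ^ 4) + 6 * c * (\<Sum>k\<in>K. (m k)\<^sup>2 * (f k z)\<^sup>2)" for z
  proof -
    have "(\<Sum>k\<in>K. (f k z)\<^sup>2)\<^sup>2 \<le> real (card {k\<in>K. f k z * f k z \<noteq> 0}) * (\<Sum>k\<in>K. ((f k z)\<^sup>2)\<^sup>2)"
      using sum_power2_le_card[OF K, of "\<lambda>k. (f k z)\<^sup>2"] by (simp add: power2_eq_square)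
    also have "\<dots> \<le> c * (\<Sum>k\<in>K. ((f k z)\<^sup>2)\<^sup>2)"
      by (intro mult_right_mono card_le sum_nonneg) auto
    finally have 1: "(\<Sum>k\<in>K. (f k z)\<^sup>2)\<^sup>2 \<le> c * (\<Sum>k\<in>K. f k z ^ 4)" by (simp flip: power_mult)
    have "(\<Sum>k\<in>K. m k * f k z)\<^sup>2 \<le> real (card {k\<in>K. m k * f k z \<noteq> 0}) * (\<Sum>k\<in>K. (m k * f k z)\<^sup>2)"
      by (rule sum_power2_le_card[OF K])
    also have "\<dots> \<le> c * (\<Sum>k\<in>K. (m k * f k z)\<^sup>2)"
      by (intro mult_right_mono card_le sum_nonneg) auto
    finally have 2: "(\<Sum>k\<in>K. m k * f k z)\<^sup>2 \<le> c * (\<Sum>k\<in>K. (m k)\<^sup>2 * (f k z)\<^sup>2)" by (simp add: power_mult_distrib)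
    from 1 2 show ?thesis by simp
  qed
  have iR: "integrable intensity (\<lambda>z. 3 * c * (\<Sum>k\<in>K. f k z ^ 4) + 6 * c * (\<Sum>k\<in>K. (m k)\<^sup>2 * (f k z)\<^sup>2))"
    using int(2) i2 by (intro Bochner_Integration.integrable_add integrable_mult_right Bochner_Integration.integrable_sum)
  have "(\<integral>z. 3 * (\<Sum>k\<in>K. (f k z)\<^sup>2)\<^sup>2 + 6 * (\<Sum>k\<in>K. m k * f k z)\<^sup>2 \<partial>intensity)
     \<le> (\<integral>z. 3 * c * (\<Sum>k\<in>K. f k z ^ 4) + 6 * c * (\<Sum>k\<in>K. (m k)\<^sup>2 * (f k z)\<^sup>2) \<partial>intensity)"
  proof (rule Bochner_Integration.integral_mono[OF _ iR ptw])
    have "(\<lambda>z. 3 * (\<Sum>k\<in>K. (f k z)\<^sup>2)\<^sup>2 + 6 * (\<Sum>k\<in>K. m k * f k z)\<^sup>2) \<in> borel_measurable intensity"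
      using meas by measurable
    then show "integrable intensity (\<lambda>z. 3 * (\<Sum>k\<in>K. (f k z)\<^sup>2)\<^sup>2 + 6 * (\<Sum>k\<in>K. m k * f k z)\<^sup>2)"
    proof (rule Bochner_Integration.integrable_bound[OF iR], intro AE_I2)
      fix z
      have "0 \<le> 3 * (\<Sum>k\<in>K. (f k z)\<^sup>2)\<^sup>2 + 6 * (\<Sum>k\<in>K. m k * f k z)\<^sup>2" by simp
      then show "norm (3 * (\<Sum>k\<in>K. (f k z)\<^sup>2)\<^sup>2 + 6 * (\<Sum>k\<in>K. m k * f k z)\<^sup>2)
        \<le> norm (3 * c * (\<Sum>k\<in>K. f k z ^ 4) + 6 * c * (\<Sum>k\<in>K. (m k)\<^sup>2 * (f k z)\<^sup>2))"
        using ptw[of z] by (simp only: real_norm_def abs_of_nonneg)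
    qed
  qed
  also have "\<dots> = 3 * c * (\<Sum>k\<in>K. \<integral>z. f k z ^ 4 \<partial>intensity) + 6 * c * (\<Sum>k\<in>K. (m k)\<^sup>2 * (\<integral>z. (f k z)\<^sup>2 \<partial>intensity))"
    using int(2) i2 by (subst Bochner_Integration.integral_add) (simp_all add: Bochner_Integration.integral_sum)
  also have "\<dots> \<le> 3 * c * (\<Sum>k\<in>K. A4) + 6 * c * (\<Sum>k\<in>K. A1 * A2)"
  proof (intro add_mono mult_left_mono sum_mono mult_mono)
    fix k assume "k \<in> K"
    have "0 \<le> (m k)\<^sup>2" by simp
    also have "\<dots> \<le> A1" using A1[OF \<open>k \<in> K\<close>] by (simp add: m_def)
    finally show "0 \<le> A1" .
  qed (use A1 A2 A4 c0 in \<open>auto simp: m_def\<close>)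
  also have "\<dots> = card K * (3 * c * A4 + 6 * c * A1 * A2)"
    by (simp add: algebra_simps)
  finally have T1: "(\<integral>z. 3 * (\<Sum>k\<in>K. (f k z)\<^sup>2)\<^sup>2 + 6 * (\<Sum>k\<in>K. m k * f k z)\<^sup>2 \<partial>intensity) \<le> card K * (3 * c * A4 + 6 * c * A1 * A2)" .
  have "(\<Sum>k\<in>K. \<Sum>k'\<in>K. (v k k')\<^sup>2) \<le> (\<Sum>k\<in>K. A2 * B)"
  proof (rule sum_mono)
    fix k assume k: "k \<in> K"
    have A2_nonneg: "0 \<le> A2" using order_trans[OF _ A2[OF k]] by simp
    have iab: "integrable intensity (\<lambda>z. \<bar>f k z\<bar> * \<bar>f k' z\<bar>)" if "k' \<in> K" for k'
      using integrable_abs[OF i11[OF k that]] by (simp add: abs_mult)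
    have vle: "\<bar>v k k'\<bar> \<le> (\<integral>z. \<bar>f k z\<bar> * \<bar>f k' z\<bar> \<partial>intensity)" for k'
      unfolding v_def using integral_abs_bound[of intensity "\<lambda>z. f k z * f k' z"] by (simp add: abs_mult)
    have vA: "\<bar>v k k'\<bar> \<le> A2" if k': "k' \<in> K" for k'
    proof -
      have "(\<integral>z. \<bar>f k z\<bar> * \<bar>f k' z\<bar> \<partial>intensity) \<le> (\<integral>z. ((f k z)\<^sup>2 + (f k' z)\<^sup>2) / 2 \<partial>intensity)"
      proof (intro Bochner_Integration.integral_mono iab k')
        show "\<bar>f k z\<bar> * \<bar>f k' z\<bar> \<le> ((f k z)\<^sup>2 + (f k' z)\<^sup>2) / 2" for z
          using sum_squares_bound[of "\<bar>f k z\<bar>" "\<bar>f k' z\<bar>"] by simp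
      qed (use i2 k k' in auto)
      also have "\<dots> = ((\<integral>z. (f k z)\<^sup>2 \<partial>intensity) + (\<integral>z. (f k' z)\<^sup>2 \<partial>intensity)) / 2"
        using i2 k k' by simp
      also have "\<dots> \<le> A2" using A2[OF k] A2[OF k'] by simp
      finally show ?thesis using vle[of k'] by simp
    qed
    have "(\<Sum>k'\<in>K. (v k k')\<^sup>2) \<le> (\<Sum>k'\<in>K. A2 * (\<integral>z. \<bar>f k z\<bar> * \<bar>f k' z\<bar> \<partial>intensity))"
    proof (rule sum_mono)
      fix k' assume k': "k' \<in> K"
      have "(v k k')\<^sup>2 = \<bar>v k k'\<bar> * \<bar>v k k'\<bar>" by (simp add: power2_eq_square)
      also have "\<dots> \<le> A2 * (\<integral>z. \<bar>f k z\<bar> * \<bar>f k' z\<bar> \<partial>intensity)"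
        using vA[OF k'] vle A2_nonneg by (intro mult_mono) auto
      finally show "(v k k')\<^sup>2 \<le> A2 * (\<integral>z. \<bar>f k z\<bar> * \<bar>f k' z\<bar> \<partial>intensity)" .
    qed
    also have "\<dots> = A2 * (\<integral>z. \<bar>f k z\<bar> * (\<Sum>k'\<in>K. \<bar>f k' z\<bar>) \<partial>intensity)"
      using iab by (simp add: sum_distrib_left)
    also have "\<dots> \<le> A2 * (\<integral>z. \<bar>f k z\<bar> * h z \<partial>intensity)"
    proof (intro mult_left_mono A2_nonneg Bochner_Integration.integral_mono B(1) k)
      show "integrable intensity (\<lambda>z. \<bar>f k z\<bar> * (\<Sum>k'\<in>K. \<bar>f k' z\<bar>))"
        using iab by (simp add: sum_distrib_left)
    qed (use h in \<open>auto intro!: mult_left_mono\<close>)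
    also have "\<dots> \<le> A2 * B"
      using B(2)[OF k] A2_nonneg by (rule mult_left_mono)
    finally show "(\<Sum>k'\<in>K. (v k k')\<^sup>2) \<le> A2 * B" .
  qed
  then have T2: "2 * (\<Sum>k\<in>K. \<Sum>k'\<in>K. (v k k')\<^sup>2) \<le> card K * (2 * A2 * B)"
    by simp
  define e where "e = expectation F"
  have var: "variance F \<le> card K * (3 * c * A4 + 6 * c * A1 * A2 + 2 * A2 * B)"
    using V(3) T1 T2 by (simp add: algebra_simps)
  \<comment> \<open>The first absolute moment is at most the standard deviation, since the absolute
    deviation itself has nonnegative variance.\<close>
  let ?Y = "\<lambda>\<omega>. \<bar>F \<omega> - e\<bar>"
  have iY: "integrable P ?Y" using V(1) by simp
  have iY2: "integrable P (\<lambda>\<omega>. (?Y \<omega>)\<^sup>2)"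
    using V(1,2) by (simp add: power2_diff)
  have "0 \<le> variance ?Y" by simp
  also have "\<dots> = expectation (\<lambda>\<omega>. (?Y \<omega>)\<^sup>2) - (expectation ?Y)\<^sup>2"
    using iY iY2 by (rule variance_eq)
  finally have "(expectation ?Y)\<^sup>2 \<le> variance F" by (simp add: e_def)
  then show ?thesis
    using var unfolding e_def by (intro real_le_rsqrt) linarith
qed

end

section \<open>Moments of the marks\<close>

context infinite_source_poisson
begin

lemma integrable_mark_power:
  assumes "p \<le> pstar"
  shows "integrable \<nu> (\<lambda>(v, w). \<bar>w\<bar> ^ p)"
proof (rule Bochner_Integration.integrable_bound)
  show "integrable \<nu> (\<lambda>(v, w). 1 + \<bar>w\<bar> ^ pstar)"
    using Bochner_Integration.integrable_add[OF \<nu>.integrable_const[of 1] moment] by (simp add: case_prod_unfold)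
  have "\<bar>w\<bar> ^ p \<le> 1 + \<bar>w\<bar> ^ pstar" for w :: real
  proof (cases "\<bar>w\<bar> \<le> 1")
    case True
    then have "\<bar>w\<bar> ^ p \<le> 1" by (intro power_le_one) auto
    then show ?thesis by (simp add: add_increasing2)
  next
    case False
    then have "\<bar>w\<bar> ^ p \<le> \<bar>w\<bar> ^ pstar" using assms by (intro power_increasing) auto
    then show ?thesis by simp
  qed
  then show "AE x in \<nu>. norm (case x of (v, w) \<Rightarrow> \<bar>w\<bar> ^ p) \<le> norm (case x of (v, w) \<Rightarrow> 1 + \<bar>w\<bar> ^ pstar)"
    by (intro AE_I2) (auto simp: case_prod_unfold intro: order_trans[OF _ abs_ge_self])
qed measurable

lemma nn_integral_tail:
  assumes "p \<le> pstar" "0 < x"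
  shows "(\<integral>\<^sup>+(v, w). ennreal (\<bar>w\<bar> ^ p * indicator {x<..} v) \<partial>\<nu>) = ennreal (L p x * x powr (-\<alpha>))"
proof -
  have "integrable \<nu> (\<lambda>(v, w). \<bar>w\<bar> ^ p * indicator {x<..} v)"
    using integrable_mark_power[OF assms(1)]
    by (rule Bochner_Integration.integrable_bound) (auto simp: case_prod_unfold indicator_def)
  from nn_integral_eq_integral[OF this] show ?thesis
    using tail[OF assms] by (simp add: case_prod_unfold)
qed

lemma L_pos: "p \<le> pstar \<Longrightarrow> 0 < x \<Longrightarrow> 0 < L p x"
  using L_slowly_varying[of p] by (simp add: slowly_varying_def)

text \<open>The left inequality is strict because the tails of the lifetime are taken over
  \<open>{2 ^ i<..}\<close>.\<close>

lemma dyadic_floor: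
  fixes v :: real
  assumes "1 < v"
  obtains i :: nat where "2 ^ i < v" "v \<le> 2 ^ Suc i"
proof -
  obtain n where n: "v < 2 ^ n" using real_arch_pow[of 2 v] by auto
  define i where "i = (LEAST i. v \<le> 2 ^ Suc i)"
  have ex: "v \<le> 2 ^ Suc n" using n assms by simp
  have 1: "v \<le> 2 ^ Suc i" unfolding i_def using ex by (rule LeastI)
  have "2 ^ i < v"
  proof (cases i)
    case (Suc k)
    have "\<not> v \<le> 2 ^ Suc k" using not_less_Least[of k "\<lambda>i. v \<le> 2 ^ Suc i"] Suc unfolding i_def by simp
    then show ?thesis using Suc by simp
  qed (use assms in simp)
  then show thesis using 1 that by blast
qed

text \<open>Only the slow variation of \<open>L p\<close> along powers of two is used: it makes the dyadic
  tail sums converge by the ratio test.\<close>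

lemma mark_moment_finite:
  assumes p: "p \<le> pstar" and a: "0 \<le> a" "a < \<alpha>"
  obtains C where "0 \<le> C" "(\<integral>\<^sup>+(v, w). ennreal (\<bar>w\<bar> ^ p * (1 + v) powr a) \<partial>\<nu>) \<le> ennreal C"
proof -
  \<comment> \<open>Bounds the contribution of the shell \<open>2 ^ i < v \<le> 2 ^ Suc i\<close>,
    on which \<open>1 + v \<le> 2 ^ (i + 2)\<close>.\<close>
  define u where "u = (\<lambda>i::nat. 2 powr (a * (i + 2)) * (L p (2 ^ i) * (2 ^ i) powr (-\<alpha>)))"
  have Lp: "0 < L p (2 ^ i)" for i using L_pos[OF p] by simp
  have upos: "0 < u i" for i using Lp by (simp add: u_def)
  have ratio: "u (Suc i) / u i = (L p (2 * 2 ^ i) / L p (2 ^ i)) * 2 powr (a - \<alpha>)" for i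
  proof -
    have e: "(2 ^ i) powr (-\<alpha>) = 2 powr (real i * (-\<alpha>))" for i :: nat
      by (simp add: powr_powr flip: powr_realpow)
    have "2 powr (a * (Suc i + 2)) * (2 ^ Suc i) powr (-\<alpha>) = 2 powr (a * (i + 2)) * (2 ^ i) powr (-\<alpha>) * 2 powr (a - \<alpha>)"
      unfolding e by (simp add: algebra_simps flip: powr_add)
    then show ?thesis using Lp[of i] by (simp add: u_def field_simps)
  qed
  have "((\<lambda>x. L p (2 * x) / L p x) \<longlongrightarrow> 1) at_top"
    using L_slowly_varying[OF p] by (simp add: slowly_varying_def)
  moreover have "filterlim (\<lambda>i::nat. 2 ^ i :: real) at_top sequentially"
    by real_asymp
  ultimately have "(\<lambda>i::nat. L p (2 * 2 ^ i) / L p (2 ^ i)) \<longlonglongrightarrow> 1"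
    by (rule filterlim_compose)
  then have "(\<lambda>i. u (Suc i) / u i) \<longlonglongrightarrow> 1 * 2 powr (a - \<alpha>)"
    unfolding ratio by (intro tendsto_mult tendsto_const)
  moreover have lt: "2 powr (a - \<alpha>) < 1" using a by (simp add: powr_less_one)
  \<comment> \<open>Any value strictly between the limit of the ratios and 1 serves; the limit is
    below 1 because a < \<alpha>.\<close>
  define c where "c = (2 powr (a - \<alpha>) + 1) / 2"
  have "2 powr (a - \<alpha>) < c" "c < 1" using lt by (auto simp: c_def)
  ultimately have "\<forall>\<^sub>F i in sequentially. u (Suc i) / u i < c"
    by (intro order_tendstoD) auto
  then obtain n0 where n0: "\<And>i. i \<ge> n0 \<Longrightarrow> u (Suc i) / u i < c"
    by (auto simp: eventually_sequentially)
  have "summable u"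
  proof (rule summable_ratio_test[OF \<open>c < 1\<close>])
    fix i assume "n0 \<le> i"
    from n0[OF this] show "norm (u (Suc i)) \<le> c * norm (u i)"
      using upos[of i] upos[of "Suc i"] by (simp add: field_simps)
  qed
  define E where "E = (\<integral>(v, w). \<bar>w\<bar> ^ p \<partial>\<nu>)"
  have E: "(\<integral>\<^sup>+(v, w). ennreal (\<bar>w\<bar> ^ p) \<partial>\<nu>) = ennreal E"
    using nn_integral_eq_integral[OF integrable_mark_power[OF p]] by (simp add: E_def case_prod_unfold)
  have E0: "0 \<le> E" by (simp add: E_def case_prod_unfold)
  have "(\<integral>\<^sup>+(v, w). ennreal (\<bar>w\<bar> ^ p * (1 + v) powr a) \<partial>\<nu>)
    \<le> (\<integral>\<^sup>+(v, w). ennreal (2 powr a) * ennreal (\<bar>w\<bar> ^ p) + (\<Sum>i. ennreal (2 powr (a * (i + 2))) * ennreal (\<bar>w\<bar> ^ p * indicator {2 ^ i<..} v)) \<partial>\<nu>)"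
  proof (rule nn_integral_mono_AE)
    show "AE x in \<nu>. (case x of (v, w) \<Rightarrow> ennreal (\<bar>w\<bar> ^ p * (1 + v) powr a))
      \<le> (case x of (v, w) \<Rightarrow> ennreal (2 powr a) * ennreal (\<bar>w\<bar> ^ p) + (\<Sum>i. ennreal (2 powr (a * (i + 2))) * ennreal (\<bar>w\<bar> ^ p * indicator {2 ^ i<..} v)))"
      using \<nu>_pos
    proof eventually_elim
      case (elim x)
      obtain v w where x: "x = (v, w)" by fastforce
      with elim have v: "0 < v" by simp
      show ?case
      proof (cases "v \<le> 1")
        case True
        then have "(1 + v) powr a \<le> 2 powr a" using v a by (intro powr_mono2) auto
        then have "ennreal (\<bar>w\<bar> ^ p * (1 + v) powr a) \<le> ennreal (2 powr a * \<bar>w\<bar> ^ p)"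
          by (subst mult.commute) (intro ennreal_leI mult_right_mono, auto)
        then show ?thesis using x by (simp add: ennreal_mult add_increasing2)
      next
        case False
        then obtain i :: nat where i: "2 ^ i < v" "v \<le> 2 ^ Suc i" using dyadic_floor[of v] by auto
        have "1 + v \<le> 2 ^ (i + 2)"
        proof -
          have "1 \<le> (2::real) ^ Suc i" by (rule one_le_power) simp
          then show ?thesis using i by (simp only: power_add) simp
        qed
        then have "(1 + v) powr a \<le> (2 ^ (i + 2)) powr a" using v a by (intro powr_mono2) auto
        also have "(2 ^ (i + 2)) powr a = 2 powr (a * (i + 2))"
          by (subst powr_realpow[symmetric]) (simp_all add: powr_powr mult.commute)
        finally have "ennreal (\<bar>w\<bar> ^ p * (1 + v) powr a) \<le> ennreal (2 powr (a * (i + 2)) * (\<bar>w\<bar> ^ p * indicator {2 ^ i<..} v))"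
          using i by (subst mult.commute) (intro ennreal_leI, simp add: mult_right_mono)
        also have "\<dots> = (\<Sum>n\<in>{i}. ennreal (2 powr (a * (n + 2))) * ennreal (\<bar>w\<bar> ^ p * indicator {2 ^ n<..} v))"
          by (simp add: ennreal_mult)
        also have "\<dots> \<le> (\<Sum>n. ennreal (2 powr (a * (n + 2))) * ennreal (\<bar>w\<bar> ^ p * indicator {2 ^ n<..} v))"
          by (rule sum_le_suminf) auto
        finally show ?thesis using x by (simp add: add_increasing)
      qed
    qed
  qed
  also have "\<dots> = ennreal (2 powr a) * (\<integral>\<^sup>+(v, w). ennreal (\<bar>w\<bar> ^ p) \<partial>\<nu>)
      + (\<Sum>i. ennreal (2 powr (a * (i + 2))) * (\<integral>\<^sup>+(v, w). ennreal (\<bar>w\<bar> ^ p * indicator {2 ^ i<..} v) \<partial>\<nu>))"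
    by (simp add: case_prod_unfold nn_integral_add nn_integral_cmult nn_integral_suminf)
  also have "\<dots> = ennreal (2 powr a * E) + (\<Sum>i. ennreal (u i))"
    unfolding E nn_integral_tail[OF p zero_less_power[OF zero_less_numeral]] u_def
    using Lp E0 by (intro arg_cong2[where f="(+)"] suminf_cong) (auto simp: ennreal_mult[symmetric] less_imp_le)
  also have "\<dots> = ennreal (2 powr a * E + (\<Sum>i. u i))"
    using upos \<open>summable u\<close> E0
    by (subst suminf_ennreal2) (auto simp: less_imp_le suminf_nonneg intro!: ennreal_plus[symmetric])
  finally show thesis
    using that upos \<open>summable u\<close> E0 by (metis add_nonneg_nonneg less_imp_le mult_nonneg_nonneg powr_ge_zero suminf_nonneg)
qed

text \<open>With \<open>L p\<close> bounded, the dyadic shells below the truncation level are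
  dominated by a geometric sum. Its ratio exceeds 1, so the last term decides the order and no
  slowly varying factor is left.\<close>

lemma truncated_moment_bound:
  assumes p: "p \<le> pstar" and bdd: "bounded (L p ` {0<..})"
  obtains C where "0 \<le> C"
    "\<And>j::nat. (\<integral>\<^sup>+(v, w). ennreal (\<bar>w\<bar> ^ p * (min (2 ^ j) (1 + v)) ^ 4) \<partial>\<nu>) \<le> ennreal (C * 2 powr ((4 - \<alpha>) * j))"
proof -
  obtain B where B: "\<And>x. 0 < x \<Longrightarrow> L p x \<le> B"
    using bdd unfolding bounded_iff by (metis abs_le_D1 greaterThan_iff image_eqI real_norm_def)
  have B0: "0 \<le> B" using B[of 1] L_pos[OF p, of 1] by simp
  define E where "E = (\<integral>(v, w). \<bar>w\<bar> ^ p \<partial>\<nu>)"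
  have E: "(\<integral>\<^sup>+(v, w). ennreal (\<bar>w\<bar> ^ p) \<partial>\<nu>) = ennreal E"
    using nn_integral_eq_integral[OF integrable_mark_power[OF p]] by (simp add: E_def case_prod_unfold)
  have E0: "0 \<le> E" by (simp add: E_def case_prod_unfold)
  \<comment> \<open>Ratio at least 2 is what makes the sum of the powers below j at most
    \<open>r ^ j\<close>, with constant 1.\<close>
  define r :: real where "r = 2 powr (4 - \<alpha>)"
  have r: "2 \<le> r"
    unfolding r_def using powr_mono[of 1 "4 - \<alpha>" 2] \<alpha>_range by simp
  have rj: "2 powr ((4 - \<alpha>) * j) = r ^ j" for j :: nat
    by (simp add: r_def powr_powr flip: powr_realpow)
  have "(\<integral>\<^sup>+(v, w). ennreal (\<bar>w\<bar> ^ p * (min (2 ^ j) (1 + v)) ^ 4) \<partial>\<nu>) \<le> ennreal ((16 * E + 256 * B) * 2 powr ((4 - \<alpha>) * j))" for j :: nat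
  proof -
    have "(\<integral>\<^sup>+(v, w). ennreal (\<bar>w\<bar> ^ p * (min (2 ^ j) (1 + v)) ^ 4) \<partial>\<nu>)
      \<le> (\<integral>\<^sup>+(v, w). ennreal 16 * ennreal (\<bar>w\<bar> ^ p) + (\<Sum>i<j. ennreal (256 * 16 ^ i) * ennreal (\<bar>w\<bar> ^ p * indicator {2 ^ i<..} v)) \<partial>\<nu>)"
    proof (rule nn_integral_mono_AE)
      show "AE x in \<nu>. (case x of (v, w) \<Rightarrow> ennreal (\<bar>w\<bar> ^ p * (min (2 ^ j) (1 + v)) ^ 4))
        \<le> (case x of (v, w) \<Rightarrow> ennreal 16 * ennreal (\<bar>w\<bar> ^ p) + (\<Sum>i<j. ennreal (256 * 16 ^ i) * ennreal (\<bar>w\<bar> ^ p * indicator {2 ^ i<..} v)))"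
        using \<nu>_pos
      proof eventually_elim
        case (elim x)
        obtain v w where x: "x = (v, w)" by fastforce
        with elim have v: "0 < v" by simp
        let ?S = "(\<Sum>i<j. ennreal (256 * 16 ^ i) * ennreal (\<bar>w\<bar> ^ p * indicator {2 ^ i<..} v))"
        show ?case
        proof (cases "v \<le> 1 \<or> j = 0")
          case True
          then have "(min (2 ^ j) (1 + v)) ^ 4 \<le> 2 ^ 4" using v by (intro power_mono) auto
          then have "ennreal (\<bar>w\<bar> ^ p * (min (2 ^ j) (1 + v)) ^ 4) \<le> ennreal (16 * \<bar>w\<bar> ^ p)"
            by (subst mult.commute) (intro ennreal_leI mult_right_mono, auto)
          also have "\<dots> \<le> ennreal 16 * ennreal (\<bar>w\<bar> ^ p) + ?S"
            by (simp add: ennreal_mult add_increasing2 del: ennreal_numeral)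
          finally show ?thesis using x by simp
        next
          case False
          then obtain k :: nat where k: "2 ^ k < v" "v \<le> 2 ^ Suc k" using dyadic_floor[of v] by auto
          \<comment> \<open>Truncation at \<open>2 ^ j\<close> lets all longer lifetimes be charged
            to the last shell \<open>j - 1\<close>.\<close>
          define i where "i = min k (j - 1)"
          have i: "i < j" "2 ^ i < v"
          proof -
            show "i < j" using False by (simp add: i_def min_def) linarith
            have "(2::real) ^ i \<le> 2 ^ k" by (intro power_increasing) (auto simp: i_def)
            then show "2 ^ i < v" using k(1) by (rule le_less_trans)
          qed
          have m: "min (2 ^ j) (1 + v) \<le> 2 ^ (i + 2)"
          proof (cases "k \<le> j - 1")
            case True
            then have "i = k" by (simp add: i_def)
            moreover have "1 \<le> (2::real) ^ Suc k" by (rule one_le_power) simp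
            ultimately show ?thesis using k by (simp only: power_add) simp
          next
            case False
            then have "j \<le> i + 2" by (simp add: i_def)
            then have "(2::real) ^ j \<le> 2 ^ (i + 2)" by (intro power_increasing) auto
            then show ?thesis by simp
          qed
          then have "(min (2 ^ j) (1 + v)) ^ 4 \<le> (2 ^ (i + 2)) ^ 4" using v by (intro power_mono) auto
          also have "(2 ^ (i + 2)) ^ 4 = (256 * 16 ^ i :: real)"
          proof -
            have "(2 ^ (i + 2)) ^ 4 = ((2::real) ^ 4) ^ (i + 2)" by (simp only: power_mult[symmetric] mult.commute)
            then show ?thesis by (simp add: power_add)
          qed
          finally have "ennreal (\<bar>w\<bar> ^ p * (min (2 ^ j) (1 + v)) ^ 4) \<le> ennreal (256 * 16 ^ i * (\<bar>w\<bar> ^ p * indicator {2 ^ i<..} v))"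
            using i by (subst mult.commute) (intro ennreal_leI, simp add: mult_right_mono)
          also have "\<dots> = (\<Sum>n\<in>{i}. ennreal (256 * 16 ^ n) * ennreal (\<bar>w\<bar> ^ p * indicator {2 ^ n<..} v))"
            by (simp add: ennreal_mult)
          also have "\<dots> \<le> ?S"
            using i by (intro sum_mono2) auto
          finally show ?thesis using x by (simp add: add_increasing)
        qed
      qed
    qed
    also have "\<dots> = ennreal 16 * (\<integral>\<^sup>+(v, w). ennreal (\<bar>w\<bar> ^ p) \<partial>\<nu>)
      + (\<Sum>i<j. ennreal (256 * 16 ^ i) * (\<integral>\<^sup>+(v, w). ennreal (\<bar>w\<bar> ^ p * indicator {2 ^ i<..} v) \<partial>\<nu>))"
      by (simp add: case_prod_unfold nn_integral_add nn_integral_cmult nn_integral_sum del: ennreal_numeral)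
    also have "\<dots> = ennreal (16 * E + (\<Sum>i<j. 256 * 16 ^ i * (L p (2 ^ i) * (2 ^ i) powr (-\<alpha>))))"
      unfolding E nn_integral_tail[OF p zero_less_power[OF zero_less_numeral]]
      using L_pos[OF p] E0
      by (subst ennreal_plus) (auto simp: ennreal_mult[symmetric] less_imp_le sum_nonneg simp del: ennreal_numeral ennreal_plus)
    also have "\<dots> \<le> ennreal ((16 * E + 256 * B) * r ^ j)"
    proof (rule ennreal_leI)
      have "256 * 16 ^ i * (L p (2 ^ i) * (2 ^ i) powr (-\<alpha>)) \<le> 256 * B * r ^ i" for i
      proof -
        have "16 ^ i * (2 ^ i) powr (-\<alpha>) = r ^ i"
        proof -
          have "(16::real) ^ i = (2 ^ i) powr 4"
          proof -
            have "(16::real) ^ i = (2 ^ 4) ^ i" by simp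
            also have "\<dots> = (2 ^ i) ^ 4" by (simp only: power_mult[symmetric] mult.commute)
            finally show ?thesis by simp
          qed
          then have "16 ^ i * (2 ^ i) powr (-\<alpha>) = (2 ^ i) powr (4 - \<alpha>)" by (simp add: powr_diff powr_minus divide_inverse)
          also have "\<dots> = r ^ i" by (simp add: r_def powr_powr mult.commute flip: powr_realpow)
          finally show ?thesis .
        qed
        moreover have "256 * 16 ^ i * (l * x) = 256 * l * (16 ^ i * x)" for l x :: real
          by simp
        ultimately have "256 * 16 ^ i * (L p (2 ^ i) * (2 ^ i) powr (-\<alpha>)) = 256 * L p (2 ^ i) * r ^ i"
          by simp
        also have "\<dots> \<le> 256 * B * r ^ i"
          using B[of "2 ^ i"] r by (intro mult_right_mono) auto
        finally show ?thesis .
      qed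
      then have "(\<Sum>i<j. 256 * 16 ^ i * (L p (2 ^ i) * (2 ^ i) powr (-\<alpha>))) \<le> (\<Sum>i<j. 256 * B * r ^ i)"
        by (rule sum_mono)
      also have "\<dots> = 256 * B * (\<Sum>i<j. r ^ i)" by (simp add: sum_distrib_left)
      also have "(\<Sum>i<j. r ^ i) \<le> r ^ j"
      proof (induction j)
        case (Suc j)
        have "r ^ j + r ^ j \<le> r * r ^ j" using r by (simp flip: mult_2)
        then show ?case using Suc by simp
      qed simp
      finally have "(\<Sum>i<j. 256 * 16 ^ i * (L p (2 ^ i) * (2 ^ i) powr (-\<alpha>))) \<le> 256 * B * r ^ j"
        using B0 by (simp add: mult_left_mono)
      moreover have "16 * E \<le> 16 * E * r ^ j"
        using r E0 one_le_power[of r j] by (simp add: mult_le_cancel_left1)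
      ultimately show "16 * E + (\<Sum>i<j. 256 * 16 ^ i * (L p (2 ^ i) * (2 ^ i) powr (-\<alpha>))) \<le> (16 * E + 256 * B) * r ^ j"
        by (simp add: distrib_right)
    qed
    finally show ?thesis unfolding rj .
  qed
  moreover have "0 \<le> 16 * E + 256 * B" using E0 B0 by simp
  ultimately show thesis using that by blast
qed

end

section \<open>Wavelet kernels\<close>

lemma abs_integral_le_interval:
  fixes f :: "real \<Rightarrow> real"
  assumes "f \<in> borel_measurable borel" "\<And>s. \<bar>f s\<bar> \<le> c" "\<And>s. s \<notin> {a..b} \<Longrightarrow> f s = 0" "a \<le> b"
  shows "integrable lborel f" "\<bar>\<integral>s. f s \<partial>lborel\<bar> \<le> c * (b - a)"
proof -
  have c: "0 \<le> c" using assms(2)[of 0] by linarith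
  have i: "integrable lborel (\<lambda>s. c * indicator {a..b} s)"
    using assms(4) by (intro integrable_mult_right integrable_real_indicator) auto
  have le: "\<bar>f s\<bar> \<le> c * indicator {a..b} s" for s
    using assms(2,3) c by (auto simp: indicator_def)
  show int: "integrable lborel f"
    using i by (rule Bochner_Integration.integrable_bound) (use assms(1) le c in \<open>auto intro!: AE_I2\<close>)
  have "\<bar>\<integral>s. f s \<partial>lborel\<bar> \<le> (\<integral>s. \<bar>f s\<bar> \<partial>lborel)" by (rule integral_abs_bound)
  also have "\<dots> \<le> (\<integral>s. c * indicator {a..b} s \<partial>lborel)"
    using int i le by (intro Bochner_Integration.integral_mono) auto
  also have "\<dots> = c * (b - a)" using assms(4) by simp
  finally show "\<bar>\<integral>s. f s \<partial>lborel\<bar> \<le> c * (b - a)" .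
qed

context wavelet_setting
begin

lemma \<psi>_bound: obtains B where "0 < B" "\<And>s. \<bar>\<psi> s\<bar> \<le> B"
  using \<psi>_bounded unfolding bounded_pos by (metis rangeI real_norm_def)

lemma \<phi>_bound: obtains B where "0 < B" "\<And>s. \<bar>\<phi> s\<bar> \<le> B"
  using \<phi>_bounded unfolding bounded_pos by (metis rangeI real_norm_def)

lemma measurable_wavelet [measurable]: "wavelet \<psi> j k \<in> borel_measurable borel"
  unfolding wavelet_def using \<psi>_measurable by measurable

lemma wavelet_support:
  assumes "wavelet \<psi> j k s \<noteq> 0"
  shows "of_int k * 2 ^ j \<le> s" "s \<le> (of_int k + M) * 2 ^ j"
proof -
  have "2 powr - real j * s - of_int k \<in> {0..M}"
    using assms by (rule contrapos_np) (simp add: wavelet_def \<psi>_support)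
  then have "of_int k \<le> s / 2 ^ j \<and> s / 2 ^ j \<le> of_int k + M"
    by (auto simp: powr_minus powr_realpow divide_inverse mult.commute)
  then show "of_int k * 2 ^ j \<le> s" "s \<le> (of_int k + M) * 2 ^ j"
    by (auto simp: field_simps)
qed

lemma wavelet_bound: "(\<And>s. \<bar>\<psi> s\<bar> \<le> B) \<Longrightarrow> \<bar>wavelet \<psi> j k s\<bar> \<le> 2 powr (- real j / 2) * B"
  by (simp add: wavelet_def abs_mult)

lemma integrable_wavelet: "integrable lborel (wavelet \<psi> j k)"
proof -
  obtain B where B: "0 < B" "\<And>s. \<bar>\<psi> s\<bar> \<le> B" using \<psi>_bound by blast
  show ?thesis
    using M_ge_1 wavelet_support[of j k]
    by (intro abs_integral_le_interval(1)[OF measurable_wavelet wavelet_bound[OF B(2)], where a="of_int k * 2 ^ j" and b="(of_int k + M) * 2 ^ j"]) force+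
qed

lemma integral_wavelet: "(\<integral>s. wavelet \<psi> j k s \<partial>lborel) = 0"
proof -
  have "(\<integral>s. \<psi> s \<partial>lborel) = (LINT s:{0..M}|lborel. \<psi> s)"
    unfolding set_lebesgue_integral_def
    using \<psi>_support by (intro Bochner_Integration.integral_cong) (auto simp: indicator_def)
  then have \<psi>0: "(\<integral>s. \<psi> s \<partial>lborel) = 0" using \<psi>_integral by simp
  have "(\<integral>s. \<psi> s \<partial>lborel) = \<bar>2 powr - real j\<bar> *\<^sub>R (\<integral>s. \<psi> (- of_int k + 2 powr - real j * s) \<partial>lborel)"
    by (rule lborel_integral_real_affine) simp
  moreover have "- of_int k + 2 powr - real j * s = 2 powr - real j * s - of_int k" for s
    by simp
  ultimately have "(\<integral>s. \<psi> (2 powr - real j * s - of_int k) \<partial>lborel) = 0"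
    using \<psi>0 by (simp only:) simp
  then show ?thesis by (simp add: wavelet_def)
qed

end

text \<open>Both observation schemes have coefficients of the form
  \<open>d j k = (\<Sum>l. U l * (\<integral>s. \<psi>\<^sub>j\<^sub>k s * I s (t l) (\<eta> l)))\<close>, where \<open>I s x v\<close> is the indicator of
  \<open>x \<le> s < x + v\<close> or its interpolation from the integers. The locale collects what the two cases
  have in common.\<close>

locale coverage = wavelet_setting M \<psi> \<phi> for M \<psi> \<phi> +
  fixes I :: "real \<Rightarrow> real \<Rightarrow> real \<Rightarrow> real" and Imax :: real
  assumes I_measurable: "(\<lambda>(s, x, v). I s x v) \<in> borel_measurable (borel \<Otimes>\<^sub>M borel \<Otimes>\<^sub>M borel)"
    and I_bound: "\<And>s x v. \<bar>I s x v\<bar> \<le> Imax"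
    and I_empty: "\<And>s x v. v \<le> 0 \<Longrightarrow> I s x v = 0"
    and I_outside: "\<And>s x v. s < x - M \<or> x + v + M < s \<Longrightarrow> I s x v = 0"
    and I_inside: "\<And>s x v. x + M \<le> s \<Longrightarrow> s < x + v - M \<Longrightarrow> I s x v = 1"
    and I_past: "\<And>s x v. 0 < s \<Longrightarrow> x < 0 \<Longrightarrow> x + v \<le> 0 \<Longrightarrow> I s x v = 0"
    and I_integral: "\<And>s v. 0 < v \<Longrightarrow> (\<integral>x. I s x v \<partial>lborel) = v"
begin

definition kernel :: "nat \<Rightarrow> int \<Rightarrow> real \<Rightarrow> real \<Rightarrow> real" where
  "kernel j k x v = (\<integral>s. wavelet \<psi> j k s * I s x v \<partial>lborel)"

lemma I_measurable' [measurable (raw)]: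
  assumes "f \<in> borel_measurable N" "g \<in> borel_measurable N" "h \<in> borel_measurable N"
  shows "(\<lambda>z. I (f z) (g z) (h z)) \<in> borel_measurable N"
proof -
  have "(\<lambda>z. (f z, g z, h z)) \<in> N \<rightarrow>\<^sub>M borel \<Otimes>\<^sub>M borel \<Otimes>\<^sub>M borel"
    using assms by measurable
  from measurable_compose[OF this I_measurable] show ?thesis by simp
qed

lemma Imax_nonneg: "0 \<le> Imax"
  using order_trans[OF abs_ge_zero I_bound] .

lemma measurable_kernel [measurable (raw)]:
  assumes [measurable]: "g \<in> borel_measurable N" "h \<in> borel_measurable N"
  shows "(\<lambda>z. kernel j k (g z) (h z)) \<in> borel_measurable N"
proof -
  have "(\<lambda>p. \<integral>s. wavelet \<psi> j k s * I s (fst p) (snd p) \<partial>lborel) \<in> borel_measurable (borel \<Otimes>\<^sub>M borel)"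
    by (intro lborel.borel_measurable_lebesgue_integral) measurable
  moreover have "(\<lambda>z. (g z, h z)) \<in> N \<rightarrow>\<^sub>M borel \<Otimes>\<^sub>M borel" by measurable
  ultimately show ?thesis
    using measurable_compose[of "\<lambda>z. (g z, h z)" N] by (fastforce simp: kernel_def)
qed

lemma kernel_integrand_bound:
  assumes "\<And>s. \<bar>\<psi> s\<bar> \<le> B"
  shows "\<bar>wavelet \<psi> j k s * I s x v\<bar> \<le> 2 powr (- real j / 2) * B * Imax"
  unfolding abs_mult using wavelet_bound[of B j k s] I_bound[of s x v] assms abs_ge_zero[of "\<psi> 0"]
  by (intro mult_mono) (auto intro!: mult_nonneg_nonneg order_trans[OF abs_ge_zero assms])

lemma kernel_empty: "v \<le> 0 \<Longrightarrow> kernel j k x v = 0"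
  by (simp add: kernel_def I_empty)

text \<open>The integrand lives on the wavelet support, of length M 2^j, and also on the lifetime
  enlarged by M on both sides, of length v + 2 M. Each length gives one side of the minimum. The
  added 1 makes the constant positive even if \<open>Imax\<close> is 0.\<close>

lemma kernel_bound:
  obtains C where "0 < C" "\<And>j k x v. 0 < v \<Longrightarrow> \<bar>kernel j k x v\<bar> \<le> C * 2 powr (- real j / 2) * min (2 ^ j) (1 + v)"
proof -
  obtain B where B: "0 < B" "\<And>s. \<bar>\<psi> s\<bar> \<le> B" using \<psi>_bound by blast
  have bound: "\<bar>kernel j k x v\<bar> \<le> (B * Imax * (3 * M) + 1) * 2 powr (- real j / 2) * min (2 ^ j) (1 + v)" if v: "0 < v" for j k x v
  proof -
    let ?c = "2 powr (- real j / 2) * B * Imax"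
    have c0: "0 \<le> ?c" using B Imax_nonneg by simp
    have meas: "(\<lambda>s. wavelet \<psi> j k s * I s x v) \<in> borel_measurable borel" by measurable
    have M0: "0 < M" using M_ge_1 by simp
    have "\<bar>kernel j k x v\<bar> \<le> ?c * ((of_int k + M) * 2 ^ j - of_int k * 2 ^ j)"
      unfolding kernel_def using wavelet_support[of j k] M0
      by (intro abs_integral_le_interval(2)[OF meas kernel_integrand_bound[OF B(2)]]) force+
    also have "\<dots> = ?c * (M * 2 ^ j)" by (simp add: algebra_simps)
    also have "\<dots> \<le> ?c * (3 * M * 2 ^ j)" using c0 M0 by (intro mult_left_mono) auto
    finally have 1: "\<bar>kernel j k x v\<bar> \<le> ?c * (3 * M * 2 ^ j)" .
    have "\<bar>kernel j k x v\<bar> \<le> ?c * ((x + v + M) - (x - M))"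
      unfolding kernel_def using I_outside[of _ x v] M0 v
      by (intro abs_integral_le_interval(2)[OF meas kernel_integrand_bound[OF B(2)]]) force+
    also have "\<dots> \<le> ?c * (3 * M * (1 + v))"
    proof (intro mult_left_mono c0)
      have "1 * v \<le> 3 * M * v" using M_ge_1 v by (intro mult_right_mono) auto
      then show "x + v + M - (x - M) \<le> 3 * M * (1 + v)" using M0 by (simp add: distrib_left)
    qed
    finally have 2: "\<bar>kernel j k x v\<bar> \<le> ?c * (3 * M * (1 + v))" .
    have "\<bar>kernel j k x v\<bar> \<le> ?c * (3 * M * min (2 ^ j) (1 + v))"
      using 1 2 by (auto simp: min_def)
    also have "\<dots> = (B * Imax * (3 * M)) * (2 powr (- real j / 2) * min (2 ^ j) (1 + v))" by simp
    also have "\<dots> \<le> (B * Imax * (3 * M) + 1) * (2 powr (- real j / 2) * min (2 ^ j) (1 + v))"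
      using v by (intro mult_right_mono) auto
    finally show ?thesis by (simp add: mult.assoc)
  qed
  have "0 < B * Imax * (3 * M) + 1" using B Imax_nonneg M_ge_1 by (intro add_nonneg_pos) auto
  then show thesis using bound that by blast
qed

text \<open>The wavelet support enlarged by the margin M that \<open>I_outside\<close> and
  \<open>I_inside\<close> leave open around birth and death.\<close>

definition reach :: "nat \<Rightarrow> int \<Rightarrow> real set" where
  "reach j k = {of_int k * 2 ^ j - M .. (of_int k + M) * 2 ^ j + M}"

text \<open>If neither birth nor death is near the wavelet support, coverage is constant there: 0
  when the life misses the support, and 1 when it contains it. In the second case the wavelet
  integrates to 0.\<close>

lemma kernel_support:
  assumes "kernel j k x v \<noteq> 0"
  shows "x \<in> reach j k \<or> x + v \<in> reach j k"
proof (rule ccontr)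
  assume n: "\<not> (x \<in> reach j k \<or> x + v \<in> reach j k)"
  have v: "0 < v" using assms kernel_empty[of v j k x] by force
  let ?a = "of_int k * 2 ^ j" and ?b = "(of_int k + M) * 2 ^ j"
  consider "?b + M < x" | "x + v < ?a - M" | "x < ?a - M" "?b + M < x + v"
    using n v unfolding reach_def by force
  then have "kernel j k x v = 0"
  proof cases
    case 1
    have "(\<lambda>s. wavelet \<psi> j k s * I s x v) = (\<lambda>s. 0)"
      using wavelet_support[of j k] I_outside[of _ x v] 1 by (force simp: fun_eq_iff)
    then show ?thesis by (simp add: kernel_def)
  next
    case 2
    have "(\<lambda>s. wavelet \<psi> j k s * I s x v) = (\<lambda>s. 0)"
      using wavelet_support[of j k] I_outside[of _ x v] 2 by (force simp: fun_eq_iff)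
    then show ?thesis by (simp add: kernel_def)
  next
    case 3
    have "(\<lambda>s. wavelet \<psi> j k s * I s x v) = wavelet \<psi> j k"
      using wavelet_support[of j k] I_inside[of x _ v] 3 by (force simp: fun_eq_iff)
    then show ?thesis by (simp add: kernel_def integral_wavelet)
  qed
  then show False using assms by simp
qed

lemma measure_reach: "emeasure lborel {of_int k * 2 ^ j - M - v .. (of_int k + M) * 2 ^ j + M - v} \<le> ennreal (3 * M * 2 ^ j)"
proof -
  have "M \<le> M * 2 ^ j" using M_ge_1 one_le_power[of "2::real" j] by (simp add: mult_le_cancel_left1)
  then have le: "(of_int k + M) * 2 ^ j + M - v - (of_int k * 2 ^ j - M - v) \<le> 3 * M * 2 ^ j"
    by (simp add: distrib_right)
  have "of_int k * 2 ^ j - M - v \<le> (of_int k + M) * 2 ^ j + M - v"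
    using M_ge_1 by (simp add: distrib_right)
  then show ?thesis
    by (subst emeasure_lborel_Icc) (use le in \<open>auto intro!: ennreal_leI\<close>)
qed

text \<open>The bound does not depend on \<open>v\<close>. Integration over birth times thus costs a
  factor of order \<open>2 ^ j\<close> even for very long lifetimes.\<close>

lemma measure_kernel_support:
  "emeasure lborel {x. x \<in> reach j k \<or> x + v \<in> reach j k} \<le> ennreal (6 * M * 2 ^ j)"
proof -
  have eq: "{x. x \<in> reach j k \<or> x + v \<in> reach j k} = reach j k \<union> {of_int k * 2 ^ j - M - v .. (of_int k + M) * 2 ^ j + M - v}"
    by (auto simp: reach_def)
  have "emeasure lborel {x. x \<in> reach j k \<or> x + v \<in> reach j k} \<le> emeasure lborel (reach j k) + emeasure lborel {of_int k * 2 ^ j - M - v .. (of_int k + M) * 2 ^ j + M - v}"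
    unfolding eq by (intro emeasure_subadditive) (auto simp: reach_def)
  also have "\<dots> \<le> ennreal (3 * M * 2 ^ j) + ennreal (3 * M * 2 ^ j)"
    using measure_reach[of k j 0] by (intro add_mono measure_reach) (simp add: reach_def)
  also have "\<dots> = ennreal (6 * M * 2 ^ j)"
    using M_ge_1 by (subst ennreal_plus[symmetric]) auto
  finally show ?thesis .
qed

text \<open>Dividing by 2^j confines k to an interval of length 3 M, since the margin M is at most M
  2^j.\<close>

lemma card_reach: "finite {k. x \<in> reach j k}" "real (card {k. x \<in> reach j k}) \<le> 3 * M + 1"
proof -
  let ?y = "x / 2 ^ j"
  have sub: "{k. x \<in> reach j k} \<subseteq> {\<lceil>?y - 2 * M\<rceil>..\<lfloor>?y + M\<rfloor>}"
  proof
    fix k assume "k \<in> {k. x \<in> reach j k}"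
    then have k: "of_int k * 2 ^ j - M \<le> x" "x \<le> (of_int k + M) * 2 ^ j + M" by (auto simp: reach_def)
    have "M \<le> M * 2 ^ j" using M_ge_1 one_le_power[of "2::real" j] by (simp add: mult_le_cancel_left1)
    then have "(of_int k - M) * 2 ^ j \<le> x" "x \<le> (of_int k + 2 * M) * 2 ^ j" using k by (auto simp: algebra_simps)
    then have "of_int k - M \<le> ?y" "?y \<le> of_int k + 2 * M" by (auto simp: field_simps)
    then show "k \<in> {\<lceil>?y - 2 * M\<rceil>..\<lfloor>?y + M\<rfloor>}" by (auto simp: ceiling_le_iff le_floor_iff)
  qed
  show "finite {k. x \<in> reach j k}" using sub by (rule finite_subset) simp
  have "real (card {k. x \<in> reach j k}) \<le> real (card {\<lceil>?y - 2 * M\<rceil>..\<lfloor>?y + M\<rfloor>})"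
    using sub by (intro of_nat_mono card_mono) auto
  also have "\<dots> = real (nat (\<lfloor>?y + M\<rfloor> + 1 - \<lceil>?y - 2 * M\<rceil>))" by simp
  also have "\<dots> \<le> 3 * M + 1"
  proof -
    have "real_of_int (\<lfloor>?y + M\<rfloor> + 1 - \<lceil>?y - 2 * M\<rceil>) \<le> 3 * M + 1"
      using of_int_floor_le[of "?y + M"] le_of_int_ceiling[of "?y - 2 * M"] by linarith
    then show ?thesis using M_ge_1 by simp
  qed
  finally show "real (card {k. x \<in> reach j k}) \<le> 3 * M + 1" .
qed

text \<open>Each of the two endpoints of the life lies in the reach of at most 3 M + 1
  shifts.\<close>

lemma kernel_overlap:
  shows "real (card {k\<in>K. kernel j k x v \<noteq> 0}) \<le> 6 * M + 2"
proof -
  have sub: "{k\<in>K. kernel j k x v \<noteq> 0} \<subseteq> {k. x \<in> reach j k} \<union> {k. x + v \<in> reach j k}"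
    using kernel_support by blast
  have "real (card {k\<in>K. kernel j k x v \<noteq> 0}) \<le> real (card ({k. x \<in> reach j k} \<union> {k. x + v \<in> reach j k}))"
    using sub card_reach(1) by (intro of_nat_mono card_mono) auto
  also have "\<dots> \<le> real (card {k. x \<in> reach j k}) + real (card {k. x + v \<in> reach j k})"
    using card_Un_le by (metis of_nat_add of_nat_mono)
  also have "\<dots> \<le> 6 * M + 2" using card_reach(2)[of x j] card_reach(2)[of "x + v" j] by simp
  finally show ?thesis .
qed

text \<open>A source dead by time 0 is invisible to nonnegative shifts. \<open>I_past\<close> speaks
  only of s > 0, because at s = 0 interpolation may still read the grid point -1; that single time
  is a null set.\<close>

lemma kernel_past:
  assumes "0 \<le> k" "x < 0" "x + v \<le> 0"
  shows "kernel j k x v = 0"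
proof -
  have "AE s in lborel. s \<noteq> (0::real)" by (rule AE_lborel_singleton)
  then have "AE s in lborel. wavelet \<psi> j k s * I s x v = 0"
  proof eventually_elim
    case (elim s)
    show ?case
    proof (cases "0 < s")
      case True
      then show ?thesis using I_past assms by simp
    next
      case False
      have "wavelet \<psi> j k s = 0"
      proof (rule ccontr)
        assume "wavelet \<psi> j k s \<noteq> 0"
        from wavelet_support(1)[OF this] assms have "0 \<le> s"
          by (metis mult_nonneg_nonneg of_int_0_le_iff order_trans zero_le_numeral zero_le_power)
        then show False using False elim by simp
      qed
      then show ?thesis by simp
    qed
  qed
  then show ?thesis unfolding kernel_def by (rule integral_eq_zero_AE)
qed

text \<open>Integrating over the birth time first gives \<open>v\<close> at every \<open>s\<close>,
  and what is left is a multiple of the integral of the wavelet.\<close>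

lemma kernel_integral:
  assumes v: "0 < v"
  shows "integrable lborel (\<lambda>x. kernel j k x v)" "(\<integral>x. kernel j k x v \<partial>lborel) = 0"
proof -
  obtain B where B: "0 < B" "\<And>s. \<bar>\<psi> s\<bar> \<le> B" using \<psi>_bound by blast
  let ?a = "of_int k * 2 ^ j" and ?b = "(of_int k + M) * 2 ^ j"
  let ?F = "\<lambda>s x. wavelet \<psi> j k s * I s x v"
  let ?c = "2 powr (- real j / 2) * B * Imax"
  let ?Q = "{?a..?b} \<times> {?a - v - M..?b + M}"
  have c0: "0 \<le> ?c" using B Imax_nonneg by simp
  have F0: "?F s x = 0" if "(s, x) \<notin> ?Q" for s x
    using that wavelet_support[of j k s] I_outside[of s x v] by force
  have le: "\<bar>?F s x\<bar> \<le> ?c * indicator ?Q (s, x)" for s x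
    using kernel_integrand_bound[OF B(2), of j k s x v] F0[of s x] by (cases "(s, x) \<in> ?Q") auto
  have "integrable (lborel \<Otimes>\<^sub>M lborel) (\<lambda>z. ?c * indicator ?Q z)"
  proof (intro integrable_mult_right integrable_real_indicator)
    show "emeasure (lborel \<Otimes>\<^sub>M lborel) ?Q < \<infinity>"
      by (subst lborel.emeasure_pair_measure_Times) (auto simp: ennreal_mult_less_top emeasure_lborel_Icc_eq)
  qed simp
  then have int: "integrable (lborel \<Otimes>\<^sub>M lborel) (\<lambda>(s, x). ?F s x)"
  proof (rule Bochner_Integration.integrable_bound)
    show "AE z in lborel \<Otimes>\<^sub>M lborel. norm (case z of (s, x) \<Rightarrow> ?F s x) \<le> norm (?c * indicator ?Q z)"
    proof (rule AE_I2)
      fix z :: "real \<times> real"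
      obtain s x where z: "z = (s, x)" by fastforce
      show "norm (case z of (s, x) \<Rightarrow> ?F s x) \<le> norm (?c * indicator ?Q z)"
        using order_trans[OF le abs_ge_self] unfolding z by simp
    qed
  qed measurable
  show "integrable lborel (\<lambda>x. kernel j k x v)"
    unfolding kernel_def using lborel_pair.integrable_snd[OF int] .
  have "(\<integral>x. kernel j k x v \<partial>lborel) = (\<integral>s. (\<integral>x. ?F s x \<partial>lborel) \<partial>lborel)"
    unfolding kernel_def using lborel_pair.Fubini_integral[OF int] .
  also have "\<dots> = (\<integral>s. wavelet \<psi> j k s * v \<partial>lborel)"
    using I_integral[OF v] by simp
  also have "\<dots> = 0" by (simp add: integral_wavelet)
  finally show "(\<integral>x. kernel j k x v \<partial>lborel) = 0" .
qed

end

section \<open>Deviation of the level sums\<close>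

lemma integrable_if_nn_integral_le:
  fixes f :: "'b \<Rightarrow> real"
  assumes "f \<in> borel_measurable N" "(\<integral>\<^sup>+x. ennreal \<bar>f x\<bar> \<partial>N) \<le> ennreal C" "0 \<le> C"
  shows "integrable N f" "(\<integral>x. \<bar>f x\<bar> \<partial>N) \<le> C" "\<bar>\<integral>x. f x \<partial>N\<bar> \<le> C"
proof -
  show i: "integrable N f"
    using assms(1) le_less_trans[OF assms(2) ennreal_less_top] by (intro integrableI_bounded) auto
  have "ennreal (\<integral>x. \<bar>f x\<bar> \<partial>N) = (\<integral>\<^sup>+x. ennreal \<bar>f x\<bar> \<partial>N)"
    using i by (intro nn_integral_eq_integral[symmetric]) auto
  then have "ennreal (\<integral>x. \<bar>f x\<bar> \<partial>N) \<le> ennreal C" using assms by simp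
  then show "(\<integral>x. \<bar>f x\<bar> \<partial>N) \<le> C" using assms(3) by (simp add: ennreal_le_iff)
  then show "\<bar>\<integral>x. f x \<partial>N\<bar> \<le> C"
    using integral_abs_bound[of N f] by linarith
qed

text \<open>Trades powers of the truncation level for a moment of order \<open>mid_exp\<close>: with
  m = min N x, the factor x^(1 - \<open>mid_exp\<close>) is at most m^(1 - \<open>mid_exp\<close>),
  as the exponent is nonpositive.\<close>

lemma min_power_le:
  fixes x mid_exp :: real and N :: real and r :: nat
  assumes "1 \<le> x" "1 \<le> N" "1 \<le> mid_exp" "mid_exp \<le> r + 1"
  shows "(min N x) ^ r * x \<le> N powr (r + 1 - mid_exp) * x powr mid_exp"
proof -
  define m where "m = min N x"
  have m: "1 \<le> m" "m \<le> x" "m \<le> N" using assms by (auto simp: m_def)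
  have "m ^ r * x = m powr r * (x powr (1 - mid_exp) * x powr mid_exp)"
    using assms m by (simp add: powr_realpow flip: powr_add)
  also have "\<dots> \<le> m powr r * (m powr (1 - mid_exp) * x powr mid_exp)"
    using assms m by (intro mult_left_mono mult_right_mono powr_mono2') auto
  also have "\<dots> = m powr (r + 1 - mid_exp) * x powr mid_exp"
    using m by (simp add: algebra_simps flip: powr_add mult.assoc)
  also have "\<dots> \<le> N powr (r + 1 - mid_exp) * x powr mid_exp"
    using assms m by (intro mult_right_mono powr_mono2) auto
  finally show ?thesis by (simp add: m_def)
qed

locale covered_source = infinite_source_poisson P t \<eta> U \<nu> \<alpha> 4 L + coverage M \<psi> \<phi> I Imax
  for P :: "'a measure" and t \<eta> U :: "int \<Rightarrow> 'a \<Rightarrow> real" and \<nu> \<alpha> L M \<psi> \<phi> I Imax +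
  assumes \<alpha>_gt_1: "1 < \<alpha>" and L4_bounded: "bounded (L 4 ` {0<..})"
begin

text \<open>Sources are taken from the whole time line, although the process starts at 0.
  Translation invariance then makes the mean vanish and, in continuous time, expresses the second
  moment exactly through \<open>scale_fun\<close>; the observed part \<open>present\<close> is
  compared with it.\<close>

definition shot :: "nat \<Rightarrow> int \<Rightarrow> real \<times> real \<times> real \<Rightarrow> real" where
  "shot j k z = snd (snd z) * kernel j k (fst z) (fst (snd z))"

definition present :: "nat \<Rightarrow> int \<Rightarrow> real \<times> real \<times> real \<Rightarrow> real" where
  "present j k z = indicator {0..} (fst z) * shot j k z"

definition past :: "nat \<Rightarrow> int \<Rightarrow> real \<times> real \<times> real \<Rightarrow> real" where
  "past j k z = indicator {..<0} (fst z) * shot j k z"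

lemma measurable_shot [measurable]: "shot j k \<in> borel_measurable intensity"
  unfolding shot_def by measurable

lemma measurable_present [measurable]: "present j k \<in> borel_measurable intensity"
  unfolding present_def by measurable

lemma measurable_past [measurable]: "past j k \<in> borel_measurable intensity"
  unfolding past_def by measurable

lemma shot_split: "shot j k z = present j k z + past j k z"
  by (simp add: present_def past_def indicator_def)

lemma nn_integral_intensity:
  assumes "f \<in> borel_measurable intensity"
  shows "integral\<^sup>N intensity f = (\<integral>\<^sup>+x. (\<integral>\<^sup>+s. f (s, x) \<partial>lborel) \<partial>\<nu>)"
  using intensity.nn_integral_snd[of f] assms unfolding intensity_def by simp

text \<open>Choice fixes one constant for all scales, shifts and sources that later statements can
  name; \<open>mark_mom\<close> is fixed in the same way.\<close>

definition kernel_const :: real where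
  "kernel_const = (SOME C. 0 < C \<and> (\<forall>j k x v. 0 < v \<longrightarrow> \<bar>kernel j k x v\<bar> \<le> C * 2 powr (- real j / 2) * min (2 ^ j) (1 + v)))"

lemma kernel_const: "0 < kernel_const" "0 < v \<Longrightarrow> \<bar>kernel j k x v\<bar> \<le> kernel_const * 2 powr (- real j / 2) * min (2 ^ j) (1 + v)"
proof -
  have "\<exists>C. 0 < C \<and> (\<forall>j k x v. 0 < v \<longrightarrow> \<bar>kernel j k x v\<bar> \<le> C * 2 powr (- real j / 2) * min (2 ^ j) (1 + v))"
    using kernel_bound by metis
  from someI_ex[OF this, folded kernel_const_def]
  show "0 < kernel_const" "0 < v \<Longrightarrow> \<bar>kernel j k x v\<bar> \<le> kernel_const * 2 powr (- real j / 2) * min (2 ^ j) (1 + v)" by blast+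
qed

text \<open>For a fixed mark, the birth times that count have length at most 6 M 2^j. The exponent j
  - r j / 2 collects this length and the r-th power of the normalisation 2^(-j/2).\<close>

lemma kernel_moment_bound:
  assumes r: "1 \<le> r"
  shows "(\<integral>\<^sup>+z. ennreal (\<bar>snd (snd z)\<bar> ^ p * \<bar>kernel j k (fst z) (fst (snd z))\<bar> ^ r) \<partial>intensity)
    \<le> ennreal (6 * M * kernel_const ^ r * 2 powr (j - real r * real j / 2)) * (\<integral>\<^sup>+(v, w). ennreal (\<bar>w\<bar> ^ p * (min (2 ^ j) (1 + v)) ^ r) \<partial>\<nu>)"
proof -
  have "(\<integral>\<^sup>+z. ennreal (\<bar>snd (snd z)\<bar> ^ p * \<bar>kernel j k (fst z) (fst (snd z))\<bar> ^ r) \<partial>intensity)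
    = (\<integral>\<^sup>+x. (\<integral>\<^sup>+s. ennreal (\<bar>snd x\<bar> ^ p * \<bar>kernel j k s (fst x)\<bar> ^ r) \<partial>lborel) \<partial>\<nu>)"
    by (subst nn_integral_intensity) (simp_all, measurable)
  also have "\<dots> \<le> (\<integral>\<^sup>+x. ennreal (6 * M * kernel_const ^ r * 2 powr (j - real r * real j / 2)) * ennreal (\<bar>snd x\<bar> ^ p * (min (2 ^ j) (1 + fst x)) ^ r) \<partial>\<nu>)"
  proof (rule nn_integral_mono_AE)
    show "AE x in \<nu>. (\<integral>\<^sup>+s. ennreal (\<bar>snd x\<bar> ^ p * \<bar>kernel j k s (fst x)\<bar> ^ r) \<partial>lborel)
      \<le> ennreal (6 * M * kernel_const ^ r * 2 powr (j - real r * real j / 2)) * ennreal (\<bar>snd x\<bar> ^ p * (min (2 ^ j) (1 + fst x)) ^ r)"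
      using \<nu>_pos
    proof eventually_elim
      case (elim x)
      obtain v w where x: "x = (v, w)" by fastforce
      with elim have v: "0 < v" by simp
      let ?X = "\<bar>w\<bar> ^ p * (kernel_const * 2 powr (- real j / 2) * min (2 ^ j) (1 + v)) ^ r"
      have X0: "0 \<le> ?X" using kernel_const(1) v by simp
      let ?S = "{s. s \<in> reach j k \<or> s + v \<in> reach j k}"
      have S: "?S \<in> sets borel" unfolding reach_def by measurable
      have "(\<integral>\<^sup>+s. ennreal (\<bar>w\<bar> ^ p * \<bar>kernel j k s v\<bar> ^ r) \<partial>lborel) \<le> (\<integral>\<^sup>+s. ennreal ?X * indicator ?S s \<partial>lborel)"
      proof (rule nn_integral_mono)
        fix s
        show "ennreal (\<bar>w\<bar> ^ p * \<bar>kernel j k s v\<bar> ^ r) \<le> ennreal ?X * indicator ?S s"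
        proof (cases "s \<in> ?S")
          case True
          then show ?thesis using kernel_const(2)[OF v, of j k s] by (auto intro!: ennreal_leI mult_left_mono power_mono)
        next
          case False
          then have "kernel j k s v = 0" using kernel_support by blast
          then show ?thesis using r by (simp add: power_0_left)
        qed
      qed
      also have "\<dots> = ennreal ?X * emeasure lborel ?S"
        using S by (intro nn_integral_cmult_indicator) simp
      also have "\<dots> \<le> ennreal ?X * ennreal (6 * M * 2 ^ j)"
        by (intro mult_left_mono measure_kernel_support) simp
      also have "\<dots> = ennreal (?X * (6 * M * 2 ^ j))"
        using M_ge_1 X0 by (simp add: ennreal_mult)
      also have "?X * (6 * M * 2 ^ j) = (6 * M * kernel_const ^ r * 2 powr (j - real r * real j / 2)) * (\<bar>w\<bar> ^ p * (min (2 ^ j) (1 + v)) ^ r)"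
      proof -
        have "(2 powr (- real j / 2)) ^ r * 2 ^ j = 2 powr (j - real r * real j / 2)"
          by (simp add: powr_powr mult.commute flip: powr_realpow powr_add)
        then show ?thesis by (simp add: power_mult_distrib)
      qed
      finally show ?case using x v M_ge_1 kernel_const(1) by (simp add: ennreal_mult)
    qed
  qed
  also have "\<dots> = ennreal (6 * M * kernel_const ^ r * 2 powr (j - real r * real j / 2)) * (\<integral>\<^sup>+(v, w). ennreal (\<bar>w\<bar> ^ p * (min (2 ^ j) (1 + v)) ^ r) \<partial>\<nu>)"
    by (simp add: case_prod_unfold nn_integral_cmult)
  finally show ?thesis .
qed

text \<open>Since \<alpha> > 1 this lies below \<alpha>, so the moment of this order is finite. From
  (1 + \<alpha>) / 2 on, the terms caused by the missing past stay below the fluctuation term of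
  \<open>level_sum_deviation\<close> at every scale j \<le> J.\<close>

definition mid_exp :: real where "mid_exp = (1 + \<alpha>) / 2"

lemma mid_exp: "1 < mid_exp" "mid_exp < \<alpha>" "mid_exp < 2"
  using \<alpha>_gt_1 \<alpha>_range by (auto simp: mid_exp_def)

definition mark_mom :: "nat \<Rightarrow> real" where
  "mark_mom p = (SOME C. 0 \<le> C \<and> (\<integral>\<^sup>+(v, w). ennreal (\<bar>w\<bar> ^ p * (1 + v) powr mid_exp) \<partial>\<nu>) \<le> ennreal C)"

lemma mark_mom:
  assumes "p \<le> 4"
  shows "0 \<le> mark_mom p" "(\<integral>\<^sup>+(v, w). ennreal (\<bar>w\<bar> ^ p * (1 + v) powr mid_exp) \<partial>\<nu>) \<le> ennreal (mark_mom p)"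
proof -
  have "\<exists>C. 0 \<le> C \<and> (\<integral>\<^sup>+(v, w). ennreal (\<bar>w\<bar> ^ p * (1 + v) powr mid_exp) \<partial>\<nu>) \<le> ennreal C"
  proof -
    have "0 \<le> mid_exp" using mid_exp by simp
    obtain C where "0 \<le> C" "(\<integral>\<^sup>+(v, w). ennreal (\<bar>w\<bar> ^ p * (1 + v) powr mid_exp) \<partial>\<nu>) \<le> ennreal C"
      by (rule mark_moment_finite[OF assms \<open>0 \<le> mid_exp\<close> mid_exp(2)])
    then show ?thesis by blast
  qed
  from someI_ex[OF this, folded mark_mom_def]
  show "0 \<le> mark_mom p" "(\<integral>\<^sup>+(v, w). ennreal (\<bar>w\<bar> ^ p * (1 + v) powr mid_exp) \<partial>\<nu>) \<le> ennreal (mark_mom p)" by blast+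
qed

lemma first_moment_bound:
  assumes "p \<le> 4"
  shows "(\<integral>\<^sup>+(v, w). ennreal (\<bar>w\<bar> ^ p * (min (2 ^ j) (1 + v)) ^ 1) \<partial>\<nu>) \<le> ennreal (mark_mom p)"
proof -
  have "(\<integral>\<^sup>+(v, w). ennreal (\<bar>w\<bar> ^ p * (min (2 ^ j) (1 + v)) ^ 1) \<partial>\<nu>) \<le> (\<integral>\<^sup>+(v, w). ennreal (\<bar>w\<bar> ^ p * (1 + v) powr mid_exp) \<partial>\<nu>)"
  proof (rule nn_integral_mono_AE)
    show "AE x in \<nu>. (case x of (v, w) \<Rightarrow> ennreal (\<bar>w\<bar> ^ p * (min (2 ^ j) (1 + v)) ^ 1)) \<le> (case x of (v, w) \<Rightarrow> ennreal (\<bar>w\<bar> ^ p * (1 + v) powr mid_exp))"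
      using \<nu>_pos
    proof eventually_elim
      case (elim x)
      obtain v w where x: "x = (v, w)" by fastforce
      with elim have v: "0 < v" by simp
      have "min (2 ^ j) (1 + v) \<le> (1 + v) powr 1" using v by simp
      also have "\<dots> \<le> (1 + v) powr mid_exp" using v mid_exp by (intro powr_mono) auto
      finally show ?case using x by (auto intro!: ennreal_leI mult_left_mono)
    qed
  qed
  also have "\<dots> \<le> ennreal (mark_mom p)" using mark_mom[OF assms] by simp
  finally show ?thesis .
qed

text \<open>The factor U of the shot raises the weight to the power p. The case p = 1 bounds means;
  p = 2 bounds the sums of covariances and the discretisation error.\<close>

lemma shot_first_moment:
  assumes "1 \<le> p" "p \<le> 4"
  shows "(\<integral>\<^sup>+z. ennreal (\<bar>snd (snd z)\<bar> ^ (p - 1) * \<bar>shot j k z\<bar>) \<partial>intensity) \<le> ennreal (6 * M * kernel_const * mark_mom p * 2 powr (j / 2))"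
proof -
  have "\<bar>snd (snd z)\<bar> ^ (p - 1) * \<bar>shot j k z\<bar> = \<bar>snd (snd z)\<bar> ^ p * \<bar>kernel j k (fst z) (fst (snd z))\<bar> ^ 1" for z
  proof -
    have "\<bar>snd (snd z)\<bar> ^ p = \<bar>snd (snd z)\<bar> ^ (p - 1) * \<bar>snd (snd z)\<bar>"
      using assms(1) power_minus_mult[of p "\<bar>snd (snd z)\<bar>"] by linarith
    then show ?thesis by (simp only: shot_def abs_mult power_one_right mult.assoc)
  qed
  then have "(\<integral>\<^sup>+z. ennreal (\<bar>snd (snd z)\<bar> ^ (p - 1) * \<bar>shot j k z\<bar>) \<partial>intensity)
    \<le> ennreal (6 * M * kernel_const ^ 1 * 2 powr (j - real 1 * real j / 2)) * (\<integral>\<^sup>+(v, w). ennreal (\<bar>w\<bar> ^ p * (min (2 ^ j) (1 + v)) ^ 1) \<partial>\<nu>)"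
    using kernel_moment_bound[of 1 p j k] by simp
  also have "\<dots> \<le> ennreal (6 * M * kernel_const ^ 1 * 2 powr (j - real 1 * real j / 2)) * ennreal (mark_mom p)"
    by (intro mult_left_mono first_moment_bound assms) simp
  also have "\<dots> = ennreal (6 * M * kernel_const * mark_mom p * 2 powr (j / 2))"
    using M_ge_1 kernel_const(1) mark_mom[OF assms(2)] by (simp add: mult_ac flip: ennreal_mult)
  finally show ?thesis .
qed

text \<open>The exponent adds up the length 2^j of birth times, the normalisation 2^(-2 j) and the
  truncated fourth moment 2^((4 - \<alpha>) j).\<close>

lemma shot_fourth_moment:
  obtains C where "0 \<le> C" "\<And>j k. (\<integral>\<^sup>+z. ennreal (shot j k z ^ 4) \<partial>intensity) \<le> ennreal (C * 2 powr ((3 - \<alpha>) * j))"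
proof -
  obtain C0 where C0: "0 \<le> C0" "\<And>j::nat. (\<integral>\<^sup>+(v, w). ennreal (\<bar>w\<bar> ^ 4 * (min (2 ^ j) (1 + v)) ^ 4) \<partial>\<nu>) \<le> ennreal (C0 * 2 powr ((4 - \<alpha>) * j))"
    using truncated_moment_bound[of 4, OF _ L4_bounded] by auto
  have "(\<integral>\<^sup>+z. ennreal (shot j k z ^ 4) \<partial>intensity) \<le> ennreal (6 * M * kernel_const ^ 4 * C0 * 2 powr ((3 - \<alpha>) * j))" for j k
  proof -
    have "shot j k z ^ 4 = \<bar>snd (snd z)\<bar> ^ 4 * \<bar>kernel j k (fst z) (fst (snd z))\<bar> ^ 4" for z
      by (simp add: shot_def power_mult_distrib)
    then have "(\<integral>\<^sup>+z. ennreal (shot j k z ^ 4) \<partial>intensity)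
      \<le> ennreal (6 * M * kernel_const ^ 4 * 2 powr (j - real 4 * real j / 2)) * (\<integral>\<^sup>+(v, w). ennreal (\<bar>w\<bar> ^ 4 * (min (2 ^ j) (1 + v)) ^ 4) \<partial>\<nu>)"
      using kernel_moment_bound[of 4 4 j k] by simp
    also have "\<dots> \<le> ennreal (6 * M * kernel_const ^ 4 * 2 powr (j - real 4 * real j / 2)) * ennreal (C0 * 2 powr ((4 - \<alpha>) * j))"
      by (intro mult_left_mono C0) simp
    also have "\<dots> = ennreal (6 * M * kernel_const ^ 4 * 2 powr (j - real 4 * real j / 2) * (C0 * 2 powr ((4 - \<alpha>) * j)))"
      using M_ge_1 kernel_const(1) C0 by (intro ennreal_mult[symmetric]) auto
    also have "6 * M * kernel_const ^ 4 * 2 powr (j - real 4 * real j / 2) * (C0 * 2 powr ((4 - \<alpha>) * j)) = 6 * M * kernel_const ^ 4 * C0 * (2 powr (j - real 4 * real j / 2) * 2 powr ((4 - \<alpha>) * j))"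
      by simp
    also have "2 powr (j - real 4 * real j / 2) * 2 powr ((4 - \<alpha>) * j) = 2 powr ((3 - \<alpha>) * j)"
      by (simp add: algebra_simps flip: powr_add)
    finally show ?thesis .
  qed
  moreover have "0 \<le> 6 * M * kernel_const ^ 4 * C0" using M_ge_1 kernel_const(1) C0 by simp
  ultimately show thesis using that by blast
qed

text \<open>At a fixed mark \<open>(v, w)\<close> a bounded number of \<open>k\<close> contribute, and a source born before time 0
  contributes only if it was born in \<open>(-v, 0)\<close>.\<close>

lemma past_moment_bound:
  assumes K: "finite K" "\<And>k. k \<in> K \<Longrightarrow> 0 \<le> k" and r: "1 \<le> r" "r \<le> 4"
  shows "(\<Sum>k\<in>K. \<integral>\<^sup>+z. ennreal (\<bar>past j k z\<bar> ^ r) \<partial>intensity)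
    \<le> ennreal ((6 * M + 2) * kernel_const ^ r * mark_mom r * 2 powr (real r * real j / 2 + j - mid_exp * j))"
proof -
  have r0: "r \<noteq> 0" using r by simp
  have "(\<Sum>k\<in>K. \<integral>\<^sup>+z. ennreal (\<bar>past j k z\<bar> ^ r) \<partial>intensity) = (\<integral>\<^sup>+z. (\<Sum>k\<in>K. ennreal (\<bar>past j k z\<bar> ^ r)) \<partial>intensity)"
    by (intro nn_integral_sum[symmetric]) measurable
  also have "\<dots> = (\<integral>\<^sup>+x. (\<integral>\<^sup>+s. (\<Sum>k\<in>K. ennreal (\<bar>past j k (s, x)\<bar> ^ r)) \<partial>lborel) \<partial>\<nu>)"
    by (intro nn_integral_intensity) measurable
  also have "\<dots> \<le> (\<integral>\<^sup>+x. ennreal ((6 * M + 2) * kernel_const ^ r * 2 powr (real r * real j / 2 + j - mid_exp * j)) * ennreal (\<bar>snd x\<bar> ^ r * (1 + fst x) powr mid_exp) \<partial>\<nu>)"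
  proof (rule nn_integral_mono_AE)
    show "AE x in \<nu>. (\<integral>\<^sup>+s. (\<Sum>k\<in>K. ennreal (\<bar>past j k (s, x)\<bar> ^ r)) \<partial>lborel)
      \<le> ennreal ((6 * M + 2) * kernel_const ^ r * 2 powr (real r * real j / 2 + j - mid_exp * j)) * ennreal (\<bar>snd x\<bar> ^ r * (1 + fst x) powr mid_exp)"
      using \<nu>_pos
    proof eventually_elim
      case (elim x)
      obtain v w where x: "x = (v, w)" by fastforce
      with elim have v: "0 < v" by simp
      let ?X = "\<bar>w\<bar> ^ r * (kernel_const * 2 powr (- real j / 2) * min (2 ^ j) (1 + v)) ^ r"
      have X0: "0 \<le> ?X" using kernel_const(1) v by simp
      have ptw: "(\<Sum>k\<in>K. \<bar>past j k (s, x)\<bar> ^ r) \<le> (6 * M + 2) * ?X * indicator {-v..0} s" for s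
      proof (cases "s < 0 \<and> 0 < s + v")
        case True
        have "(\<Sum>k\<in>K. \<bar>past j k (s, x)\<bar> ^ r) = (\<Sum>k\<in>{k\<in>K. kernel j k s v \<noteq> 0}. \<bar>past j k (s, x)\<bar> ^ r)"
          using K r0 by (intro sum.mono_neutral_right) (auto simp: past_def shot_def x)
        also have "\<dots> \<le> (\<Sum>k\<in>{k\<in>K. kernel j k s v \<noteq> 0}. ?X)"
        proof (rule sum_mono)
          fix k
          have "\<bar>past j k (s, x)\<bar> \<le> \<bar>w\<bar> * (kernel_const * 2 powr (- real j / 2) * min (2 ^ j) (1 + v))"
            using kernel_const(2)[OF v, of j k s] by (simp add: past_def shot_def x indicator_def abs_mult mult_left_mono kernel_const(1) less_imp_le v)
          then show "\<bar>past j k (s, x)\<bar> ^ r \<le> ?X"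
            unfolding power_mult_distrib[symmetric] by (intro power_mono) auto
        qed
        also have "\<dots> \<le> (6 * M + 2) * ?X"
          using X0 kernel_overlap[of K j s v] by (simp add: mult_right_mono)
        finally show ?thesis using True by simp
      next
        case False
        then have "past j k (s, x) = 0" if "k \<in> K" for k
          using kernel_past[OF K(2)[OF that], of s v j] by (auto simp: past_def shot_def x indicator_def)
        then show ?thesis using X0 r0 M_ge_1 by (simp add: power_0_left)
      qed
      have "(\<integral>\<^sup>+s. (\<Sum>k\<in>K. ennreal (\<bar>past j k (s, x)\<bar> ^ r)) \<partial>lborel) \<le> (\<integral>\<^sup>+s. ennreal ((6 * M + 2) * ?X) * indicator {-v..0} s \<partial>lborel)"
      proof (rule nn_integral_mono)
        fix s
        have "(\<Sum>k\<in>K. ennreal (\<bar>past j k (s, x)\<bar> ^ r)) = ennreal (\<Sum>k\<in>K. \<bar>past j k (s, x)\<bar> ^ r)" by simp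
        also have "\<dots> \<le> ennreal ((6 * M + 2) * ?X * indicator {-v..0} s)" by (intro ennreal_leI ptw)
        also have "\<dots> = ennreal ((6 * M + 2) * ?X) * indicator {-v..0} s" by (simp add: indicator_def)
        finally show "(\<Sum>k\<in>K. ennreal (\<bar>past j k (s, x)\<bar> ^ r)) \<le> ennreal ((6 * M + 2) * ?X) * indicator {-v..0} s" .
      qed
      also have "\<dots> = ennreal ((6 * M + 2) * ?X) * ennreal v"
        using v by (subst nn_integral_cmult_indicator) auto
      also have "\<dots> = ennreal ((6 * M + 2) * ?X * v)"
        using X0 M_ge_1 v by (intro ennreal_mult[symmetric]) auto
      also have "\<dots> \<le> ennreal ((6 * M + 2) * kernel_const ^ r * 2 powr (real r * real j / 2 + j - mid_exp * j) * (\<bar>w\<bar> ^ r * (1 + v) powr mid_exp))"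
      proof (rule ennreal_leI)
        have pw: "(2 powr (- real j / 2)) ^ r = 2 powr (- (real r * real j) / 2)"
          by (simp add: powr_powr mult.commute flip: powr_realpow)
        \<comment> \<open>The length v of the birth interval contributes one more power, and
          \<open>min_power_le\<close> exchanges the product for the finite moment of order
          \<open>mid_exp\<close>.\<close>
        have "(min (2 ^ j) (1 + v)) ^ r * v \<le> (min (2 ^ j) (1 + v)) ^ r * (1 + v)"
          using v by (intro mult_left_mono) auto
        also have "\<dots> \<le> (2 ^ j) powr (r + 1 - mid_exp) * (1 + v) powr mid_exp"
          using v mid_exp r by (intro min_power_le) (auto simp: one_le_power)
        also have "(2 ^ j) powr (r + 1 - mid_exp) = 2 powr (j * (r + 1 - mid_exp))"
          by (simp add: powr_powr flip: powr_realpow)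
        finally have mv: "(min (2 ^ j) (1 + v)) ^ r * v \<le> 2 powr (j * (r + 1 - mid_exp)) * (1 + v) powr mid_exp" .
        have "(6 * M + 2) * ?X * v = (6 * M + 2) * kernel_const ^ r * \<bar>w\<bar> ^ r * 2 powr (- (real r * real j) / 2) * ((min (2 ^ j) (1 + v)) ^ r * v)"
          unfolding power_mult_distrib pw by simp
        also have "\<dots> \<le> (6 * M + 2) * kernel_const ^ r * \<bar>w\<bar> ^ r * 2 powr (- (real r * real j) / 2) * (2 powr (j * (r + 1 - mid_exp)) * (1 + v) powr mid_exp)"
          using M_ge_1 kernel_const(1) by (intro mult_left_mono mv) auto
        also have "\<dots> = (6 * M + 2) * kernel_const ^ r * (2 powr (- (real r * real j) / 2) * 2 powr (j * (r + 1 - mid_exp))) * (\<bar>w\<bar> ^ r * (1 + v) powr mid_exp)"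
          by simp
        also have "2 powr (- (real r * real j) / 2) * 2 powr (j * (r + 1 - mid_exp)) = 2 powr (real r * real j / 2 + j - mid_exp * j)"
          by (simp add: algebra_simps flip: powr_add)
        finally show "(6 * M + 2) * ?X * v \<le> (6 * M + 2) * kernel_const ^ r * 2 powr (real r * real j / 2 + j - mid_exp * j) * (\<bar>w\<bar> ^ r * (1 + v) powr mid_exp)" .
      qed
      also have "\<dots> = ennreal ((6 * M + 2) * kernel_const ^ r * 2 powr (real r * real j / 2 + j - mid_exp * j)) * ennreal (\<bar>w\<bar> ^ r * (1 + v) powr mid_exp)"
        using M_ge_1 kernel_const(1) by (intro ennreal_mult) auto
      finally show ?case by (simp add: x)
    qed
  qed
  also have "\<dots> = ennreal ((6 * M + 2) * kernel_const ^ r * 2 powr (real r * real j / 2 + j - mid_exp * j)) * (\<integral>\<^sup>+(v, w). ennreal (\<bar>w\<bar> ^ r * (1 + v) powr mid_exp) \<partial>\<nu>)"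
    by (simp add: case_prod_unfold nn_integral_cmult)
  also have "\<dots> \<le> ennreal ((6 * M + 2) * kernel_const ^ r * 2 powr (real r * real j / 2 + j - mid_exp * j)) * ennreal (mark_mom r)"
    using mark_mom(2)[OF r(2)] by (intro mult_left_mono) auto
  also have "\<dots> = ennreal ((6 * M + 2) * kernel_const ^ r * mark_mom r * 2 powr (real r * real j / 2 + j - mid_exp * j))"
    using M_ge_1 kernel_const(1) mark_mom[OF r(2)] by (simp add: mult_ac flip: ennreal_mult)
  finally show ?thesis .
qed

section \<open>Level sums: bias and fluctuation\<close>

definition shifts :: "nat \<Rightarrow> nat \<Rightarrow> int set" where
  "shifts J j = {0..2 ^ (J - j) - 1}"

lemma finite_shifts [simp]: "finite (shifts J j)"
  by (simp add: shifts_def)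

lemma card_shifts: "real (card (shifts J j)) = 2 ^ (J - j)"
  by (simp add: shifts_def nat_power_eq)

definition level_sum :: "nat \<Rightarrow> nat \<Rightarrow> 'a \<Rightarrow> real" where
  "level_sum J j \<omega> = (\<Sum>k\<in>shifts J j. (point_sum [present j k] \<omega>)\<^sup>2)"

text \<open>A common upper bound for the birth times that influence any shift at scale j, so that
  one finite window of sources serves all of them.\<close>

definition reach_end :: "nat \<Rightarrow> nat \<Rightarrow> real" where
  "reach_end J j = (2 ^ (J - j) + M) * 2 ^ j + M"

lemma shot_support:
  assumes "k \<in> shifts J j" "shot j k z \<noteq> 0"
  shows "fst z \<le> reach_end J j"
proof -
  have nz: "kernel j k (fst z) (fst (snd z)) \<noteq> 0" using assms by (simp add: shot_def)
  then have v: "0 < fst (snd z)" using kernel_empty[of "fst (snd z)"] by force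
  have "k \<le> 2 ^ (J - j)" using assms by (simp add: shifts_def)
  then have "real_of_int k \<le> 2 ^ (J - j)"
    by (metis of_int_le_iff of_int_numeral of_int_power)
  then have "(real_of_int k + M) * 2 ^ j \<le> (2 ^ (J - j) + M) * 2 ^ j" by (intro mult_right_mono) auto
  then show ?thesis
    using kernel_support[OF nz] v unfolding reach_def reach_end_def atLeastAtMost_iff by linarith
qed

lemma present_support:
  assumes "k \<in> shifts J j" "present j k z \<noteq> 0"
  shows "fst z \<in> {0..reach_end J j}"
  using assms shot_support[OF assms(1), of z] by (auto simp: present_def indicator_def split: if_splits)

lemma abs_present_le: "\<bar>present j k z\<bar> \<le> \<bar>shot j k z\<bar>"
  by (simp add: present_def indicator_def)

lemma abs_past_le: "\<bar>past j k z\<bar> \<le> \<bar>shot j k z\<bar>"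
  by (simp add: past_def indicator_def)

lemma shot_integrable: "integrable intensity (shot j k)"
  and shot_abs_integral: "(\<integral>z. \<bar>shot j k z\<bar> \<partial>intensity) \<le> 6 * M * kernel_const * mark_mom 1 * 2 powr (j / 2)"
proof -
  have C: "0 \<le> 6 * M * kernel_const * mark_mom 1 * 2 powr (j / 2)" using M_ge_1 kernel_const(1) mark_mom[of 1] by simp
  have "(\<integral>\<^sup>+z. ennreal \<bar>shot j k z\<bar> \<partial>intensity) \<le> ennreal (6 * M * kernel_const * mark_mom 1 * 2 powr (j / 2))"
    using shot_first_moment[of 1 j k] by simp
  from integrable_if_nn_integral_le[OF _ this C]
  show "integrable intensity (shot j k)" "(\<integral>z. \<bar>shot j k z\<bar> \<partial>intensity) \<le> 6 * M * kernel_const * mark_mom 1 * 2 powr (j / 2)" by auto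
qed

lemma weighted_shot_integrable: "integrable intensity (\<lambda>z. \<bar>snd (snd z)\<bar> * \<bar>shot j k z\<bar>)"
  and weighted_shot_integral: "(\<integral>z. \<bar>snd (snd z)\<bar> * \<bar>shot j k z\<bar> \<partial>intensity) \<le> 6 * M * kernel_const * mark_mom 2 * 2 powr (j / 2)"
proof -
  have C: "0 \<le> 6 * M * kernel_const * mark_mom 2 * 2 powr (j / 2)" using M_ge_1 kernel_const(1) mark_mom[of 2] by simp
  have meas: "(\<lambda>z. \<bar>snd (snd z)\<bar> * \<bar>shot j k z\<bar>) \<in> borel_measurable intensity" by measurable
  have "(\<integral>\<^sup>+z. ennreal \<bar>\<bar>snd (snd z)\<bar> * \<bar>shot j k z\<bar>\<bar> \<partial>intensity) \<le> ennreal (6 * M * kernel_const * mark_mom 2 * 2 powr (j / 2))"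
    using shot_first_moment[of 2 j k] by simp
  from integrable_if_nn_integral_le[OF meas this C]
  show "integrable intensity (\<lambda>z. \<bar>snd (snd z)\<bar> * \<bar>shot j k z\<bar>)"
    "(\<integral>z. \<bar>snd (snd z)\<bar> * \<bar>shot j k z\<bar> \<partial>intensity) \<le> 6 * M * kernel_const * mark_mom 2 * 2 powr (j / 2)" by auto
qed

lemma shot_power4_integrable: "integrable intensity (\<lambda>z. shot j k z ^ 4)"
proof -
  obtain C where C: "0 \<le> C" "\<And>j k. (\<integral>\<^sup>+z. ennreal (shot j k z ^ 4) \<partial>intensity) \<le> ennreal (C * 2 powr ((3 - \<alpha>) * j))"
    using shot_fourth_moment by blast
  have le: "(\<integral>\<^sup>+z. ennreal \<bar>shot j k z ^ 4\<bar> \<partial>intensity) \<le> ennreal (C * 2 powr ((3 - \<alpha>) * j))"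
    using C(2)[of j k] by simp
  show ?thesis by (rule integrable_if_nn_integral_le(1)[OF _ le]) (use C(1) in auto)
qed

lemma shot_square_integrable: "integrable intensity (\<lambda>z. (shot j k z)\<^sup>2)"
  using integrable_moments2[OF _ _ shot_integrable shot_integrable shot_power4_integrable shot_power4_integrable, of j k j k 2 0]
  by simp

lemma present_integrable: "integrable intensity (present j k)"
  using shot_integrable[of j k] by (rule Bochner_Integration.integrable_bound) (auto simp: abs_present_le)

lemma past_integrable: "integrable intensity (past j k)"
  using shot_integrable[of j k] by (rule Bochner_Integration.integrable_bound) (auto simp: abs_past_le)

lemma present_power4_integrable: "integrable intensity (\<lambda>z. present j k z ^ 4)"
  using shot_power4_integrable[of j k]
  by (rule Bochner_Integration.integrable_bound) (auto simp: present_def indicator_def)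

lemma present_square_integrable: "integrable intensity (\<lambda>z. (present j k z)\<^sup>2)"
  and past_square_integrable: "integrable intensity (\<lambda>z. (past j k z)\<^sup>2)"
  using shot_square_integrable[of j k] abs_present_le abs_past_le
  by (auto intro!: Bochner_Integration.integrable_bound[OF shot_square_integrable[of j k]] simp: abs_le_square_iff)

lemma shot_mean_zero: "integral\<^sup>L intensity (shot j k) = 0"
proof -
  have int: "integrable (lborel \<Otimes>\<^sub>M \<nu>) (\<lambda>(s, x). shot j k (s, x))"
    using shot_integrable[of j k] by (simp add: intensity_def)
  have "integral\<^sup>L intensity (shot j k) = (\<integral>x. (\<integral>s. shot j k (s, x) \<partial>lborel) \<partial>\<nu>)"
    using intensity.integral_snd[OF int] by (simp add: intensity_def)
  also have "\<dots> = 0"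
  proof (rule integral_eq_zero_AE)
    show "AE x in \<nu>. (\<integral>s. shot j k (s, x) \<partial>lborel) = 0"
      using \<nu>_pos by eventually_elim (auto simp: shot_def kernel_integral)
  qed
  finally show ?thesis .
qed

text \<open>The mean is the whole-line second moment corrected by the past. Both past terms turn out
  to be no larger than the fluctuation, so the bound shows only the bias and the standard deviation,
  each relative to the number of shifts.\<close>

lemma level_sum_deviation:
  assumes second_moment: "\<And>j k. 0 \<le> k \<Longrightarrow> \<bar>(\<integral>z. (shot j k z)\<^sup>2 \<partial>intensity) - c * 2 powr ((2 - \<alpha>) * j)\<bar> \<le> Cv * 2 powr ((2 - \<alpha> - \<gamma>) * j)"
    and c: "0 < c" and \<gamma>: "0 < \<gamma>"
  obtains C where "0 \<le> C" "\<And>J j. integrable P (level_sum J j)"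
    "\<And>J j. j \<le> J \<Longrightarrow> expectation (\<lambda>\<omega>. \<bar>level_sum J j \<omega> * 2 powr (- (2 - \<alpha>) * j) - c * 2 ^ (J - j)\<bar>)
       \<le> C * 2 ^ (J - j) * (2 powr (- \<gamma> * j) + 2 powr ((\<alpha> * j - J) / 2))"
proof -
  obtain C4 where C4: "0 \<le> C4" "\<And>j k. (\<integral>\<^sup>+z. ennreal (shot j k z ^ 4) \<partial>intensity) \<le> ennreal (C4 * 2 powr ((3 - \<alpha>) * j))"
    using shot_fourth_moment by blast
  define c0 where "c0 = 6 * M + 2"
  define c1 where "c1 = 6 * M * kernel_const * mark_mom 1"
  define c2 where "c2 = 6 * M * kernel_const * mark_mom 2"
  define p1 where "p1 = c0 * kernel_const * mark_mom 1"
  define p2 where "p2 = c0 * kernel_const\<^sup>2 * mark_mom 2"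
  have c0: "0 \<le> c0" using M_ge_1 by (simp add: c0_def)
  have cc: "0 \<le> c1" "0 \<le> c2" "0 \<le> p1" "0 \<le> p2"
    using M_ge_1 kernel_const(1) mark_mom[of 1] mark_mom[of 2] c0 by (auto simp: c1_def c2_def p1_def p2_def)
  have Cv_nonneg: "0 \<le> Cv" using order_trans[OF abs_ge_zero second_moment[of 0 0]] by simp
  define D where "D = 3 * c0 * C4 + 6 * c0 * c1\<^sup>2 * (c + Cv) + 2 * (c + Cv) * (c0 * kernel_const * c2)"
  have D0: "0 \<le> D" using c0 C4 cc c Cv_nonneg kernel_const(1) by (auto simp: D_def)
  have intF: "integrable P (level_sum J j)" for J j
    unfolding level_sum_def
    by (rule variance_sum_squares(1)[where b="reach_end J j"])
      (auto intro: present_integrable present_power4_integrable dest: present_support)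
  have main: "expectation (\<lambda>\<omega>. \<bar>level_sum J j \<omega> - c * 2 ^ (J - j) * 2 powr ((2 - \<alpha>) * j)\<bar>)
    \<le> sqrt (2 ^ (J - j) * D * 2 powr ((3 - \<alpha>) * j)) + (Cv * 2 ^ (J - j) * 2 powr ((2 - \<alpha> - \<gamma>) * j)
       + p2 * 2 powr ((2 - mid_exp) * j) + p1\<^sup>2 * 2 powr ((3 - 2 * mid_exp) * j))" (is "_ \<le> ?S + ?B") for J j
  proof -
    let ?K = "shifts J j"
    have K0: "0 \<le> k" if "k \<in> ?K" for k using that by (simp add: shifts_def)
    \<comment> \<open>The whole-line shot has mean 0, so removing the past leaves minus its
      mean.\<close>
    have mp: "integral\<^sup>L intensity (present j k) = - integral\<^sup>L intensity (past j k)" for k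
    proof -
      have "integral\<^sup>L intensity (shot j k) = integral\<^sup>L intensity (present j k) + integral\<^sup>L intensity (past j k)"
        unfolding shot_split using present_integrable past_integrable by simp
      then show ?thesis using shot_mean_zero[of j k] by simp
    qed
    have v2: "(\<integral>z. (present j k z)\<^sup>2 \<partial>intensity) = (\<integral>z. (shot j k z)\<^sup>2 \<partial>intensity) - (\<integral>z. (past j k z)\<^sup>2 \<partial>intensity)" for k
    proof -
      have "(shot j k z)\<^sup>2 = (present j k z)\<^sup>2 + (past j k z)\<^sup>2" for z
        by (simp add: present_def past_def indicator_def)
      then show ?thesis using present_square_integrable past_square_integrable by simp
    qed
    have V2: "(\<integral>z. (shot j k z)\<^sup>2 \<partial>intensity) \<le> (c + Cv) * 2 powr ((2 - \<alpha>) * j)" if "k \<in> ?K" for k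
    proof -
      have "Cv * 2 powr ((2 - \<alpha> - \<gamma>) * j) \<le> Cv * 2 powr ((2 - \<alpha>) * j)"
        using \<gamma> Cv_nonneg by (intro mult_left_mono powr_mono mult_right_mono) auto
      then show ?thesis using second_moment[OF K0[OF that], of j] by (simp add: algebra_simps)
    qed
    have past2: "(\<Sum>k\<in>?K. \<integral>z. (past j k z)\<^sup>2 \<partial>intensity) \<le> p2 * 2 powr ((2 - mid_exp) * j)"
    proof -
      have "ennreal (\<Sum>k\<in>?K. \<integral>z. (past j k z)\<^sup>2 \<partial>intensity) = (\<Sum>k\<in>?K. \<integral>\<^sup>+z. ennreal (\<bar>past j k z\<bar> ^ 2) \<partial>intensity)"
        using past_square_integrable by (simp add: nn_integral_eq_integral)
      also have "\<dots> \<le> ennreal ((6 * M + 2) * kernel_const ^ 2 * mark_mom 2 * 2 powr (real 2 * real j / 2 + j - mid_exp * j))"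
        by (rule past_moment_bound) (auto simp: shifts_def)
      finally have "(\<Sum>k\<in>?K. \<integral>z. (past j k z)\<^sup>2 \<partial>intensity) \<le> (6 * M + 2) * kernel_const ^ 2 * mark_mom 2 * 2 powr (real 2 * real j / 2 + j - mid_exp * j)"
        using M_ge_1 kernel_const(1) mark_mom[of 2] by (subst (asm) ennreal_le_iff) auto
      then show ?thesis by (simp add: p2_def c0_def left_diff_distrib)
    qed
    \<comment> \<open>Squares of nonnegative numbers sum to at most the square of their sum, and the
      sum over all shifts is bounded without a factor \<open>card ?K\<close>.\<close>
    have past1: "(\<Sum>k\<in>?K. (integral\<^sup>L intensity (past j k))\<^sup>2) \<le> p1\<^sup>2 * 2 powr ((3 - 2 * mid_exp) * j)"
    proof -
      have "ennreal (\<Sum>k\<in>?K. \<integral>z. \<bar>past j k z\<bar> \<partial>intensity) = (\<Sum>k\<in>?K. \<integral>\<^sup>+z. ennreal (\<bar>past j k z\<bar> ^ 1) \<partial>intensity)"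
        using past_integrable by (subst sum_ennreal[symmetric]) (auto simp: nn_integral_eq_integral integrable_abs intro!: sum.cong)
      also have "\<dots> \<le> ennreal ((6 * M + 2) * kernel_const ^ 1 * mark_mom 1 * 2 powr (real 1 * real j / 2 + j - mid_exp * j))"
        by (rule past_moment_bound) (auto simp: shifts_def)
      finally have "(\<Sum>k\<in>?K. \<integral>z. \<bar>past j k z\<bar> \<partial>intensity) \<le> (6 * M + 2) * kernel_const ^ 1 * mark_mom 1 * 2 powr (real 1 * real j / 2 + j - mid_exp * j)"
        using M_ge_1 kernel_const(1) mark_mom[of 1] by (subst (asm) ennreal_le_iff) auto
      then have s: "(\<Sum>k\<in>?K. \<integral>z. \<bar>past j k z\<bar> \<partial>intensity) \<le> p1 * 2 powr ((3 / 2 - mid_exp) * j)"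
        by (simp add: p1_def c0_def left_diff_distrib)
      have "(\<Sum>k\<in>?K. (integral\<^sup>L intensity (past j k))\<^sup>2) \<le> (\<Sum>k\<in>?K. (\<integral>z. \<bar>past j k z\<bar> \<partial>intensity)\<^sup>2)"
        by (intro sum_mono) (auto simp: abs_le_square_iff[symmetric] intro!: order_trans[OF integral_abs_bound])
      also have "\<dots> \<le> (\<Sum>k\<in>?K. \<integral>z. \<bar>past j k z\<bar> \<partial>intensity)\<^sup>2"
      proof -
        have "(\<Sum>k\<in>?K. (\<integral>z. \<bar>past j k z\<bar> \<partial>intensity)\<^sup>2) \<le> (\<Sum>k\<in>?K. (\<integral>z. \<bar>past j k z\<bar> \<partial>intensity) * (\<Sum>k\<in>?K. \<integral>z. \<bar>past j k z\<bar> \<partial>intensity))"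
          unfolding power2_eq_square by (intro sum_mono mult_left_mono member_le_sum) auto
        then show ?thesis by (simp add: power2_eq_square sum_distrib_right)
      qed
      also have "\<dots> \<le> (p1 * 2 powr ((3 / 2 - mid_exp) * j))\<^sup>2"
        by (intro power_mono s sum_nonneg) auto
      also have "\<dots> = p1\<^sup>2 * 2 powr ((3 - 2 * mid_exp) * j)"
        by (simp add: power_mult_distrib power2_eq_square algebra_simps flip: powr_add)
      finally show ?thesis .
    qed
    have EF: "expectation (level_sum J j) = (\<Sum>k\<in>?K. (\<integral>z. present j k z * present j k z \<partial>intensity) + (integral\<^sup>L intensity (present j k))\<^sup>2)"
      unfolding level_sum_def
      by (rule variance_sum_squares(2)[where b="reach_end J j"])
        (auto intro: present_integrable present_power4_integrable dest: present_support)
    also have "\<dots> = (\<Sum>k\<in>?K. (\<integral>z. (shot j k z)\<^sup>2 \<partial>intensity)) - (\<Sum>k\<in>?K. \<integral>z. (past j k z)\<^sup>2 \<partial>intensity) + (\<Sum>k\<in>?K. (integral\<^sup>L intensity (past j k))\<^sup>2)"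
      by (simp add: mp v2 sum.distrib sum_subtractf flip: power2_eq_square)
    finally have EF': "expectation (level_sum J j) = (\<Sum>k\<in>?K. (\<integral>z. (shot j k z)\<^sup>2 \<partial>intensity)) - (\<Sum>k\<in>?K. \<integral>z. (past j k z)\<^sup>2 \<partial>intensity) + (\<Sum>k\<in>?K. (integral\<^sup>L intensity (past j k))\<^sup>2)" .
    have "\<bar>(\<Sum>k\<in>?K. (\<integral>z. (shot j k z)\<^sup>2 \<partial>intensity)) - c * 2 ^ (J - j) * 2 powr ((2 - \<alpha>) * j)\<bar>
      = \<bar>\<Sum>k\<in>?K. (\<integral>z. (shot j k z)\<^sup>2 \<partial>intensity) - c * 2 powr ((2 - \<alpha>) * j)\<bar>"
      by (simp add: sum_subtractf card_shifts mult_ac)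
    also have "\<dots> \<le> (\<Sum>k\<in>?K. Cv * 2 powr ((2 - \<alpha> - \<gamma>) * j))"
      by (intro order_trans[OF sum_abs] sum_mono second_moment K0)
    also have "\<dots> = Cv * 2 ^ (J - j) * 2 powr ((2 - \<alpha> - \<gamma>) * j)"
      by (simp add: card_shifts mult_ac)
    finally have V: "\<bar>(\<Sum>k\<in>?K. (\<integral>z. (shot j k z)\<^sup>2 \<partial>intensity)) - c * 2 ^ (J - j) * 2 powr ((2 - \<alpha>) * j)\<bar> \<le> Cv * 2 ^ (J - j) * 2 powr ((2 - \<alpha> - \<gamma>) * j)" .
    have "0 \<le> (\<Sum>k\<in>?K. \<integral>z. (past j k z)\<^sup>2 \<partial>intensity)" "0 \<le> (\<Sum>k\<in>?K. (integral\<^sup>L intensity (past j k))\<^sup>2)"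
      by (auto intro!: sum_nonneg)
    then have bias: "\<bar>expectation (level_sum J j) - c * 2 ^ (J - j) * 2 powr ((2 - \<alpha>) * j)\<bar> \<le> ?B"
      unfolding EF' using V past1 past2 by linarith
    \<comment> \<open>Envelope for the sum over shifts: at most \<open>c0\<close> of them are
      active, and each contributes at most \<open>kernel_const\<close> 2^(j/2) times the absolute
      mark, because the minimum in the kernel bound is at most 2^j.\<close>
    let ?h = "\<lambda>z. c0 * kernel_const * 2 powr (j / 2) * \<bar>snd (snd z)\<bar>"
    have ov: "real (card {k\<in>?K. present j k z \<noteq> 0}) \<le> c0" for z
    proof -
      have "{k\<in>?K. present j k z \<noteq> 0} \<subseteq> {k\<in>?K. kernel j k (fst z) (fst (snd z)) \<noteq> 0}"
        by (auto simp: present_def shot_def)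
      then have "real (card {k\<in>?K. present j k z \<noteq> 0}) \<le> real (card {k\<in>?K. kernel j k (fst z) (fst (snd z)) \<noteq> 0})"
        by (intro of_nat_mono card_mono) auto
      also have "\<dots> \<le> c0" unfolding c0_def by (rule kernel_overlap)
      finally show ?thesis .
    qed
    have "expectation (\<lambda>\<omega>. \<bar>level_sum J j \<omega> - expectation (level_sum J j)\<bar>)
      \<le> sqrt (card ?K * (3 * c0 * (C4 * 2 powr ((3 - \<alpha>) * j)) + 6 * c0 * (c1 * 2 powr (j / 2))\<^sup>2 * ((c + Cv) * 2 powr ((2 - \<alpha>) * j))
          + 2 * ((c + Cv) * 2 powr ((2 - \<alpha>) * j)) * (c0 * kernel_const * 2 powr (j / 2) * (c2 * 2 powr (j / 2)))))"
      unfolding level_sum_def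
    proof (rule mean_deviation_sum_squares[where b="reach_end J j" and h="?h"])
      fix k assume k: "k \<in> ?K"
      show "integrable intensity (present j k)" by (rule present_integrable)
      show "integrable intensity (\<lambda>z. present j k z ^ 4)" by (rule present_power4_integrable)
      show "fst z \<in> {0..reach_end J j}" if "present j k z \<noteq> 0" for z using present_support[OF k that] .
      have "\<bar>integral\<^sup>L intensity (present j k)\<bar> \<le> (\<integral>z. \<bar>present j k z\<bar> \<partial>intensity)" by (rule integral_abs_bound)
      also have "\<dots> \<le> (\<integral>z. \<bar>shot j k z\<bar> \<partial>intensity)"
        using present_integrable shot_integrable abs_present_le by (intro Bochner_Integration.integral_mono) auto
      also have "\<dots> \<le> c1 * 2 powr (j / 2)" using shot_abs_integral[of j k] by (simp add: c1_def)
      finally show "(integral\<^sup>L intensity (present j k))\<^sup>2 \<le> (c1 * 2 powr (j / 2))\<^sup>2"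
        by (simp add: abs_le_square_iff[symmetric])
      have "0 \<le> (\<integral>z. (past j k z)\<^sup>2 \<partial>intensity)" by simp
      then show "(\<integral>z. (present j k z)\<^sup>2 \<partial>intensity) \<le> (c + Cv) * 2 powr ((2 - \<alpha>) * j)"
        using V2[OF k] v2[of k] by linarith
      have "(\<integral>z. present j k z ^ 4 \<partial>intensity) \<le> (\<integral>z. shot j k z ^ 4 \<partial>intensity)"
        using present_power4_integrable shot_power4_integrable
        by (intro Bochner_Integration.integral_mono) (auto simp: present_def indicator_def)
      also have "ennreal \<dots> = (\<integral>\<^sup>+z. ennreal (shot j k z ^ 4) \<partial>intensity)"
        using shot_power4_integrable by (intro nn_integral_eq_integral[symmetric]) auto
      then have "(\<integral>z. shot j k z ^ 4 \<partial>intensity) \<le> C4 * 2 powr ((3 - \<alpha>) * j)"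
        using C4(2)[of j k] C4(1) by (metis ennreal_le_iff mult_nonneg_nonneg powr_ge_zero)
      finally show "(\<integral>z. present j k z ^ 4 \<partial>intensity) \<le> C4 * 2 powr ((3 - \<alpha>) * j)" .
      have le: "\<bar>\<bar>present j k z\<bar> * ?h z\<bar> \<le> \<bar>c0 * kernel_const * 2 powr (j / 2) * (\<bar>snd (snd z)\<bar> * \<bar>shot j k z\<bar>)\<bar>" for z
        using abs_present_le[of j k z] c0 kernel_const(1) by (simp add: abs_mult mult.commute mult.left_commute mult_left_mono)
      have iw: "integrable intensity (\<lambda>z. c0 * kernel_const * 2 powr (j / 2) * (\<bar>snd (snd z)\<bar> * \<bar>shot j k z\<bar>))"
        using weighted_shot_integrable by (intro integrable_mult_right)
      show ih: "integrable intensity (\<lambda>z. \<bar>present j k z\<bar> * ?h z)"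
        using iw by (rule Bochner_Integration.integrable_bound) (use le in auto)
      have "(\<integral>z. \<bar>present j k z\<bar> * ?h z \<partial>intensity) \<le> (\<integral>z. c0 * kernel_const * 2 powr (j / 2) * (\<bar>snd (snd z)\<bar> * \<bar>shot j k z\<bar>) \<partial>intensity)"
      proof (rule Bochner_Integration.integral_mono[OF ih iw])
        fix z
        have "0 \<le> c0 * kernel_const * 2 powr (j / 2) * (\<bar>snd (snd z)\<bar> * \<bar>shot j k z\<bar>)" using c0 kernel_const(1) by simp
        then show "\<bar>present j k z\<bar> * ?h z \<le> c0 * kernel_const * 2 powr (j / 2) * (\<bar>snd (snd z)\<bar> * \<bar>shot j k z\<bar>)"
          using le[of z] by linarith
      qed
      also have "\<dots> = c0 * kernel_const * 2 powr (j / 2) * (\<integral>z. \<bar>snd (snd z)\<bar> * \<bar>shot j k z\<bar> \<partial>intensity)"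
        by simp
      also have "\<dots> \<le> c0 * kernel_const * 2 powr (j / 2) * (c2 * 2 powr (j / 2))"
        using weighted_shot_integral[of j k] c0 kernel_const(1) unfolding c2_def by (intro mult_left_mono) auto
      finally show "(\<integral>z. \<bar>present j k z\<bar> * ?h z \<partial>intensity) \<le> c0 * kernel_const * 2 powr (j / 2) * (c2 * 2 powr (j / 2))" .
    next
      show "real (card {k\<in>?K. present j k z \<noteq> 0}) \<le> c0" for z by (rule ov)
      show "(\<Sum>k\<in>?K. \<bar>present j k z\<bar>) \<le> ?h z" for z
      proof -
        have single: "\<bar>present j k z\<bar> \<le> kernel_const * 2 powr (j / 2) * \<bar>snd (snd z)\<bar>" for k
        proof (cases "0 < fst (snd z)")
          case True
          have "\<bar>kernel j k (fst z) (fst (snd z))\<bar> \<le> kernel_const * 2 powr (- real j / 2) * min (2 ^ j) (1 + fst (snd z))"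
            by (rule kernel_const(2)[OF True])
          also have "\<dots> \<le> kernel_const * 2 powr (- real j / 2) * 2 ^ j" using kernel_const(1) by (intro mult_left_mono) auto
          also have "\<dots> = kernel_const * (2 powr (- real j / 2) * 2 powr j)" by (simp add: powr_realpow)
          also have "2 powr (- real j / 2) * 2 powr j = 2 powr (j / 2)" by (simp flip: powr_add)
          finally have "\<bar>shot j k z\<bar> \<le> \<bar>snd (snd z)\<bar> * (kernel_const * 2 powr (j / 2))"
            unfolding shot_def abs_mult by (intro mult_left_mono) auto
          then show ?thesis using abs_present_le[of j k z] by (simp add: mult_ac)
        next
          case False
          then show ?thesis using kernel_const(1) by (simp add: present_def shot_def kernel_empty)
        qed
        have "(\<Sum>k\<in>?K. \<bar>present j k z\<bar>) = (\<Sum>k\<in>{k\<in>?K. present j k z \<noteq> 0}. \<bar>present j k z\<bar>)"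
          by (intro sum.mono_neutral_right) auto
        also have "\<dots> \<le> (\<Sum>k\<in>{k\<in>?K. present j k z \<noteq> 0}. kernel_const * 2 powr (j / 2) * \<bar>snd (snd z)\<bar>)"
          by (intro sum_mono single)
        also have "\<dots> \<le> c0 * (kernel_const * 2 powr (j / 2) * \<bar>snd (snd z)\<bar>)"
          using ov[of z] kernel_const(1) by (simp add: mult_right_mono)
        finally show ?thesis by (simp add: mult_ac)
      qed
    qed simp
    \<comment> \<open>All three contributions to the variance have the same order: 3 - \<alpha>
      arises directly, as 1 + (2 - \<alpha>), and as (2 - \<alpha>) + 1/2 + 1/2.\<close>
    also have "\<dots> = ?S"
    proof -
      have a: "(c1 * 2 powr (j / 2))\<^sup>2 * ((c + Cv) * 2 powr ((2 - \<alpha>) * j)) = c1\<^sup>2 * (c + Cv) * 2 powr ((3 - \<alpha>) * j)"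
      proof -
        have "(2 powr (j / 2))\<^sup>2 * 2 powr ((2 - \<alpha>) * j) = 2 powr ((3 - \<alpha>) * j)"
          by (simp add: power2_eq_square algebra_simps flip: powr_add)
        then show ?thesis by (simp add: power_mult_distrib)
      qed
      have b: "2 powr ((2 - \<alpha>) * j) * (2 powr (j / 2) * 2 powr (j / 2)) = 2 powr ((3 - \<alpha>) * j)"
        by (simp add: algebra_simps flip: powr_add)
      have "3 * c0 * (C4 * 2 powr ((3 - \<alpha>) * j)) + 6 * c0 * (c1 * 2 powr (j / 2))\<^sup>2 * ((c + Cv) * 2 powr ((2 - \<alpha>) * j))
          + 2 * ((c + Cv) * 2 powr ((2 - \<alpha>) * j)) * (c0 * kernel_const * 2 powr (j / 2) * (c2 * 2 powr (j / 2)))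
        = 3 * c0 * C4 * 2 powr ((3 - \<alpha>) * j) + 6 * c0 * ((c1 * 2 powr (j / 2))\<^sup>2 * ((c + Cv) * 2 powr ((2 - \<alpha>) * j)))
          + 2 * (c + Cv) * (c0 * kernel_const * c2) * (2 powr ((2 - \<alpha>) * j) * (2 powr (j / 2) * 2 powr (j / 2)))"
        by simp
      also have "\<dots> = D * 2 powr ((3 - \<alpha>) * j)"
        unfolding a b D_def by (simp add: algebra_simps)
      finally show ?thesis by (simp add: card_shifts mult_ac)
    qed
    finally have dev: "expectation (\<lambda>\<omega>. \<bar>level_sum J j \<omega> - expectation (level_sum J j)\<bar>) \<le> ?S" .
    have "expectation (\<lambda>\<omega>. \<bar>level_sum J j \<omega> - c * 2 ^ (J - j) * 2 powr ((2 - \<alpha>) * j)\<bar>)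
      \<le> expectation (\<lambda>\<omega>. \<bar>level_sum J j \<omega> - expectation (level_sum J j)\<bar> + \<bar>expectation (level_sum J j) - c * 2 ^ (J - j) * 2 powr ((2 - \<alpha>) * j)\<bar>)"
      using intF by (intro Bochner_Integration.integral_mono) auto
    also have "\<dots> = expectation (\<lambda>\<omega>. \<bar>level_sum J j \<omega> - expectation (level_sum J j)\<bar>) + \<bar>expectation (level_sum J j) - c * 2 ^ (J - j) * 2 powr ((2 - \<alpha>) * j)\<bar>"
      using intF by (subst Bochner_Integration.integral_add) (auto simp: prob_space)
    also have "\<dots> \<le> ?S + ?B" using dev bias by simp
    finally show ?thesis .
  qed
  define C where "C = sqrt D + Cv + p2 + p1\<^sup>2"
  have final: "expectation (\<lambda>\<omega>. \<bar>level_sum J j \<omega> * 2 powr (- (2 - \<alpha>) * j) - c * 2 ^ (J - j)\<bar>)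
       \<le> C * 2 ^ (J - j) * (2 powr (- \<gamma> * j) + 2 powr ((\<alpha> * j - J) / 2))" if jJ: "j \<le> J" for J j
  proof -
    let ?u = "2 powr (- (2 - \<alpha>) * j)"
    let ?n = "(2::real) ^ (J - j)"
    let ?s = "?n * 2 powr ((\<alpha> * j - J) / 2)"
    have n: "?n = 2 powr (real J - real j)" using jJ by (simp add: powr_realpow[symmetric] of_nat_diff)
    have inv: "2 powr ((2 - \<alpha>) * j) * ?u = 1" by (simp flip: powr_add) (simp add: algebra_simps)
    have eq: "\<bar>level_sum J j \<omega> * ?u - c * ?n\<bar> = ?u * \<bar>level_sum J j \<omega> - c * ?n * 2 powr ((2 - \<alpha>) * j)\<bar>" for \<omega>
    proof -
      have "level_sum J j \<omega> * ?u - c * ?n = ?u * (level_sum J j \<omega> - c * ?n * 2 powr ((2 - \<alpha>) * j))"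
        using inv by (simp add: right_diff_distrib mult.assoc) (simp add: mult.left_commute mult.commute)
      then show ?thesis by (simp add: abs_mult)
    qed
    have s: "?s = 2 powr (real J / 2 - (1 - \<alpha> / 2) * j)"
      unfolding n by (simp add: algebra_simps flip: powr_add) (simp add: field_simps)
    have sq: "sqrt (?n * D * 2 powr ((3 - \<alpha>) * j)) * ?u = sqrt D * ?s"
    proof -
      have "sqrt (?n * D * 2 powr ((3 - \<alpha>) * j)) = sqrt D * sqrt (?n * 2 powr ((3 - \<alpha>) * j))"
        by (simp add: real_sqrt_mult mult_ac)
      also have "sqrt (?n * 2 powr ((3 - \<alpha>) * j)) = 2 powr ((real J - real j + (3 - \<alpha>) * j) / 2)"
        unfolding n by (simp add: powr_half_sqrt[symmetric] powr_powr flip: powr_add)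
      finally have "sqrt (?n * D * 2 powr ((3 - \<alpha>) * j)) * ?u = sqrt D * (2 powr ((real J - real j + (3 - \<alpha>) * j) / 2) * ?u)"
        by simp
      also have "2 powr ((real J - real j + (3 - \<alpha>) * j) / 2) * ?u = ?s"
        unfolding s powr_add[symmetric] by (simp add: field_simps)
      finally show ?thesis .
    qed
    have b1: "Cv * ?n * 2 powr ((2 - \<alpha> - \<gamma>) * j) * ?u = Cv * (?n * 2 powr (- \<gamma> * j))"
      by (simp add: mult.assoc algebra_simps flip: powr_add)
    have e_eq: "2 * mid_exp = 1 + \<alpha>" by (simp add: mid_exp_def)
    \<comment> \<open>Here the value of \<open>mid_exp\<close> enters: the comparison of exponents
      reduces to j \<le> J.\<close>
    have "2 powr ((2 - mid_exp) * j) * ?u \<le> ?s"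
    proof -
      have "2 powr ((2 - mid_exp) * j) * ?u = 2 powr ((\<alpha> - mid_exp) * j)"
        by (simp add: algebra_simps flip: powr_add)
      also have "(\<alpha> - mid_exp) * j \<le> real J / 2 - (1 - \<alpha> / 2) * j"
      proof -
        have "(\<alpha> - mid_exp) * j = (\<alpha> / 2 - 1 / 2) * j" by (simp add: mid_exp_def field_simps)
        then show ?thesis using jJ by (simp add: algebra_simps)
      qed
      then have "2 powr ((\<alpha> - mid_exp) * j) \<le> ?s" unfolding s by (intro powr_mono) auto
      finally show ?thesis .
    qed
    then have b2: "p2 * 2 powr ((2 - mid_exp) * j) * ?u \<le> p2 * ?s"
      using cc by (simp add: mult.assoc mult_left_mono)
    have "2 powr ((3 - 2 * mid_exp) * j) * ?u \<le> ?s"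
    proof -
      have "2 powr ((3 - 2 * mid_exp) * j) * ?u = 1"
        unfolding e_eq powr_add[symmetric] by (simp add: algebra_simps)
      also have "0 \<le> real J / 2 - (1 - \<alpha> / 2) * j"
      proof -
        have "(1 - \<alpha> / 2) * j \<le> 1 / 2 * j" using \<alpha>_gt_1 by (intro mult_right_mono) auto
        then show ?thesis using jJ by simp
      qed
      then have "1 \<le> ?s" unfolding s by (simp add: ge_one_powr_ge_zero)
      finally show ?thesis .
    qed
    then have b3: "p1\<^sup>2 * 2 powr ((3 - 2 * mid_exp) * j) * ?u \<le> p1\<^sup>2 * ?s"
      by (simp add: mult.assoc mult_left_mono)
    have "expectation (\<lambda>\<omega>. \<bar>level_sum J j \<omega> * ?u - c * ?n\<bar>) = ?u * expectation (\<lambda>\<omega>. \<bar>level_sum J j \<omega> - c * ?n * 2 powr ((2 - \<alpha>) * j)\<bar>)"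
      unfolding eq by simp
    also have "\<dots> \<le> ?u * (sqrt (?n * D * 2 powr ((3 - \<alpha>) * j)) + (Cv * ?n * 2 powr ((2 - \<alpha> - \<gamma>) * j)
       + p2 * 2 powr ((2 - mid_exp) * j) + p1\<^sup>2 * 2 powr ((3 - 2 * mid_exp) * j)))"
      by (intro mult_left_mono main) simp
    also have "\<dots> = sqrt (?n * D * 2 powr ((3 - \<alpha>) * j)) * ?u + Cv * ?n * 2 powr ((2 - \<alpha> - \<gamma>) * j) * ?u
       + p2 * 2 powr ((2 - mid_exp) * j) * ?u + p1\<^sup>2 * 2 powr ((3 - 2 * mid_exp) * j) * ?u"
      by (simp only: distrib_left distrib_right mult.commute add.assoc)
    also have "\<dots> \<le> sqrt D * ?s + Cv * (?n * 2 powr (- \<gamma> * j)) + p2 * ?s + p1\<^sup>2 * ?s"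
      unfolding sq b1 using b2 b3 by simp
    also have "\<dots> \<le> C * (?n * 2 powr (- \<gamma> * j)) + C * ?s"
    proof -
      have "0 \<le> (sqrt D + p2 + p1\<^sup>2) * (?n * 2 powr (- \<gamma> * j))" "0 \<le> Cv * ?s"
        using D0 cc Cv_nonneg by (auto intro!: mult_nonneg_nonneg add_nonneg_nonneg)
      then show ?thesis unfolding C_def by (simp only: distrib_right)
    qed
    also have "\<dots> = C * ?n * (2 powr (- \<gamma> * j) + 2 powr ((\<alpha> * j - J) / 2))"
      by (simp add: algebra_simps)
    finally show ?thesis .
  qed
  have "0 \<le> C" using D0 Cv_nonneg cc by (simp add: C_def)
  then show thesis using that intF final by blast
qed

end

section \<open>The contrast\<close>

lemma scale_indices_Sigma: "scale_indices J J0 J1 = (SIGMA j:{J0<..J1}. {0..2 ^ (J - j) - 1})"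
  by (auto simp: scale_indices_def)

lemma sum_scale_indices:
  "(\<Sum>(j, k)\<in>scale_indices J J0 J1. f j k) = (\<Sum>j\<in>{J0<..J1}. \<Sum>k\<in>{0..2 ^ (J - j) - 1}. f j k)"
  unfolding scale_indices_Sigma by (rule sum.Sigma[symmetric]) auto

lemma card_scale_indices: "real (card (scale_indices J J0 J1)) = (\<Sum>j\<in>{J0<..J1}. 2 ^ (J - j))"
  unfolding scale_indices_Sigma by (subst card_SigmaI) (auto simp: nat_power_eq)

text \<open>Adding one more scale doubles all old weights and gives the new scale weight 1; the
  closed forms solve the resulting recursions.\<close>

lemma scale_shift_sums:
  fixes J0 p :: nat
  shows "(\<Sum>j\<in>{J0<..J0 + p}. 2 ^ (J0 + p - j)) = (2 ^ p - 1 :: real)"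
    and "(\<Sum>j\<in>{J0<..J0 + p}. 2 ^ (J0 + p - j) * (real j - real J0 - 1)) = 2 ^ p - real p - 1"
proof -
  have ins: "{J0<..J0 + Suc p} = insert (J0 + Suc p) {J0<..J0 + p}" for p by auto
  have dbl: "(2::real) ^ (J0 + Suc p - j) = 2 * 2 ^ (J0 + p - j)" if "j \<in> {J0<..J0 + p}" for j p
    using that by (simp add: Suc_diff_le)
  show 1: "(\<Sum>j\<in>{J0<..J0 + p}. 2 ^ (J0 + p - j)) = (2 ^ p - 1 :: real)"
  proof (induction p)
    case (Suc p)
    have "(\<Sum>j\<in>{J0<..J0 + Suc p}. 2 ^ (J0 + Suc p - j)) = 1 + (\<Sum>j\<in>{J0<..J0 + p}. 2 ^ (J0 + Suc p - j) :: real)"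
      unfolding ins by (subst sum.insert) auto
    also have "(\<Sum>j\<in>{J0<..J0 + p}. 2 ^ (J0 + Suc p - j) :: real) = 2 * (\<Sum>j\<in>{J0<..J0 + p}. 2 ^ (J0 + p - j))"
      unfolding sum_distrib_left using dbl by (intro sum.cong) auto
    finally show ?case using Suc by simp
  qed simp
  show "(\<Sum>j\<in>{J0<..J0 + p}. 2 ^ (J0 + p - j) * (real j - real J0 - 1)) = 2 ^ p - real p - 1"
  proof (induction p)
    case (Suc p)
    have "(\<Sum>j\<in>{J0<..J0 + Suc p}. 2 ^ (J0 + Suc p - j) * (real j - real J0 - 1)) = real p + (\<Sum>j\<in>{J0<..J0 + p}. 2 ^ (J0 + Suc p - j) * (real j - real J0 - 1))"
      unfolding ins by (subst sum.insert) auto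
    also have "(\<Sum>j\<in>{J0<..J0 + p}. 2 ^ (J0 + Suc p - j) * (real j - real J0 - 1)) = 2 * (\<Sum>j\<in>{J0<..J0 + p}. 2 ^ (J0 + p - j) * (real j - real J0 - 1))"
      unfolding sum_distrib_left using dbl by (intro sum.cong) (auto simp: mult.assoc)
    finally show ?case using Suc by simp
  qed simp
qed

text \<open>The square of 1 + y / 2 \<le> exp (y / 2); y \<ge> -2 keeps the smaller side
  nonnegative.\<close>

lemma exp_ge_quadratic:
  fixes y :: real
  assumes "- 2 \<le> y"
  shows "1 + y + y\<^sup>2 / 4 \<le> exp y"
proof -
  have "1 + y + y\<^sup>2 / 4 = (1 + y / 2)\<^sup>2" by (simp add: power2_eq_square field_simps)
  also have "\<dots> \<le> (exp (y / 2))\<^sup>2" using assms by (intro power_mono) auto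
  also have "\<dots> = exp y" by (simp add: power2_eq_square flip: exp_add)
  finally show ?thesis .
qed

text \<open>The mean of a truncated geometric law. The lower bound, attained for J = J0 + 2, keeps m
  at distance 1/3 from J0 + 1, which yields curvature of the contrast; the upper bound keeps |j - m|
  below j - J0 at later scales.\<close>

lemma mean_scale_bounds:
  assumes J: "J0 + 2 \<le> J"
  defines "m \<equiv> mean_scale (scale_indices J J0 J)"
  shows "J0 + 4 / 3 \<le> m" "m \<le> J0 + 2" "(\<Sum>j\<in>{J0<..J}. 2 ^ (J - j) * (real j - m)) = 0"
proof -
  define p where "p = J - J0"
  have Jp: "J = J0 + p" "2 \<le> p" using J by (auto simp: p_def)
  have n: "(\<Sum>j\<in>{J0<..J}. 2 ^ (J - j)) = (2 ^ p - 1 :: real)" unfolding Jp(1) by (rule scale_shift_sums)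
  have n0: "0 < (2 ^ p - 1 :: real)" using one_less_power[of "2::real" p] Jp by simp
  have m: "m * (2 ^ p - 1) = (\<Sum>j\<in>{J0<..J}. 2 ^ (J - j) * real j)"
  proof -
    have "(\<Sum>(j, k)\<in>scale_indices J J0 J. real j) = (\<Sum>j\<in>{J0<..J}. 2 ^ (J - j) * real j)"
      unfolding sum_scale_indices by (simp add: nat_power_eq)
    then show ?thesis
      unfolding m_def mean_scale_def card_scale_indices n using n0 by simp
  qed
  moreover have "(\<Sum>j\<in>{J0<..J}. 2 ^ (J - j) * (real j - m)) = (\<Sum>j\<in>{J0<..J}. 2 ^ (J - j) * real j) - m * (\<Sum>j\<in>{J0<..J}. 2 ^ (J - j))"
    unfolding sum_distrib_left sum_subtractf[symmetric] by (intro sum.cong refl) (simp add: algebra_simps)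
  ultimately show "(\<Sum>j\<in>{J0<..J}. 2 ^ (J - j) * (real j - m)) = 0"
    using n by simp
  have "(m - J0 - 1) * (2 ^ p - 1) = (\<Sum>j\<in>{J0<..J}. 2 ^ (J - j) * (real j - real J0 - 1))"
  proof -
    have "(\<Sum>j\<in>{J0<..J}. 2 ^ (J - j) * (real j - real J0 - 1)) = (\<Sum>j\<in>{J0<..J}. 2 ^ (J - j) * real j) - (real J0 + 1) * (\<Sum>j\<in>{J0<..J}. 2 ^ (J - j))"
      unfolding sum_distrib_left sum_subtractf[symmetric] by (intro sum.cong refl) (simp add: algebra_simps)
    then show ?thesis using m n by (simp add: left_diff_distrib distrib_right)
  qed
  also have "\<dots> = 2 ^ p - real p - 1" unfolding Jp(1) by (rule scale_shift_sums)
  finally have eq: "(m - J0 - 1) * (2 ^ p - 1) = 2 ^ p - real p - 1" .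
  have "(m - J0 - 1) * (2 ^ p - 1) \<le> 1 * (2 ^ p - 1)" unfolding eq by simp
  then have "m - J0 - 1 \<le> 1" using n0 mult_right_le_imp_le by blast
  then show "m \<le> J0 + 2" by simp
  have "3 * real p + 2 \<le> 2 * 2 ^ p" using Jp(2)
  proof (induction p rule: dec_induct)
    case (step q)
    have "(4::real) \<le> 2 ^ q" using step power_increasing[of 2 q "2::real"] by simp
    then show ?case using step by simp
  qed simp
  then have "1 / 3 * (2 ^ p - 1) \<le> (m - J0 - 1) * (2 ^ p - 1)" unfolding eq by simp
  then have "1 / 3 \<le> m - J0 - 1" using n0 mult_right_le_imp_le by blast
  then show "J0 + 4 / 3 \<le> m" by simp
qed

text \<open>With \<open>\<theta> = x ln 2\<close>, \<open>exp y \<ge> 1 + y + y\<^sup>2 / 4\<close> is applied at the coarsest retained scale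
  \<open>j = J0 + 1\<close> and \<open>exp y \<ge> 1 + y\<close> at all others; the linear terms cancel up to the weighted error,
  because \<open>m\<close> is the mean scale for the weights \<open>2 ^ (J - j)\<close>.\<close>

lemma tilted_sum_gt:
  fixes s :: "nat \<Rightarrow> real" and x c \<rho> :: real
  assumes J: "J0 + 2 \<le> J" and c: "0 < c" and s: "\<And>j. 0 \<le> s j"
    and \<rho>: "0 < \<rho>" "\<rho> < \<bar>x\<bar>" "\<bar>x\<bar> < 2"
    and err: "(\<Sum>j\<in>{J0<..J}. (real j - J0) * \<bar>s j - c * 2 ^ (J - j)\<bar>) \<le> c * 2 ^ (J - J0) * \<rho> / 288"
  defines "m \<equiv> mean_scale (scale_indices J J0 J)"
  shows "(\<Sum>j\<in>{J0<..J}. s j) < (\<Sum>j\<in>{J0<..J}. s j * 2 powr (x * (real j - m)))" "0 < (\<Sum>j\<in>{J0<..J}. s j)"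
proof -
  define H where "H = (\<Sum>j\<in>{J0<..J}. (real j - J0) * \<bar>s j - c * 2 ^ (J - j)\<bar>)"
  \<comment> \<open>The weight of the index \<open>Suc J0\<close>, on which the quadratic gain is
    taken.\<close>
  define n where "n = (2::real) ^ (J - Suc J0)"
  have n0: "0 < n" by (simp add: n_def)
  have "J - J0 = Suc (J - Suc J0)" using J by simp
  then have "(2::real) ^ (J - J0) = 2 * n" by (simp add: n_def)
  then have Hle: "H \<le> c * n * \<rho> / 144" using err by (simp add: H_def mult_ac)
  note m = mean_scale_bounds[OF J, folded m_def]
  let ?j = "Suc J0"
  have mem: "?j \<in> {J0<..J}" using J by simp
  have "(real ?j - J0) * \<bar>s ?j - c * 2 ^ (J - ?j)\<bar> \<le> H"
    unfolding H_def using mem by (intro member_le_sum) auto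
  then have "\<bar>s ?j - c * n\<bar> \<le> H" by (simp add: n_def)
  \<comment> \<open>As \<rho> < 2, the deviation at \<open>Suc J0\<close> is at most c n / 72, well
    below c n / 2.\<close>
  moreover have "c * n * \<rho> / 144 \<le> c * n * 2 / 144"
    using c n0 \<rho> by (intro divide_right_mono mult_left_mono) auto
  moreover have cn: "0 < c * n" using c n0 by simp
  ultimately have s1: "c * n / 2 \<le> s ?j" using Hle by linarith
  then have "0 < s ?j" using cn by linarith
  then show pos: "0 < (\<Sum>j\<in>{J0<..J}. s j)"
    using mem s by (intro sum_pos2[of _ ?j]) auto
  define \<theta> where "\<theta> = x * ln 2"
  \<comment> \<open>These crude bounds give |x| / 2 \<le> |\<theta>| \<le> 2. The latter, with |J0 +
    1 - m| \<le> 1, keeps the exponent in the range of \<open>exp_ge_quadratic\<close>.\<close>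
  have ln2: "1 / 2 < ln (2::real)" "ln (2::real) < 1"
    using ln_2_less_1 ln2_ge_two_thirds by auto
  have \<theta>: "\<bar>x\<bar> / 2 \<le> \<bar>\<theta>\<bar>" "\<bar>\<theta>\<bar> \<le> 2"
  proof -
    have "\<bar>x\<bar> * (1 / 2) \<le> \<bar>x\<bar> * ln 2" using ln2 by (intro mult_left_mono) auto
    then show "\<bar>x\<bar> / 2 \<le> \<bar>\<theta>\<bar>" by (simp add: \<theta>_def abs_mult)
    have "\<bar>x\<bar> * ln 2 \<le> 2 * 1" using ln2 \<rho> by (intro mult_mono) auto
    then show "\<bar>\<theta>\<bar> \<le> 2" by (simp add: \<theta>_def abs_mult)
  qed
  have pw: "2 powr (x * (real j - m)) = exp (\<theta> * (real j - m))" for j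
    by (simp add: powr_def \<theta>_def mult_ac)
  have lin: "\<bar>\<Sum>j\<in>{J0<..J}. s j * (real j - m)\<bar> \<le> H"
  proof -
    have "(\<Sum>j\<in>{J0<..J}. s j * (real j - m)) = (\<Sum>j\<in>{J0<..J}. (s j - c * 2 ^ (J - j)) * (real j - m)) + c * (\<Sum>j\<in>{J0<..J}. 2 ^ (J - j) * (real j - m))"
      by (simp add: sum_distrib_left left_diff_distrib sum_subtractf mult.assoc)
    also have "\<dots> = (\<Sum>j\<in>{J0<..J}. (s j - c * 2 ^ (J - j)) * (real j - m))" using m(3) by simp
    also have "\<bar>\<dots>\<bar> \<le> (\<Sum>j\<in>{J0<..J}. \<bar>(s j - c * 2 ^ (J - j)) * (real j - m)\<bar>)" by (rule sum_abs)
    also have "\<dots> \<le> H"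
      unfolding H_def
    proof (rule sum_mono)
      fix j assume j: "j \<in> {J0<..J}"
      \<comment> \<open>Origin of the weight j - J0: m lies between J0 and J0 + 2, and every index
        other than J0 + 1 is at least J0 + 2.\<close>
      have "\<bar>real j - m\<bar> \<le> real j - J0"
      proof (cases "j = Suc J0")
        case True
        then show ?thesis using m(1,2) by simp
      next
        case False
        then have "real J0 + 2 \<le> real j" using j by simp
        then show ?thesis using m(1,2) by linarith
      qed
      then show "\<bar>(s j - c * 2 ^ (J - j)) * (real j - m)\<bar> \<le> (real j - J0) * \<bar>s j - c * 2 ^ (J - j)\<bar>"
        by (subst abs_mult, subst mult.commute) (intro mult_right_mono, auto)
    qed
    finally show ?thesis .
  qed
  \<comment> \<open>The 72 below is 2 times 9 times 4, from s \<ge> c n / 2, (J0 + 1 - m)^2 \<ge> 1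
    / 9 and the coefficient 1 / 4.\<close>
  define q where "q = s ?j * (\<theta> * (?j - m))\<^sup>2 / 4"
  have q: "c * n * \<theta>\<^sup>2 / 72 \<le> q"
  proof -
    have "(1 / 3)\<^sup>2 \<le> (?j - m)\<^sup>2"
      using m(1) by (subst abs_le_square_iff[symmetric]) auto
    then have "c * n / 2 * (\<theta>\<^sup>2 * (1 / 3)\<^sup>2) \<le> s ?j * (\<theta>\<^sup>2 * (?j - m)\<^sup>2)"
      using s1 c n0 s[of ?j] by (intro mult_mono mult_left_mono) auto
    moreover have "c * n / 2 * (\<theta>\<^sup>2 * (1 / 3)\<^sup>2) = c * n * \<theta>\<^sup>2 / 18" by (simp add: power_divide)
    moreover have "q = s ?j * (\<theta>\<^sup>2 * (?j - m)\<^sup>2) / 4" by (simp only: q_def power_mult_distrib)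
    ultimately show ?thesis by linarith
  qed
  have "(\<Sum>j\<in>{J0<..J}. s j) + \<theta> * (\<Sum>j\<in>{J0<..J}. s j * (real j - m)) + q
    = (\<Sum>j\<in>{J0<..J}. s j * (1 + \<theta> * (real j - m)) + (if j = ?j then q else 0))"
    using mem by (simp add: sum.distrib distrib_left sum_distrib_left mult.left_commute)
  also have "\<dots> \<le> (\<Sum>j\<in>{J0<..J}. s j * 2 powr (x * (real j - m)))"
  proof (rule sum_mono)
    fix j assume "j \<in> {J0<..J}"
    show "s j * (1 + \<theta> * (real j - m)) + (if j = ?j then q else 0) \<le> s j * 2 powr (x * (real j - m))"
    proof (cases "j = ?j")
      case True
      have "\<bar>\<theta> * (real j - m)\<bar> \<le> 2 * 1"
        unfolding abs_mult using \<theta>(2) m(1,2) True by (intro mult_mono) auto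
      then have "1 + \<theta> * (real j - m) + (\<theta> * (real j - m))\<^sup>2 / 4 \<le> exp (\<theta> * (real j - m))"
        by (intro exp_ge_quadratic) linarith
      then have "s j * (1 + \<theta> * (real j - m) + (\<theta> * (real j - m))\<^sup>2 / 4) \<le> s j * exp (\<theta> * (real j - m))"
        using s by (rule mult_left_mono)
      then show ?thesis unfolding pw using True by (simp add: q_def distrib_left)
    next
      case False
      then show ?thesis unfolding pw using s exp_ge_add_one_self[of "\<theta> * (real j - m)"] by (simp add: mult_left_mono)
    qed
  qed
  finally have low: "(\<Sum>j\<in>{J0<..J}. s j) + \<theta> * (\<Sum>j\<in>{J0<..J}. s j * (real j - m)) + q \<le> (\<Sum>j\<in>{J0<..J}. s j * 2 powr (x * (real j - m)))" .
  \<comment> \<open>The linear term loses at most |\<theta>| c n \<rho> / 144, and \<rho> < |x|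
    \<le> 2 |\<theta>|. The 288 in the hypothesis is twice 144, since 2^(J - J0) = 2 n; it makes the
    loss just smaller than the gain.\<close>
  have "\<bar>\<theta> * (\<Sum>j\<in>{J0<..J}. s j * (real j - m))\<bar> \<le> \<bar>\<theta>\<bar> * (c * n * \<rho> / 144)"
    unfolding abs_mult using lin Hle by (intro mult_left_mono) auto
  also have "\<dots> < \<bar>\<theta>\<bar> * (c * n * \<bar>\<theta>\<bar> / 72)"
  proof (rule mult_strict_left_mono)
    have "\<rho> / 144 < \<bar>\<theta>\<bar> / 72" using \<rho> \<theta>(1) by simp
    then have "c * n * (\<rho> / 144) < c * n * (\<bar>\<theta>\<bar> / 72)" using c n0 by (intro mult_strict_left_mono) auto
    then show "c * n * \<rho> / 144 < c * n * \<bar>\<theta>\<bar> / 72" by simp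
    show "0 < \<bar>\<theta>\<bar>" using \<theta>(1) \<rho> by linarith
  qed
  also have "\<dots> = c * n * \<theta>\<^sup>2 / 72" by (simp add: power2_eq_square)
  also have "\<dots> \<le> q" by (rule q)
  finally show "(\<Sum>j\<in>{J0<..J}. s j) < (\<Sum>j\<in>{J0<..J}. s j * 2 powr (x * (real j - m)))"
    using low by linarith
qed

text \<open>Factoring \<open>2 powr ((b - \<alpha>) * m)\<close> out of the sum cancels the linear
  term of the contrast and leaves the tilted sum. Farther than \<rho> from \<alpha> the contrast
  exceeds its value at \<alpha>, so a minimum over the compact interval around \<alpha> is global.
  This existence is required because \<open>whittle_estimate\<close> constrains \<open>a\<close>
  only when a minimiser exists.\<close>

lemma whittle_estimate_close:
  fixes d :: "nat \<Rightarrow> int \<Rightarrow> real" and \<alpha> c \<rho> a :: real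
  defines "s \<equiv> \<lambda>J j. (\<Sum>k\<in>{0..2 ^ (J - j) - 1}. (d j k)\<^sup>2) * 2 powr (- (2 - \<alpha>) * j)"
  assumes J: "J0 + 2 \<le> J" and c: "0 < c"
    and \<rho>: "0 < \<rho>" "0 < \<alpha> - \<rho>" "\<alpha> + \<rho> < 2"
    and err: "(\<Sum>j\<in>{J0<..J}. (real j - J0) * \<bar>s J j - c * 2 ^ (J - j)\<bar>) \<le> c * 2 ^ (J - J0) * \<rho> / 288"
    and est: "whittle_estimate d (scale_indices J J0 J) a"
  shows "\<bar>a - \<alpha>\<bar> \<le> \<rho>"
proof -
  let ?W = "whittle_contrast d (scale_indices J J0 J)"
  define m where "m = mean_scale (scale_indices J J0 J)"
  have s0: "0 \<le> s J j" for j by (simp add: s_def sum_nonneg)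
  have tilt: "(\<Sum>(j, k)\<in>scale_indices J J0 J. (d j k)\<^sup>2 / 2 powr ((2 - b) * real j))
      = 2 powr ((b - \<alpha>) * m) * (\<Sum>j\<in>{J0<..J}. s J j * 2 powr ((b - \<alpha>) * (real j - m)))" for b
  proof -
    have "(\<Sum>k\<in>{0..2 ^ (J - j) - 1}. (d j k)\<^sup>2 / 2 powr ((2 - b) * real j)) = 2 powr ((b - \<alpha>) * m) * (s J j * 2 powr ((b - \<alpha>) * (real j - m)))" for j
    proof -
      have "1 / 2 powr ((2 - b) * real j) = 2 powr (- ((2 - b) * real j))" by (rule powr_minus_divide[symmetric])
      \<comment> \<open>The exponent splits into a part common to all scales, the normalisation at
        the true \<alpha>, and the tilt about m.\<close>
      also have "- ((2 - b) * real j) = (b - \<alpha>) * m + (- (2 - \<alpha>) * j + (b - \<alpha>) * (real j - m))" by (simp add: algebra_simps)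
      also have "2 powr \<dots> = 2 powr ((b - \<alpha>) * m) * (2 powr (- (2 - \<alpha>) * j) * 2 powr ((b - \<alpha>) * (real j - m)))"
        by (simp only: powr_add)
      finally have e: "1 / 2 powr ((2 - b) * real j) = 2 powr ((b - \<alpha>) * m) * (2 powr (- (2 - \<alpha>) * j) * 2 powr ((b - \<alpha>) * (real j - m)))" .
      have "(\<Sum>k\<in>{0..2 ^ (J - j) - 1}. (d j k)\<^sup>2 / 2 powr ((2 - b) * real j)) = (\<Sum>k\<in>{0..2 ^ (J - j) - 1}. (d j k)\<^sup>2) * (1 / 2 powr ((2 - b) * real j))"
        by (simp add: sum_divide_distrib)
      then show ?thesis unfolding e s_def by (simp only: mult_ac)
    qed
    then show ?thesis unfolding sum_scale_indices by (simp add: sum_distrib_left)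
  qed
  have W: "?W b = ln (\<Sum>j\<in>{J0<..J}. s J j * 2 powr ((b - \<alpha>) * (real j - m))) + m * ln 2 * (2 - \<alpha>)"
    if "0 < (\<Sum>j\<in>{J0<..J}. s J j * 2 powr ((b - \<alpha>) * (real j - m)))" for b
    unfolding whittle_contrast_def tilt m_def[symmetric] using that
    by (subst ln_mult) (auto simp: ln_powr algebra_simps)
  \<comment> \<open>Positivity of the sum does not involve the tilt; (\<rho> + 2) / 2 is merely an
    admissible value between \<rho> and 2.\<close>
  have pos: "0 < (\<Sum>j\<in>{J0<..J}. s J j)"
    using tilted_sum_gt(2)[OF J c s0 \<rho>(1) _ _ err, of "(\<rho> + 2) / 2"] \<rho> by auto
  have posb: "0 < (\<Sum>j\<in>{J0<..J}. s J j * 2 powr ((b - \<alpha>) * (real j - m)))" for b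
  proof -
    obtain j where "j \<in> {J0<..J}" "0 < s J j" using pos sum_nonpos[of "{J0<..J}" "s J"] by (meson not_le)
    then show ?thesis using s0 by (intro sum_pos2[of _ j]) auto
  qed
  have W\<alpha>: "?W \<alpha> = ln (\<Sum>j\<in>{J0<..J}. s J j) + m * ln 2 * (2 - \<alpha>)" using W[OF posb[of \<alpha>]] by simp
  have far: "?W \<alpha> < ?W b" if b: "0 < b" "b < 2" "\<rho> < \<bar>b - \<alpha>\<bar>" for b
  proof -
    have "(\<Sum>j\<in>{J0<..J}. s J j) < (\<Sum>j\<in>{J0<..J}. s J j * 2 powr ((b - \<alpha>) * (real j - m)))"
      unfolding m_def using b \<rho> by (intro tilted_sum_gt(1)[OF J c s0 \<rho>(1) _ _ err]) auto
    then show ?thesis unfolding W\<alpha> W[OF posb] using pos by simp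
  qed
  have "continuous_on {\<alpha> - \<rho>..\<alpha> + \<rho>} ?W"
  proof -
    have "continuous_on {\<alpha> - \<rho>..\<alpha> + \<rho>} (\<lambda>b. ln (\<Sum>j\<in>{J0<..J}. s J j * 2 powr ((b - \<alpha>) * (real j - m))) + m * ln 2 * (2 - \<alpha>))"
      using posb by (intro continuous_intros) (auto simp: less_imp_neq[symmetric])
    then show ?thesis using W[OF posb] by simp
  qed
  then obtain b where b: "b \<in> {\<alpha> - \<rho>..\<alpha> + \<rho>}" "\<And>y. y \<in> {\<alpha> - \<rho>..\<alpha> + \<rho>} \<Longrightarrow> ?W b \<le> ?W y"
    using continuous_attains_inf[of "{\<alpha> - \<rho>..\<alpha> + \<rho>}" ?W] \<rho> by auto
  have "is_arg_min ?W (\<lambda>x. x \<in> {0<..<2}) b"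
    unfolding is_arg_min_linorder
  proof (intro conjI allI impI)
    show "b \<in> {0<..<2}" using b(1) \<rho> by auto
    fix y assume y: "y \<in> {0<..<(2::real)}"
    show "?W b \<le> ?W y"
    proof (cases "y \<in> {\<alpha> - \<rho>..\<alpha> + \<rho>}")
      case False
      then have "?W \<alpha> < ?W y" using y by (intro far) auto
      moreover have "?W b \<le> ?W \<alpha>" using \<rho> by (intro b(2)) auto
      ultimately show ?thesis by simp
    qed (rule b(2))
  qed
  then have "is_arg_min ?W (\<lambda>x. x \<in> {0<..<2}) a" using est unfolding whittle_estimate_def by blast
  then have a: "a \<in> {0<..<2}" "?W a \<le> ?W \<alpha>" using \<rho> unfolding is_arg_min_linorder by auto
  then show ?thesis using far[of a] by (metis greaterThanLessThan_iff not_le)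
qed

section \<open>Continuous and discrete observations\<close>

context wavelet_setting
begin

text \<open>Offsets, counted from the floor of s, of all grid points that interpolation at s can
  use. Being independent of s, this set turns the infinite sums into finite sums of measurable
  terms.\<close>

definition nearby :: "int set" where
  "nearby = {-1..\<lceil>M\<rceil>}"

lemma \<phi>_nearby:
  assumes "\<phi> (s - of_int i) \<noteq> 0"
  shows "i - \<lfloor>s\<rfloor> \<in> nearby" "s - 1 \<le> of_int i" "of_int i \<le> s + M - 1"
proof -
  have "s - of_int i \<in> {-M+1..1}"
    using assms by (rule contrapos_np) (rule \<phi>_support)
  then show 1: "s - 1 \<le> of_int i" "of_int i \<le> s + M - 1" by auto
  have "- 1 \<le> i - \<lfloor>s\<rfloor>" using 1(1) by linarith
  moreover have "i - \<lfloor>s\<rfloor> \<le> \<lceil>M\<rceil>" using 1(2) by linarith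
  ultimately show "i - \<lfloor>s\<rfloor> \<in> nearby" by (simp add: nearby_def)
qed

lemma interpolate_finite:
  "interpolate \<phi> g s = (\<Sum>n\<in>nearby. g (of_int (\<lfloor>s\<rfloor> + n)) * \<phi> (s - of_int (\<lfloor>s\<rfloor> + n)))"
proof -
  let ?h = "\<lambda>i. g (of_int i) * \<phi> (s - of_int i)"
  have "interpolate \<phi> g s = (\<Sum>\<^sub>\<infinity>i\<in>(\<lambda>n. \<lfloor>s\<rfloor> + n) ` nearby. ?h i)"
    unfolding interpolate_def
  proof (rule infsum_cong_neutral)
    fix i assume "i \<in> UNIV - (\<lambda>n. \<lfloor>s\<rfloor> + n) ` nearby"
    then have "i - \<lfloor>s\<rfloor> \<notin> nearby" by (metis DiffD2 add.commute diff_add_cancel image_eqI)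
    then show "?h i = 0" using \<phi>_nearby(1) by auto
  qed auto
  also have "\<dots> = (\<Sum>i\<in>(\<lambda>n. \<lfloor>s\<rfloor> + n) ` nearby. ?h i)"
    by (rule infsum_finite) (simp add: nearby_def)
  also have "\<dots> = (\<Sum>n\<in>nearby. ?h (\<lfloor>s\<rfloor> + n))"
    by (subst sum.reindex) auto
  finally show ?thesis .
qed

lemma \<phi>_partition_finite: "(\<Sum>n\<in>nearby. \<phi> (s - of_int (\<lfloor>s\<rfloor> + n))) = 1"
proof -
  \<comment> \<open>The partition of unity says that interpolation reproduces the constant
    1.\<close>
  have "interpolate \<phi> (\<lambda>_. 1) s = 1"
    unfolding interpolate_def using infsumI[OF \<phi>_partition[of s]] by simp
  then show ?thesis by (simp add: interpolate_finite)
qed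

definition grid_cover :: "real \<Rightarrow> real \<Rightarrow> real \<Rightarrow> real" where
  "grid_cover s x v = interpolate \<phi> (indicator {x..<x + v}) s"

definition grid_bound :: real where
  "grid_bound = (SOME C. \<forall>s x v. \<bar>grid_cover s x v\<bar> \<le> C)"

lemma grid_bound: "\<bar>grid_cover s x v\<bar> \<le> grid_bound"
proof -
  obtain B where B: "0 < B" "\<And>s. \<bar>\<phi> s\<bar> \<le> B" using \<phi>_bound by blast
  have "\<bar>grid_cover s x v\<bar> \<le> (\<Sum>n\<in>nearby. B)" for s x v
    unfolding grid_cover_def interpolate_finite
  proof (intro order_trans[OF sum_abs] sum_mono)
    fix n
    show "\<bar>indicat_real {x..<x + v} (of_int (\<lfloor>s\<rfloor> + n)) * \<phi> (s - of_int (\<lfloor>s\<rfloor> + n))\<bar> \<le> B"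
      using B(2)[of "s - of_int (\<lfloor>s\<rfloor> + n)"] B(1) by (simp add: indicator_def abs_mult)
  qed
  then have "\<exists>C. \<forall>s x v. \<bar>grid_cover s x v\<bar> \<le> C" by blast
  from someI_ex[OF this] show ?thesis unfolding grid_bound_def by blast
qed

end

sublocale wavelet_setting \<subseteq> cont: coverage M \<psi> \<phi> "\<lambda>s x v. indicator {x..<x + v} s" 1
proof
  show "(\<lambda>(s::real, x, v). indicat_real {x..<x + v} s) \<in> borel_measurable (borel \<Otimes>\<^sub>M borel \<Otimes>\<^sub>M borel)"
  proof -
    have eq: "(\<lambda>z::real \<times> real \<times> real. indicat_real {fst (snd z)..<fst (snd z) + snd (snd z)} (fst z))
       = (\<lambda>z. if fst (snd z) \<le> fst z \<and> fst z < fst (snd z) + snd (snd z) then 1 else 0)"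
      by (auto simp: fun_eq_iff indicator_def)
    have "(\<lambda>z::real \<times> real \<times> real. indicat_real {fst (snd z)..<fst (snd z) + snd (snd z)} (fst z)) \<in> borel_measurable (borel \<Otimes>\<^sub>M borel \<Otimes>\<^sub>M borel)"
      by (subst eq) measurable
    then show ?thesis by (simp only: case_prod_unfold)
  qed
  fix s x v :: real
  show "\<bar>indicat_real {x..<x + v} s\<bar> \<le> 1" by (simp add: indicator_def)
  show "v \<le> 0 \<Longrightarrow> indicat_real {x..<x + v} s = 0" by simp
  show "s < x - M \<or> x + v + M < s \<Longrightarrow> indicat_real {x..<x + v} s = 0" using M_ge_1 by (auto simp: indicator_def)
  show "x + M \<le> s \<Longrightarrow> s < x + v - M \<Longrightarrow> indicat_real {x..<x + v} s = 1" using M_ge_1 by (auto simp: indicator_def)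
  show "0 < s \<Longrightarrow> x < 0 \<Longrightarrow> x + v \<le> 0 \<Longrightarrow> indicat_real {x..<x + v} s = 0" by (auto simp: indicator_def)
  assume v: "0 < v"
  have "(\<lambda>x. indicat_real {x..<x + v} s) = indicat_real {s - v<..s}" by (auto simp: fun_eq_iff indicator_def)
  then show "(\<integral>x. indicat_real {x..<x + v} s \<partial>lborel) = v" using v by simp
qed

sublocale wavelet_setting \<subseteq> disc: coverage M \<psi> \<phi> grid_cover grid_bound
proof
  have m1: "(\<lambda>z::real \<times> real \<times> real. indicat_real {fst (snd z)..<fst (snd z) + snd (snd z)} (of_int (\<lfloor>fst z\<rfloor> + n))) \<in> borel_measurable (borel \<Otimes>\<^sub>M borel \<Otimes>\<^sub>M borel)" for n
  proof -
    have eq: "(\<lambda>z::real \<times> real \<times> real. indicat_real {fst (snd z)..<fst (snd z) + snd (snd z)} (of_int (\<lfloor>fst z\<rfloor> + n)))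
       = (\<lambda>z. if fst (snd z) \<le> real_of_int (\<lfloor>fst z\<rfloor> + n) \<and> real_of_int (\<lfloor>fst z\<rfloor> + n) < fst (snd z) + snd (snd z) then 1 else 0)"
      by (auto simp: fun_eq_iff indicator_def)
    show ?thesis by (subst eq) measurable
  qed
  have m2: "(\<lambda>z::real \<times> real \<times> real. \<phi> (fst z - of_int (\<lfloor>fst z\<rfloor> + n))) \<in> borel_measurable (borel \<Otimes>\<^sub>M borel \<Otimes>\<^sub>M borel)" for n
    using \<phi>_measurable by measurable
  show "(\<lambda>(s, x, v). grid_cover s x v) \<in> borel_measurable (borel \<Otimes>\<^sub>M borel \<Otimes>\<^sub>M borel)"
    unfolding grid_cover_def interpolate_finite case_prod_unfold
    by (intro borel_measurable_sum borel_measurable_times m1 m2)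
  fix s x v :: real
  show "\<bar>grid_cover s x v\<bar> \<le> grid_bound" by (rule grid_bound)
  show "v \<le> 0 \<Longrightarrow> grid_cover s x v = 0" by (simp add: grid_cover_def interpolate_finite)
  let ?i = "\<lambda>n. real_of_int (\<lfloor>s\<rfloor> + n)"
  \<comment> \<open>Contributing grid points lie within M of s because M \<ge> 1; this is the margin
    in the locale assumptions.\<close>
  have near: "s - 1 \<le> ?i n \<and> ?i n \<le> s + M - 1" if "\<phi> (s - ?i n) \<noteq> 0" for n
    using \<phi>_nearby(2,3)[OF that] by simp
  show "grid_cover s x v = 0" if "s < x - M \<or> x + v + M < s"
    unfolding grid_cover_def interpolate_finite
  proof (rule sum.neutral, rule ballI)
    fix n
    show "indicat_real {x..<x + v} (?i n) * \<phi> (s - ?i n) = 0"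
    proof (cases "\<phi> (s - ?i n) = 0")
      case False
      then have "?i n \<notin> {x..<x + v}" using near[OF False] that M_ge_1 by auto
      then show ?thesis by simp
    qed simp
  qed
  show "grid_cover s x v = 1" if "x + M \<le> s" "s < x + v - M"
  proof -
    have "indicat_real {x..<x + v} (?i n) * \<phi> (s - ?i n) = \<phi> (s - ?i n)" for n
    proof (cases "\<phi> (s - ?i n) = 0")
      case False
      then have "?i n \<in> {x..<x + v}" using near[OF False] that M_ge_1 by auto
      then show ?thesis by simp
    qed simp
    then show ?thesis unfolding grid_cover_def interpolate_finite by (simp only: \<phi>_partition_finite)
  qed
  show "grid_cover s x v = 0" if "0 < s" "x < 0" "x + v \<le> 0"
    unfolding grid_cover_def interpolate_finite
  proof (rule sum.neutral, rule ballI)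
    fix n
    show "indicat_real {x..<x + v} (?i n) * \<phi> (s - ?i n) = 0"
    proof (cases "\<phi> (s - ?i n) = 0")
      case False
      \<comment> \<open>As s > 0, a contributing grid point exceeds -1 and, being an integer, is
        nonnegative, hence beyond the end of the life.\<close>
      then have "- 1 < ?i n" using near[OF False] that by linarith
      then have "- 1 < \<lfloor>s\<rfloor> + n" by (metis of_int_less_iff of_int_minus of_int_1)
      then have "0 \<le> ?i n" by simp
      then have "?i n \<notin> {x..<x + v}" using that by auto
      then show ?thesis by simp
    qed simp
  qed
  assume v: "0 < v"
  have ind: "(\<lambda>x. indicat_real {x..<x + v} a) = indicat_real {a - v<..a}" for a
    by (auto simp: fun_eq_iff indicator_def)
  have int: "integrable lborel (\<lambda>x. indicat_real {x..<x + v} a)" "(\<integral>x. indicat_real {x..<x + v} a \<partial>lborel) = v" for a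
    unfolding ind using v by (auto intro!: integrable_real_indicator)
  \<comment> \<open>Each grid point is covered for birth times of total length v, and the translates
    of \<phi> add up to 1.\<close>
  have "(\<integral>x. grid_cover s x v \<partial>lborel) = (\<Sum>n\<in>nearby. v * \<phi> (s - ?i n))"
    unfolding grid_cover_def interpolate_finite
    using int by (subst Bochner_Integration.integral_sum) auto
  also have "\<dots> = v" unfolding sum_distrib_left[symmetric] \<phi>_partition_finite by simp
  finally show "(\<integral>x. grid_cover s x v \<partial>lborel) = v" .
qed

locale whittle_setting = infinite_source_poisson P t \<eta> U \<nu> \<alpha> 4 L + wavelet_setting M \<psi> \<phi>
  for P :: "'a measure" and t \<eta> U :: "int \<Rightarrow> 'a \<Rightarrow> real" and \<nu> \<alpha> L M \<psi> \<phi> +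
  assumes \<alpha>_gt_1: "1 < \<alpha>" and L4_bounded: "bounded (L 4 ` {0<..})"

sublocale whittle_setting \<subseteq> cont: covered_source P t \<eta> U \<nu> \<alpha> L M \<psi> \<phi> "\<lambda>s x v. indicator {x..<x + v} s" 1
  by standard (rule \<alpha>_gt_1 L4_bounded)+

sublocale whittle_setting \<subseteq> disc: covered_source P t \<eta> U \<nu> \<alpha> L M \<psi> \<phi> grid_cover grid_bound
  by standard (rule \<alpha>_gt_1 L4_bounded)+

section \<open>Observed coefficients as sums over the Poisson points\<close>

context whittle_setting
begin

text \<open>An almost sure event on which the identities for the coefficients hold for all scales
  and shifts at once. The second condition matches the indices used by the process with births from
  time 0 on.\<close>

definition regular :: "'a \<Rightarrow> bool" where
  "regular \<omega> \<longleftrightarrow> (\<forall>b. finite (window b \<omega>)) \<and> (\<forall>l. 0 \<le> t l \<omega> \<longleftrightarrow> 0 \<le> l)"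

lemma AE_regular: "AE \<omega> in P. regular \<omega>"
proof -
  have "AE \<omega> in P. \<forall>l. t l \<omega> < t (l + 1) \<omega>" "AE \<omega> in P. t (-1) \<omega> < 0 \<and> 0 \<le> t 0 \<omega>"
    using poisson by (auto simp: unit_poisson_points_def)
  with AE_finite_window show ?thesis
  proof eventually_elim
    case (elim \<omega>)
    have up: "t l \<omega> \<le> t (l + int n) \<omega>" for l n
    proof (induction n)
      case (Suc n)
      have "t (l + int n) \<omega> < t (l + int n + 1) \<omega>" using elim by blast
      also have "l + int n + 1 = l + int (Suc n)" by simp
      finally show ?case using Suc by simp
    qed simp
    have "0 \<le> t l \<omega> \<longleftrightarrow> 0 \<le> l" for l
    proof (cases "0 \<le> l")
      case True
      then show ?thesis using up[of 0 "nat l"] elim by simp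
    next
      case False
      then show ?thesis using up[of l "nat (- 1 - l)"] elim by simp
    qed
    then show ?case using elim unfolding regular_def by blast
  qed
qed

text \<open>The series runs over natural indices, the window over integer indices with births in
  [0, b]. Regularity identifies the two up to births after b, which do not show at time s.\<close>

lemma source_process_window:
  assumes "regular \<omega>" "s \<le> b"
  shows "source_process t \<eta> U \<omega> s = (\<Sum>l\<in>window b \<omega>. U l \<omega> * indicator {t l \<omega>..<t l \<omega> + \<eta> l \<omega>} s)"
proof -
  have fin: "finite (window b \<omega>)" and nn: "0 \<le> t l \<omega> \<longleftrightarrow> 0 \<le> l" for l
    using assms by (auto simp: regular_def)
  have img: "int ` (nat ` window b \<omega>) = window b \<omega>"
    using nn by (force simp: window_def image_image)
  have "source_process t \<eta> U \<omega> s = (\<Sum>n\<in>nat ` window b \<omega>. U (int n) \<omega> * indicator {t (int n) \<omega>..<t (int n) \<omega> + \<eta> (int n) \<omega>} s)"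
    unfolding source_process_def
  proof (rule suminf_finite)
    fix n assume n: "n \<notin> nat ` window b \<omega>"
    have "int n \<notin> window b \<omega>" using n by (metis image_eqI nat_int)
    then have "b < t (int n) \<omega>" using nn[of "int n"] by (auto simp: window_def)
    then show "U (int n) \<omega> * indicator {t (int n) \<omega>..<t (int n) \<omega> + \<eta> (int n) \<omega>} s = 0"
      using assms(2) by simp
  qed (use fin in simp)
  also have "\<dots> = (\<Sum>l\<in>int ` (nat ` window b \<omega>). U l \<omega> * indicator {t l \<omega>..<t l \<omega> + \<eta> l \<omega>} s)"
    by (subst sum.reindex) auto
  finally show ?thesis by (simp add: img)
qed

end

context covered_source
begin

lemma integrable_kernel_integrand: "integrable lborel (\<lambda>s. wavelet \<psi> j k s * I s x v)"
proof -
  have "integrable lborel (\<lambda>s. Imax * wavelet \<psi> j k s)" using integrable_wavelet by simp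
  then show ?thesis
  proof (rule Bochner_Integration.integrable_bound)
    show "AE s in lborel. norm (wavelet \<psi> j k s * I s x v) \<le> norm (Imax * wavelet \<psi> j k s)"
      using I_bound[of _ x v] Imax_nonneg
      by (intro AE_I2) (simp add: abs_mult mult.commute mult_right_mono)
  qed measurable
qed

text \<open>\<open>Y\<close> has to agree with the finite sum only where the wavelet is nonzero,
  since the window omits births after \<open>reach_end\<close>.\<close>

lemma coefficient_eq_point_sum:
  assumes fin: "finite (window (reach_end J j) \<omega>)" and k: "k \<in> shifts J j"
    and Y: "\<And>s. wavelet \<psi> j k s \<noteq> 0 \<Longrightarrow> Y s = (\<Sum>l\<in>window (reach_end J j) \<omega>. U l \<omega> * I s (t l \<omega>) (\<eta> l \<omega>))"
  shows "(\<integral>s. wavelet \<psi> j k s * Y s \<partial>lborel) = point_sum [present j k] \<omega>"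
proof -
  let ?w = "window (reach_end J j) \<omega>"
  have "(\<lambda>s. wavelet \<psi> j k s * Y s) = (\<lambda>s. \<Sum>l\<in>?w. U l \<omega> * (wavelet \<psi> j k s * I s (t l \<omega>) (\<eta> l \<omega>)))"
  proof
    fix s
    show "wavelet \<psi> j k s * Y s = (\<Sum>l\<in>?w. U l \<omega> * (wavelet \<psi> j k s * I s (t l \<omega>) (\<eta> l \<omega>)))"
      by (cases "wavelet \<psi> j k s = 0") (simp_all add: Y sum_distrib_left mult_ac)
  qed
  then have "(\<integral>s. wavelet \<psi> j k s * Y s \<partial>lborel) = (\<Sum>l\<in>?w. U l \<omega> * kernel j k (t l \<omega>) (\<eta> l \<omega>))"
    using integrable_kernel_integrand
    by (simp add: Bochner_Integration.integral_sum kernel_def)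
  also have "\<dots> = (\<Sum>l\<in>?w. present j k (marked_point l \<omega>))"
    by (intro sum.cong) (auto simp: present_def shot_def marked_point_def window_def)
  also have "\<dots> = point_sum [present j k] \<omega>"
    using present_support[OF k] fin by (intro point_sum_singleton[symmetric]) auto
  finally show ?thesis .
qed

text \<open>The margin M leaves room for interpolation, which at time s reads grid points up to s +
  M - 1.\<close>

lemma wavelet_before_end:
  assumes "k \<in> shifts J j" "wavelet \<psi> j k s \<noteq> 0"
  shows "0 \<le> s" "s + M \<le> reach_end J j"
proof -
  have k: "0 \<le> k" "k \<le> 2 ^ (J - j)" using assms(1) by (auto simp: shifts_def)
  show "0 \<le> s"
    using wavelet_support(1)[OF assms(2)] k(1)
    by (metis mult_nonneg_nonneg of_int_0_le_iff order_trans zero_le_numeral zero_le_power)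
  have "real_of_int k \<le> 2 ^ (J - j)"
    using k(2) by (metis of_int_le_iff of_int_numeral of_int_power)
  then have "(real_of_int k + M) * 2 ^ j \<le> (2 ^ (J - j) + M) * 2 ^ j" by (intro mult_right_mono) auto
  then show "s + M \<le> reach_end J j"
    using wavelet_support(2)[OF assms(2)] unfolding reach_end_def by linarith
qed

end

context whittle_setting
begin

lemma coeff_cont_eq:
  assumes \<omega>: "regular \<omega>" and k: "k \<in> cont.shifts J j"
  shows "coeff_cont \<psi> (source_process t \<eta> U \<omega>) j k = point_sum [cont.present j k] \<omega>"
proof -
  have "coeff_cont \<psi> (source_process t \<eta> U \<omega>) j k = (\<integral>s. wavelet \<psi> j k s * source_process t \<eta> U \<omega> s \<partial>lborel)"
    unfolding coeff_cont_def set_lebesgue_integral_def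
    using cont.wavelet_before_end(1)[OF k] by (intro Bochner_Integration.integral_cong) (auto simp: indicator_def)
  also have "\<dots> = point_sum [cont.present j k] \<omega>"
  proof (rule cont.coefficient_eq_point_sum[OF _ k])
    show "finite (window (cont.reach_end J j) \<omega>)" using \<omega> by (simp add: regular_def)
    show "source_process t \<eta> U \<omega> s = (\<Sum>l\<in>window (cont.reach_end J j) \<omega>. U l \<omega> * indicator {t l \<omega>..<t l \<omega> + \<eta> l \<omega>} s)"
      if "wavelet \<psi> j k s \<noteq> 0" for s
      using cont.wavelet_before_end(2)[OF k that] M_ge_1 by (intro source_process_window[OF \<omega>]) simp
  qed
  finally show ?thesis .
qed

lemma coeff_disc_eq:
  assumes \<omega>: "regular \<omega>" and k: "k \<in> disc.shifts J j"
  shows "coeff_disc \<psi> \<phi> (source_process t \<eta> U \<omega>) j k = point_sum [disc.present j k] \<omega>"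
  unfolding coeff_disc_def
proof (rule disc.coefficient_eq_point_sum[OF _ k])
  show "finite (window (disc.reach_end J j) \<omega>)" using \<omega> by (simp add: regular_def)
  fix s assume s: "wavelet \<psi> j k s \<noteq> 0"
  let ?w = "window (disc.reach_end J j) \<omega>" and ?i = "\<lambda>n. real_of_int (\<lfloor>s\<rfloor> + n)"
  \<comment> \<open>Near s = 0 the grid point -1 may occur. There both sides vanish, and the window
    formula, valid at all times up to its end, includes this case.\<close>
  have "source_process t \<eta> U \<omega> (?i n) * \<phi> (s - ?i n)
    = (\<Sum>l\<in>?w. U l \<omega> * (indicator {t l \<omega>..<t l \<omega> + \<eta> l \<omega>} (?i n) * \<phi> (s - ?i n)))" for n
  proof (cases "\<phi> (s - ?i n) = 0")
    case False
    then have "?i n \<le> disc.reach_end J j"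
      using \<phi>_nearby(3)[OF False] disc.wavelet_before_end(2)[OF k s] by simp
    then show ?thesis
      by (simp only: source_process_window[OF \<omega>] sum_distrib_right mult.assoc)
  qed simp
  then have "interpolate \<phi> (source_process t \<eta> U \<omega>) s
    = (\<Sum>n\<in>nearby. \<Sum>l\<in>?w. U l \<omega> * (indicator {t l \<omega>..<t l \<omega> + \<eta> l \<omega>} (?i n) * \<phi> (s - ?i n)))"
    unfolding interpolate_finite by simp
  also have "\<dots> = (\<Sum>l\<in>?w. U l \<omega> * grid_cover s (t l \<omega>) (\<eta> l \<omega>))"
    unfolding grid_cover_def interpolate_finite sum_distrib_left by (rule sum.swap)
  finally show "interpolate \<phi> (source_process t \<eta> U \<omega>) s = (\<Sum>l\<in>?w. U l \<omega> * grid_cover s (t l \<omega>) (\<eta> l \<omega>))" .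
qed

end

section \<open>Rates of convergence\<close>

text \<open>From 2 M \<le> T follows T - M + 1 \<ge> T / 2, from M \<ge> 1 follows M + 1 \<le> 2 M,
  and maximality of the exponent loses one more factor 2; together 8 M.\<close>

lemma max_scale_bounds:
  assumes M: "1 \<le> M" and T: "2 * M \<le> T"
  shows "T / (8 * M) < 2 ^ max_scale M T"
proof -
  define X where "X = (T - M + 1) / (M + 1)"
  have X: "T / (4 * M) \<le> X"
  proof -
    have "T / (4 * M) = (T / 2) / (2 * M)" by simp
    also have "\<dots> \<le> X" unfolding X_def using M T by (intro frac_le) auto
    finally show ?thesis .
  qed
  have X1: "1 \<le> X" using M T by (simp add: X_def)
  let ?S = "{j::nat. 2 ^ j \<le> X}"
  obtain n where n: "X < 2 ^ n" using real_arch_pow[of 2 X] by auto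
  have "?S \<subseteq> {..n}"
  proof
    fix j assume "j \<in> ?S"
    then have "2 ^ j \<le> X" by simp
    then have "(2::real) ^ j < 2 ^ n" using n by (rule le_less_trans)
    then show "j \<in> {..n}" by simp
  qed
  then have fin: "finite ?S" by (rule finite_subset) simp
  have J: "max_scale M T = Max ?S" by (simp add: max_scale_def X_def)
  have "Suc (Max ?S) \<notin> ?S" using Max_ge[OF fin, of "Suc (Max ?S)"] by force
  then have "X < 2 * 2 ^ max_scale M T" unfolding J by simp
  moreover have "T / (8 * M) = T / (4 * M) / 2" by simp
  ultimately show ?thesis using X by linarith
qed

section \<open>From deviations of level sums to the rate\<close>

context covered_source
begin

text \<open>The weight j - J0 costs only a constant. With j = J0 + i the summand is at most (i + 1)
  r^i times the bound at J0, where r = 2^(-(1 - \<alpha> / 2)) is below 1 because \<alpha> < 2: the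
  number of shifts falls faster than the relative fluctuation grows.\<close>

lemma weighted_deviation_bound:
  assumes C: "0 \<le> C" "\<And>J j. integrable P (level_sum J j)"
    "\<And>J j. j \<le> J \<Longrightarrow> expectation (\<lambda>\<omega>. \<bar>level_sum J j \<omega> * 2 powr (- (2 - \<alpha>) * j) - c * 2 ^ (J - j)\<bar>)
       \<le> C * 2 ^ (J - j) * (2 powr (- \<gamma> * j) + 2 powr ((\<alpha> * j - J) / 2))"
    and \<gamma>: "0 < \<gamma>"
  shows "\<exists>K\<ge>0. \<forall>J0 J. J0 \<le> J \<longrightarrow> expectation (\<lambda>\<omega>. \<Sum>j\<in>{J0<..J}. (real j - J0) * \<bar>level_sum J j \<omega> * 2 powr (- (2 - \<alpha>) * j) - c * 2 ^ (J - j)\<bar>)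
      \<le> K * 2 ^ (J - J0) * (2 powr (- \<gamma> * J0) + 2 powr ((\<alpha> * J0 - J) / 2))"
proof -
  define r :: real where "r = 2 powr (- (1 - \<alpha> / 2))"
  have r: "0 < r" "r < 1" using \<alpha>_range by (auto simp: r_def powr_less_one)
  have sm: "(\<lambda>n. of_nat (Suc n) * r ^ n) sums (1 / (1 - r)\<^sup>2)"
    using r by (intro geometric_deriv_sums) auto
  define K1 where "K1 = 1 / (1 - r)\<^sup>2"
  have main: "expectation (\<lambda>\<omega>. \<Sum>j\<in>{J0<..J}. (real j - J0) * \<bar>level_sum J j \<omega> * 2 powr (- (2 - \<alpha>) * j) - c * 2 ^ (J - j)\<bar>)
      \<le> (C * K1) * 2 ^ (J - J0) * (2 powr (- \<gamma> * J0) + 2 powr ((\<alpha> * J0 - J) / 2))" if J0: "J0 \<le> J" for J0 J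
  proof -
    define R where "R = 2 powr (- \<gamma> * J0) + 2 powr ((\<alpha> * J0 - J) / 2)"
    have R0: "0 \<le> R" by (simp add: R_def)
    have int: "integrable P (\<lambda>\<omega>. (real j - J0) * \<bar>level_sum J j \<omega> * 2 powr (- (2 - \<alpha>) * j) - c * 2 ^ (J - j)\<bar>)" for j
      using C(2) by auto
    have "expectation (\<lambda>\<omega>. \<Sum>j\<in>{J0<..J}. (real j - J0) * \<bar>level_sum J j \<omega> * 2 powr (- (2 - \<alpha>) * j) - c * 2 ^ (J - j)\<bar>)
      = (\<Sum>j\<in>{J0<..J}. expectation (\<lambda>\<omega>. (real j - J0) * \<bar>level_sum J j \<omega> * 2 powr (- (2 - \<alpha>) * j) - c * 2 ^ (J - j)\<bar>))"
      by (rule Bochner_Integration.integral_sum) (rule int)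
    also have "\<dots> = (\<Sum>j\<in>{J0<..J}. (real j - J0) * expectation (\<lambda>\<omega>. \<bar>level_sum J j \<omega> * 2 powr (- (2 - \<alpha>) * j) - c * 2 ^ (J - j)\<bar>))"
      by simp
    also have "\<dots> \<le> (\<Sum>j\<in>{J0<..J}. C * 2 ^ (J - J0) * R * (of_nat (Suc (j - J0)) * r ^ (j - J0)))"
    proof (rule sum_mono)
      fix j assume j: "j \<in> {J0<..J}"
      define i where "i = j - J0"
      have ji: "j = J0 + i" using j by (auto simp: i_def)
      have n: "(2::real) ^ (J - j) = 2 ^ (J - J0) * 2 powr (- real i)"
        using j by (simp add: ji powr_realpow[symmetric] of_nat_diff diff_diff_eq flip: powr_add)
      have ri: "r ^ i = 2 powr (- (1 - \<alpha> / 2) * i)"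
        using powr_realpow[OF r(1), of i] by (simp add: r_def powr_powr)
      have 1: "2 powr (- real i) * 2 powr (- \<gamma> * j) \<le> r ^ i * 2 powr (- \<gamma> * J0)"
      proof (rule mult_mono)
        have "0 \<le> \<alpha> / 2 * real i" using \<alpha>_range by simp
        then show "2 powr (- real i) \<le> r ^ i" unfolding ri by (intro powr_mono) (auto simp: algebra_simps)
        show "2 powr (- \<gamma> * j) \<le> 2 powr (- \<gamma> * J0)" using \<gamma> by (intro powr_mono) (auto simp: ji)
      qed (use r in auto)
      have 2: "2 powr (- real i) * 2 powr ((\<alpha> * j - J) / 2) = r ^ i * 2 powr ((\<alpha> * J0 - J) / 2)"
      proof -
        have "- real i + (\<alpha> * j - J) / 2 = - (1 - \<alpha> / 2) * i + (\<alpha> * J0 - J) / 2"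
          by (simp add: ji algebra_simps add_divide_distrib diff_divide_distrib)
        then show ?thesis unfolding ri powr_add[symmetric] by (simp only:)
      qed
      have "(real j - J0) * expectation (\<lambda>\<omega>. \<bar>level_sum J j \<omega> * 2 powr (- (2 - \<alpha>) * j) - c * 2 ^ (J - j)\<bar>)
        \<le> real i * (C * 2 ^ (J - j) * (2 powr (- \<gamma> * j) + 2 powr ((\<alpha> * j - J) / 2)))"
        using C(3)[of j J] j by (simp add: ji mult_left_mono)
      also have "\<dots> = real i * (C * 2 ^ (J - J0)) * (2 powr (- real i) * 2 powr (- \<gamma> * j) + 2 powr (- real i) * 2 powr ((\<alpha> * j - J) / 2))"
        unfolding n by (simp add: algebra_simps)
      also have "\<dots> \<le> real i * (C * 2 ^ (J - J0)) * (r ^ i * 2 powr (- \<gamma> * J0) + r ^ i * 2 powr ((\<alpha> * J0 - J) / 2))"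
        unfolding 2 using C(1) 1 r by (intro mult_left_mono add_mono) auto
      also have "\<dots> = C * 2 ^ (J - J0) * R * (real i * r ^ i)" by (simp add: R_def algebra_simps)
      also have "\<dots> \<le> C * 2 ^ (J - J0) * R * (of_nat (Suc i) * r ^ i)"
        using C(1) R0 r by (intro mult_left_mono mult_right_mono) auto
      finally show "(real j - J0) * expectation (\<lambda>\<omega>. \<bar>level_sum J j \<omega> * 2 powr (- (2 - \<alpha>) * j) - c * 2 ^ (J - j)\<bar>)
        \<le> C * 2 ^ (J - J0) * R * (of_nat (Suc (j - J0)) * r ^ (j - J0))" by (simp add: i_def)
    qed
    also have "\<dots> = C * 2 ^ (J - J0) * R * (\<Sum>i\<in>(\<lambda>j. j - J0) ` {J0<..J}. of_nat (Suc i) * r ^ i)"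
      unfolding sum_distrib_left by (subst sum.reindex) (auto simp: inj_on_def)
    also have "\<dots> \<le> C * 2 ^ (J - J0) * R * K1"
    proof (intro mult_left_mono)
      have "(\<Sum>i\<in>(\<lambda>j. j - J0) ` {J0<..J}. of_nat (Suc i) * r ^ i) \<le> (\<Sum>i. of_nat (Suc i) * r ^ i)"
        using sm r by (intro sum_le_suminf) (auto simp: sums_iff)
      then show "(\<Sum>i\<in>(\<lambda>j. j - J0) ` {J0<..J}. of_nat (Suc i) * r ^ i) \<le> K1"
        using sm by (simp add: K1_def sums_iff)
    qed (use C(1) R0 in auto)
    finally show ?thesis by (simp add: R_def mult_ac)
  qed
  have "0 \<le> C * K1" using C(1) by (simp add: K1_def)
  then show ?thesis using main by (intro exI[of _ "C * K1"] conjI allI impI) auto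
qed

text \<open>Markov's inequality bounds the probability that the weighted deviation reaches the level
  up to which \<open>whittle_estimate_close\<close> applies. The bad event of the estimator,
  possibly nonmeasurable, is covered by that event and a null set.\<close>

theorem whittle_rate:
  fixes F :: "'i filter" and \<tau> :: "'i \<Rightarrow> real" and \<alpha>hat :: "'i \<Rightarrow> 'a \<Rightarrow> real" and D :: "'a \<Rightarrow> nat \<Rightarrow> int \<Rightarrow> real"
  assumes second_moment: "\<And>j k. 0 \<le> k \<Longrightarrow> \<bar>(\<integral>z. (shot j k z)\<^sup>2 \<partial>intensity) - c * 2 powr ((2 - \<alpha>) * j)\<bar> \<le> Cv * 2 powr ((2 - \<alpha> - \<gamma>) * j)"
    and c: "0 < c" and \<gamma>: "0 < \<gamma>"
    and \<tau>: "filterlim \<tau> at_top F"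
    and D: "AE \<omega> in P. \<forall>J j k. k \<in> shifts J j \<longrightarrow> D \<omega> j k = point_sum [present j k] \<omega>"
    and est: "\<And>i \<omega>. \<omega> \<in> space P \<Longrightarrow> whittle_estimate (D \<omega>)
        (scale_indices (max_scale M (\<tau> i)) (nat \<lfloor>real (max_scale M (\<tau> i)) / (2 * \<gamma> + \<alpha>)\<rfloor>) (max_scale M (\<tau> i))) (\<alpha>hat i \<omega>)"
  shows "bigO_P P F (\<lambda>i \<omega>. \<alpha>hat i \<omega> - \<alpha>) (\<lambda>i. \<tau> i powr (- \<gamma> / (2 * \<gamma> + \<alpha>)))"
  unfolding bigO_P_def
proof (intro allI impI)
  fix \<epsilon> :: real assume \<epsilon>: "0 < \<epsilon>"
  obtain C where C: "0 \<le> C" "\<And>J j. integrable P (level_sum J j)"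
    "\<And>J j. j \<le> J \<Longrightarrow> expectation (\<lambda>\<omega>. \<bar>level_sum J j \<omega> * 2 powr (- (2 - \<alpha>) * j) - c * 2 ^ (J - j)\<bar>)
       \<le> C * 2 ^ (J - j) * (2 powr (- \<gamma> * j) + 2 powr ((\<alpha> * j - J) / 2))"
    using level_sum_deviation[OF second_moment c \<gamma>] by metis
  define dev where "dev = (\<lambda>J0 J \<omega>. \<Sum>j\<in>{J0<..J}. (real j - J0) * \<bar>level_sum J j \<omega> * 2 powr (- (2 - \<alpha>) * j) - c * 2 ^ (J - j)\<bar>)"
  obtain K where K0: "0 \<le> K" and K': "\<forall>J0 J. J0 \<le> J \<longrightarrow> expectation (\<lambda>\<omega>. \<Sum>j\<in>{J0<..J}. (real j - J0) * \<bar>level_sum J j \<omega> * 2 powr (- (2 - \<alpha>) * j) - c * 2 ^ (J - j)\<bar>)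
      \<le> K * 2 ^ (J - J0) * (2 powr (- \<gamma> * J0) + 2 powr ((\<alpha> * J0 - J) / 2))"
    using weighted_deviation_bound[OF C \<gamma>] by blast
  have K: "0 \<le> K" "expectation (dev J0 J) \<le> K * 2 ^ (J - J0) * (2 powr (- \<gamma> * J0) + 2 powr ((\<alpha> * J0 - J) / 2))" if "J0 \<le> J" for J0 J
    using K0 K'[rule_format, OF that] by (simp_all only: dev_def)
  note K = K0 K(2)
  have dev_int: "integrable P (dev J0 J)" for J0 J
    unfolding dev_def using C(2) by auto
  have dev0: "0 \<le> dev J0 J \<omega>" for J0 J \<omega>
    unfolding dev_def by (intro sum_nonneg) auto
  define q where "q = \<gamma> / (2 * \<gamma> + \<alpha>)"
  have den: "0 < 2 * \<gamma> + \<alpha>" using \<gamma> \<alpha>_gt_1 by simp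
  have q: "0 < q" using \<gamma> den by (simp add: q_def)
  \<comment> \<open>2^\<gamma> pays for the floor in J0, the 1 stands for the fluctuation, and (8
    M)^q for passing from 2^J to \<tau>.\<close>
  define K2 where "K2 = (2 powr \<gamma> + 1) * (8 * M) powr q"
  have K20: "0 < K2" unfolding K2_def using M_ge_1 by (intro mult_pos_pos add_nonneg_pos) auto
  \<comment> \<open>Chosen so that the Markov bound becomes \<epsilon> K / (K + 1); K + 1 in place
    of K keeps \<open>B\<close> positive when K = 0.\<close>
  define B where "B = 288 * (K + 1) * K2 / (c * \<epsilon>)"
  have B0: "0 < B" using K K20 c \<epsilon> by (simp add: B_def)
  \<comment> \<open>J > n will give J0 + 2 \<le> J: since J0 \<le> J / \<alpha>, it suffices that J
    - J / \<alpha> \<ge> 2, that is, J \<ge> 2 \<alpha> / (\<alpha> - 1).\<close>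
  define n where "n = nat \<lceil>2 * \<alpha> / (\<alpha> - 1)\<rceil>"
  have ev1: "\<forall>\<^sub>F i in F. max (2 * M) (8 * M * 2 ^ n) \<le> \<tau> i"
    using \<tau> unfolding filterlim_at_top by (rule spec)
  have lim: "((\<lambda>i. B * \<tau> i powr (- q)) \<longlongrightarrow> B * 0) F"
    using q by (intro tendsto_mult tendsto_const tendsto_neg_powr \<tau>) auto
  \<comment> \<open>Keeps the interval of radius \<rho> about \<alpha> inside (0, 2).\<close>
  have ev2: "\<forall>\<^sub>F i in F. B * \<tau> i powr (- q) < min \<alpha> (2 - \<alpha>)"
    using lim \<alpha>_range \<alpha>_gt_1 by (intro order_tendstoD) auto
  have ev3: "\<forall>\<^sub>F i in F. 0 < \<tau> i" using \<tau> by (simp add: filterlim_at_top_dense)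
  show "\<exists>C. \<forall>\<^sub>F i in F. \<exists>A\<in>sets P. {\<omega> \<in> space P. C < \<bar>(\<alpha>hat i \<omega> - \<alpha>) / \<tau> i powr (- \<gamma> / (2 * \<gamma> + \<alpha>))\<bar>} \<subseteq> A \<and> prob A \<le> \<epsilon>"
  proof (rule exI[of _ B], use ev1 ev2 ev3 in eventually_elim)
    case (elim i)
    define J where "J = max_scale M (\<tau> i)"
    define J0 where "J0 = nat \<lfloor>real J / (2 * \<gamma> + \<alpha>)\<rfloor>"
    define \<rho> where "\<rho> = B * \<tau> i powr (- q)"
    have \<rho>: "0 < \<rho>" "\<rho> < \<alpha>" "\<rho> < 2 - \<alpha>" using B0 elim by (auto simp: \<rho>_def)
    have T: "\<tau> i / (8 * M) < 2 ^ J"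
      unfolding J_def using elim M_ge_1 by (intro max_scale_bounds) auto
    have "2 ^ n \<le> \<tau> i / (8 * M)" using elim M_ge_1 by (simp add: field_simps)
    with T have "(2::real) ^ n < 2 ^ J" by (rule order.strict_trans1[rotated])
    then have nJ: "n < J" by simp
    have J0le: "real J0 \<le> real J / (2 * \<gamma> + \<alpha>)"
      unfolding J0_def using den by (simp add: of_nat_nat)
    have J0ge: "real J / (2 * \<gamma> + \<alpha>) - 1 \<le> real J0"
      unfolding J0_def using den by (simp add: of_nat_nat)
    have J02: "J0 + 2 \<le> J"
    proof -
      have "real J0 \<le> real J / \<alpha>"
        using \<gamma> \<alpha>_gt_1 by (intro order_trans[OF J0le] divide_left_mono) auto
      moreover have "2 * \<alpha> / (\<alpha> - 1) \<le> real J" using nJ unfolding n_def by linarith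
      then have "real J / \<alpha> + 2 \<le> real J" using \<alpha>_gt_1 by (simp add: field_simps)
      ultimately show ?thesis by linarith
    qed
    have R: "2 powr (- \<gamma> * J0) + 2 powr ((\<alpha> * J0 - J) / 2) \<le> K2 * \<tau> i powr (- q)"
    proof -
      have "\<gamma> * (real J / (2 * \<gamma> + \<alpha>) - 1) \<le> \<gamma> * real J0" using \<gamma> J0ge by (intro mult_left_mono) auto
      then have "- \<gamma> * J0 \<le> \<gamma> + - q * J" by (simp add: q_def algebra_simps)
      then have "2 powr (- \<gamma> * J0) \<le> 2 powr \<gamma> * 2 powr (- q * J)" unfolding powr_add[symmetric] by (intro powr_mono) auto
      moreover have "(\<alpha> * J0 - J) / 2 \<le> - q * J"
      proof -
        have "\<alpha> * J0 \<le> \<alpha> * (real J / (2 * \<gamma> + \<alpha>))" using J0le \<alpha>_gt_1 by (intro mult_left_mono) auto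
        then have "(\<alpha> * J0 - J) / 2 \<le> (\<alpha> * (real J / (2 * \<gamma> + \<alpha>)) - J) / 2" by (intro divide_right_mono diff_right_mono) simp_all
        \<comment> \<open>The balance behind J0: \<alpha> / (2\<gamma> + \<alpha>) - 1 = -2 q, so
          the fluctuation reaches the exponent -q of the bias.\<close>
        also have "\<dots> = - q * J" using den by (simp add: q_def field_simps)
        finally show ?thesis .
      qed
      then have "2 powr ((\<alpha> * J0 - J) / 2) \<le> 2 powr (- q * J)" by (intro powr_mono) auto
      ultimately have "2 powr (- \<gamma> * J0) + 2 powr ((\<alpha> * J0 - J) / 2) \<le> (2 powr \<gamma> + 1) * 2 powr (- q * J)"
        unfolding distrib_right mult_1_left by (rule add_mono)
      also have "\<dots> \<le> (2 powr \<gamma> + 1) * ((8 * M) powr q * \<tau> i powr (- q))"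
      proof (rule mult_left_mono)
        have "2 powr (- q * J) = (2 ^ J) powr (- q)" by (simp add: powr_powr mult.commute flip: powr_realpow)
        also have "\<dots> \<le> (\<tau> i / (8 * M)) powr (- q)"
          using T q M_ge_1 elim by (intro powr_mono2') auto
        also have "\<dots> = (8 * M) powr q * \<tau> i powr (- q)"
          using M_ge_1 elim by (simp add: powr_divide powr_minus divide_simps)
        finally show "2 powr (- q * J) \<le> (8 * M) powr q * \<tau> i powr (- q)" .
      qed simp
      finally show ?thesis by (simp add: K2_def mult.assoc)
    qed
    define lev where "lev = c * 2 ^ (J - J0) * \<rho> / 288"
    have lev0: "0 < lev" using c \<rho> by (simp add: lev_def)
    define A1 where "A1 = {\<omega> \<in> space P. lev \<le> dev J0 J \<omega>}"
    have A1: "A1 \<in> sets P" unfolding A1_def using dev_int by measurable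
    have "prob A1 \<le> expectation (dev J0 J) / lev"
      unfolding A1_def using dev_int dev0 lev0 by (intro integral_Markov_inequality_measure[where A="{}"]) auto
    also have "\<dots> \<le> (K * 2 ^ (J - J0) * (K2 * \<tau> i powr (- q))) / lev"
    proof (rule divide_right_mono)
      have "expectation (dev J0 J) \<le> K * 2 ^ (J - J0) * (2 powr (- \<gamma> * J0) + 2 powr ((\<alpha> * J0 - J) / 2))"
        using J02 by (intro K) simp
      also have "\<dots> \<le> K * 2 ^ (J - J0) * (K2 * \<tau> i powr (- q))" using K R by (intro mult_left_mono) auto
      finally show "expectation (dev J0 J) \<le> K * 2 ^ (J - J0) * (K2 * \<tau> i powr (- q))" .
    qed (use lev0 in simp)
    also have "\<dots> = 288 * K * K2 / (c * B)"
      using elim c B0 by (simp add: lev_def \<rho>_def field_simps)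
    also have "\<dots> = \<epsilon> * (K / (K + 1))"
    proof -
      have cB: "c * B = 288 * (K + 1) * K2 / \<epsilon>" using c by (simp add: B_def)
      have *: "288 * K * K2 / (288 * x * K2 / \<epsilon>) = \<epsilon> * (K / x)" if "0 < x" for x
        using that K20 \<epsilon> by (simp add: field_simps)
      show ?thesis unfolding cB by (rule *) (use K0 in simp)
    qed
    also have "\<dots> \<le> \<epsilon> * 1" using K0 \<epsilon> by (intro mult_left_mono) auto
    also have "\<epsilon> * 1 = \<epsilon>" by simp
    finally have pA1: "prob A1 \<le> \<epsilon>" .
    \<comment> \<open>The identity between observed coefficients and point sums holds only almost
      surely; the exceptional set is moved into a measurable null set.\<close>
    obtain N where N: "{\<omega> \<in> space P. \<not> (\<forall>J j k. k \<in> shifts J j \<longrightarrow> D \<omega> j k = point_sum [present j k] \<omega>)} \<subseteq> N" "emeasure P N = 0" "N \<in> sets P"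
      using D by (auto elim: AE_E)
    show ?case
    proof (intro bexI[of _ "A1 \<union> N"] conjI subsetI)
      show "A1 \<union> N \<in> sets P" using A1 N by simp
      have "prob (A1 \<union> N) \<le> prob A1 + prob N" using A1 N by (intro measure_Un_le)
      then show "prob (A1 \<union> N) \<le> \<epsilon>" using pA1 N(2) by (simp add: measure_def)
      fix \<omega> assume \<omega>: "\<omega> \<in> {\<omega> \<in> space P. B < \<bar>(\<alpha>hat i \<omega> - \<alpha>) / \<tau> i powr (- \<gamma> / (2 * \<gamma> + \<alpha>))\<bar>}"
      show "\<omega> \<in> A1 \<union> N"
      proof (rule ccontr)
        assume nA: "\<omega> \<notin> A1 \<union> N"
        with \<omega> N have eq: "D \<omega> j k = point_sum [present j k] \<omega>" if "k \<in> shifts J j" for J j k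
          using that by blast
        have small: "dev J0 J \<omega> \<le> lev" using nA \<omega> by (auto simp: A1_def)
        have "(\<Sum>j\<in>{J0<..J}. (real j - J0) * \<bar>(\<Sum>k\<in>{0..2 ^ (J - j) - 1}. (D \<omega> j k)\<^sup>2) * 2 powr (- (2 - \<alpha>) * j) - c * 2 ^ (J - j)\<bar>) = dev J0 J \<omega>"
          unfolding dev_def level_sum_def shifts_def[symmetric] using eq by simp
        then have err: "(\<Sum>j\<in>{J0<..J}. (real j - J0) * \<bar>(\<Sum>k\<in>{0..2 ^ (J - j) - 1}. (D \<omega> j k)\<^sup>2) * 2 powr (- (2 - \<alpha>) * j) - c * 2 ^ (J - j)\<bar>) \<le> c * 2 ^ (J - J0) * \<rho> / 288"
          using small by (simp add: lev_def)
        have "whittle_estimate (D \<omega>) (scale_indices J J0 J) (\<alpha>hat i \<omega>)"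
          using est[of \<omega> i] \<omega> by (simp add: J_def J0_def)
        from whittle_estimate_close[OF J02 c _ _ _ err this] \<rho>
        have "\<bar>\<alpha>hat i \<omega> - \<alpha>\<bar> \<le> \<rho>" by simp
        moreover have "0 < \<tau> i powr (- q)" using elim by simp
        ultimately have "\<bar>(\<alpha>hat i \<omega> - \<alpha>) / \<tau> i powr (- q)\<bar> \<le> B"
          by (simp add: \<rho>_def abs_divide pos_divide_le_eq)
        then show False using \<omega> by (simp add: q_def)
      qed
    qed
  qed
qed

end

section \<open>Second moments in continuous and in discrete time\<close>

context whittle_setting
begin

lemma cont_kernel_eq:
  "cont.kernel j k x v = 2 powr (j / 2) * (LINT s:{x / 2 ^ j - of_int k..x / 2 ^ j - of_int k + v / 2 ^ j}|lborel. \<psi> s)"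
proof -
  let ?u = "x / 2 ^ j - of_int k"
  have "cont.kernel j k x v = (\<integral>s. wavelet \<psi> j k s * indicat_real {x..<x + v} s \<partial>lborel)"
    by (simp add: cont.kernel_def)
  also have "\<dots> = \<bar>2 ^ j\<bar> *\<^sub>R (\<integral>y. wavelet \<psi> j k (of_int k * 2 ^ j + 2 ^ j * y) * indicat_real {x..<x + v} (of_int k * 2 ^ j + 2 ^ j * y) \<partial>lborel)"
    by (rule lborel_integral_real_affine) simp
  also have "(\<lambda>y. wavelet \<psi> j k (of_int k * 2 ^ j + 2 ^ j * y) * indicat_real {x..<x + v} (of_int k * 2 ^ j + 2 ^ j * y))
    = (\<lambda>y. 2 powr (- real j / 2) * (indicat_real {?u..<?u + v / 2 ^ j} y * \<psi> y))"
  proof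
    fix y :: real
    have "2 powr - real j * (of_int k * 2 ^ j + 2 ^ j * y) - of_int k = y"
      by (simp add: powr_minus powr_realpow field_simps)
    moreover have "indicat_real {x..<x + v} (of_int k * 2 ^ j + 2 ^ j * y) = indicat_real {?u..<?u + v / 2 ^ j} y"
      by (auto simp: indicator_def field_simps)
    ultimately show "wavelet \<psi> j k (of_int k * 2 ^ j + 2 ^ j * y) * indicat_real {x..<x + v} (of_int k * 2 ^ j + 2 ^ j * y)
      = 2 powr (- real j / 2) * (indicat_real {?u..<?u + v / 2 ^ j} y * \<psi> y)"
      by (simp add: wavelet_def)
  qed
  also have "\<bar>2 ^ j\<bar> *\<^sub>R (\<integral>y. 2 powr (- real j / 2) * (indicat_real {?u..<?u + v / 2 ^ j} y * \<psi> y) \<partial>lborel)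
    = (2 powr j * 2 powr (- real j / 2)) * (\<integral>y. indicat_real {?u..<?u + v / 2 ^ j} y * \<psi> y \<partial>lborel)"
    by (simp add: powr_realpow)
  also have "2 powr j * 2 powr (- real j / 2) = 2 powr (j / 2)" by (simp flip: powr_add)
  \<comment> \<open>The half-open life of a source and the closed interval in
    \<open>scale_fun\<close> differ by one point.\<close>
  also have "(\<integral>y. indicat_real {?u..<?u + v / 2 ^ j} y * \<psi> y \<partial>lborel) = (\<integral>y. indicat_real {?u..?u + v / 2 ^ j} y * \<psi> y \<partial>lborel)"
  proof (rule integral_cong_AE)
    show "AE y in lborel. indicat_real {?u..<?u + v / 2 ^ j} y * \<psi> y = indicat_real {?u..?u + v / 2 ^ j} y * \<psi> y"
      using AE_lborel_singleton[of "?u + v / 2 ^ j"] by eventually_elim (auto simp: indicator_def)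
  qed (use \<psi>_measurable in measurable)
  finally show ?thesis by (simp add: set_lebesgue_integral_def)
qed

text \<open>The squared kernel and the change of variable in the birth time each give a factor 2^j,
  and the shift k disappears by translation. Then 2^(2 j) = 2^((2 - \<alpha>) j) (2^j)^\<alpha>
  supplies the prefactor of \<open>scale_fun\<close> at 2^j.\<close>

lemma cont_second_moment:
  "(\<integral>z. (cont.shot j k z)\<^sup>2 \<partial>intensity) = 2 powr ((2 - \<alpha>) * j) * scale_fun \<alpha> \<nu> \<psi> (2 ^ j)"
proof -
  let ?G = "\<lambda>y. \<integral>u. (LINT s:{u..u + y}|lborel. \<psi> s)\<^sup>2 \<partial>lborel"
  have inner: "(\<integral>x. (cont.kernel j k x v)\<^sup>2 \<partial>lborel) = 2 powr (2 * j) * ?G (v / 2 ^ j)" for v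
  proof -
    have "(\<integral>x. (cont.kernel j k x v)\<^sup>2 \<partial>lborel) = 2 powr j * (\<integral>x. (LINT s:{x / 2 ^ j - of_int k..x / 2 ^ j - of_int k + v / 2 ^ j}|lborel. \<psi> s)\<^sup>2 \<partial>lborel)"
      by (simp add: cont_kernel_eq power_mult_distrib power2_eq_square[of "2 powr _"] flip: powr_add)
    also have "(\<integral>x. (LINT s:{x / 2 ^ j - of_int k..x / 2 ^ j - of_int k + v / 2 ^ j}|lborel. \<psi> s)\<^sup>2 \<partial>lborel)
      = \<bar>2 ^ j\<bar> *\<^sub>R (\<integral>u. (LINT s:{(of_int k * 2 ^ j + 2 ^ j * u) / 2 ^ j - of_int k..(of_int k * 2 ^ j + 2 ^ j * u) / 2 ^ j - of_int k + v / 2 ^ j}|lborel. \<psi> s)\<^sup>2 \<partial>lborel)"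
      by (rule lborel_integral_real_affine) simp
    also have "\<dots> = 2 powr j * ?G (v / 2 ^ j)"
      by (simp add: add_divide_distrib powr_realpow)
    finally show ?thesis by (simp add: mult.assoc[symmetric] flip: powr_add)
  qed
  have int: "integrable (lborel \<Otimes>\<^sub>M \<nu>) (\<lambda>(s, x). (cont.shot j k (s, x))\<^sup>2)"
    using cont.shot_square_integrable[of j k] by (simp add: intensity_def case_prod_unfold)
  have "(\<integral>z. (cont.shot j k z)\<^sup>2 \<partial>intensity) = (\<integral>x. (\<integral>s. (cont.shot j k (s, x))\<^sup>2 \<partial>lborel) \<partial>\<nu>)"
    using intensity.integral_snd[OF int] by (simp add: intensity_def case_prod_unfold)
  also have "\<dots> = (\<integral>(v, w). 2 powr (2 * j) * (?G (v / 2 ^ j) * w\<^sup>2) \<partial>\<nu>)"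
    by (intro Bochner_Integration.integral_cong refl) (auto simp: cont.shot_def power_mult_distrib inner)
  also have "\<dots> = 2 powr (2 * j) * (\<integral>(v, w). ?G (v / 2 ^ j) * w\<^sup>2 \<partial>\<nu>)"
    by (simp add: case_prod_unfold)
  also have "\<dots> = 2 powr ((2 - \<alpha>) * j) * scale_fun \<alpha> \<nu> \<psi> (2 ^ j)"
  proof -
    have "2 powr (2 * j) = 2 powr ((2 - \<alpha>) * j) * (2 ^ j) powr \<alpha>"
      by (simp add: powr_powr algebra_simps flip: powr_realpow powr_add)
    then show ?thesis by (simp add: scale_fun_def)
  qed
  finally show ?thesis .
qed

lemma cont_second_moment_bound:
  assumes "(\<lambda>z. scale_fun \<alpha> \<nu> \<psi> z - c) \<in> O[at_top](\<lambda>z. z powr (-\<beta>))"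
  obtains C where "0 \<le> C" "\<And>j k. \<bar>(\<integral>z. (cont.shot j k z)\<^sup>2 \<partial>intensity) - c * 2 powr ((2 - \<alpha>) * j)\<bar> \<le> C * 2 powr ((2 - \<alpha> - \<beta>) * j)"
proof -
  obtain C where C: "0 < C" "\<forall>\<^sub>F z in at_top. norm (scale_fun \<alpha> \<nu> \<psi> z - c) \<le> C * norm (z powr (-\<beta>))"
    using assms by (rule landau_o.bigE)
  have "filterlim (\<lambda>j::nat. 2 ^ j :: real) at_top sequentially" by real_asymp
  with C(2) have "\<forall>\<^sub>F j in sequentially. norm (scale_fun \<alpha> \<nu> \<psi> (2 ^ j) - c) \<le> C * norm ((2 ^ j) powr (-\<beta>))"
    by (rule eventually_compose_filterlim)
  then obtain m where m: "\<And>j. m \<le> j \<Longrightarrow> \<bar>scale_fun \<alpha> \<nu> \<psi> (2 ^ j) - c\<bar> \<le> C * (2 ^ j) powr (-\<beta>)"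
    by (auto simp: eventually_sequentially)
  \<comment> \<open>The finitely many scales before the asymptotic regime are absorbed by adding
    their errors to the constant.\<close>
  define C' where "C' = C + (\<Sum>j<m. \<bar>scale_fun \<alpha> \<nu> \<psi> (2 ^ j) - c\<bar> / (2 ^ j) powr (-\<beta>))"
  have sum0: "0 \<le> (\<Sum>j<m. \<bar>scale_fun \<alpha> \<nu> \<psi> (2 ^ j) - c\<bar> / (2 ^ j) powr (-\<beta>))" by (intro sum_nonneg) auto
  have all: "\<bar>scale_fun \<alpha> \<nu> \<psi> (2 ^ j) - c\<bar> \<le> C' * (2 ^ j) powr (-\<beta>)" for j
  proof (cases "m \<le> j")
    case True
    have "C * (2 ^ j) powr (-\<beta>) \<le> C' * (2 ^ j) powr (-\<beta>)"
      using sum0 by (intro mult_right_mono) (auto simp: C'_def)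
    then show ?thesis using m[OF True] by linarith
  next
    case False
    then have "\<bar>scale_fun \<alpha> \<nu> \<psi> (2 ^ j) - c\<bar> / (2 ^ j) powr (-\<beta>) \<le> (\<Sum>j<m. \<bar>scale_fun \<alpha> \<nu> \<psi> (2 ^ j) - c\<bar> / (2 ^ j) powr (-\<beta>))"
      by (intro member_le_sum) auto
    then have "\<bar>scale_fun \<alpha> \<nu> \<psi> (2 ^ j) - c\<bar> / (2 ^ j) powr (-\<beta>) \<le> C'" using C by (simp add: C'_def)
    then show ?thesis by (simp add: pos_divide_le_eq)
  qed
  have "\<bar>(\<integral>z. (cont.shot j k z)\<^sup>2 \<partial>intensity) - c * 2 powr ((2 - \<alpha>) * j)\<bar> \<le> C' * 2 powr ((2 - \<alpha> - \<beta>) * j)" for j k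
  proof -
    have "(\<integral>z. (cont.shot j k z)\<^sup>2 \<partial>intensity) - c * 2 powr ((2 - \<alpha>) * j) = 2 powr ((2 - \<alpha>) * j) * (scale_fun \<alpha> \<nu> \<psi> (2 ^ j) - c)"
      unfolding cont_second_moment by (simp add: algebra_simps)
    then have "\<bar>(\<integral>z. (cont.shot j k z)\<^sup>2 \<partial>intensity) - c * 2 powr ((2 - \<alpha>) * j)\<bar> \<le> 2 powr ((2 - \<alpha>) * j) * (C' * (2 ^ j) powr (-\<beta>))"
      using all[of j] by (simp add: abs_mult mult_left_mono)
    also have "\<dots> = C' * (2 powr ((2 - \<alpha>) * j) * 2 powr (- \<beta> * j))"
      by (simp add: powr_powr mult_ac flip: powr_realpow)
    also have "2 powr ((2 - \<alpha>) * j) * 2 powr (- \<beta> * j) = 2 powr ((2 - \<alpha> - \<beta>) * j)"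
      by (simp add: algebra_simps flip: powr_add)
    finally show ?thesis .
  qed
  moreover have "0 \<le> C'" using C sum0 by (simp add: C'_def)
  ultimately show thesis using that by blast
qed

text \<open>Interpolation changes the integrand only within distance \<open>M\<close> of the two endpoints of the
  life of a source, so the kernels differ by \<open>O(2 powr (- j / 2))\<close> and the second moments by \<open>O(1)\<close>.\<close>

lemma kernel_difference:
  obtains C where "0 \<le> C" "\<And>j k x v. \<bar>disc.kernel j k x v - cont.kernel j k x v\<bar> \<le> C * 2 powr (- real j / 2)"
proof -
  obtain B where B: "0 < B" "\<And>s. \<bar>\<psi> s\<bar> \<le> B" using \<psi>_bound by blast
  let ?c = "\<lambda>j. 2 powr (- real j / 2) * B * (grid_bound + 1)"
  have main: "\<bar>disc.kernel j k x v - cont.kernel j k x v\<bar> \<le> (B * (grid_bound + 1) * (4 * M)) * 2 powr (- real j / 2)" for j k x v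
  proof -
    define d where "d = (\<lambda>s. wavelet \<psi> j k s * (grid_cover s x v - indicat_real {x..<x + v} s))"
    have [measurable]: "d \<in> borel_measurable borel"
      using borel_measurable_integrable[OF disc.integrable_kernel_integrand[of j k x v]]
        borel_measurable_integrable[OF cont.integrable_kernel_integrand[of j k x v]]
      unfolding d_def right_diff_distrib by simp
    \<comment> \<open>The zones around birth and death may overlap; cutting out the first leaves a
      remainder supported in the second.\<close>
    let ?d1 = "\<lambda>s. d s * indicat_real {x - M..x + M} s"
    let ?d2 = "\<lambda>s. d s * (1 - indicat_real {x - M..x + M} s)"
    have c0: "0 \<le> ?c j" using B disc.Imax_nonneg by simp
    have wb: "\<bar>d s\<bar> \<le> ?c j" for s
    proof -
      have "\<bar>grid_cover s x v - indicat_real {x..<x + v} s\<bar> \<le> grid_bound + 1"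
        using grid_bound[of s x v] by (auto simp: indicator_def)
      then have "\<bar>wavelet \<psi> j k s\<bar> * \<bar>grid_cover s x v - indicat_real {x..<x + v} s\<bar> \<le> (2 powr (- real j / 2) * B) * (grid_bound + 1)"
        using wavelet_bound[OF B(2), of j k s] B(1) by (intro mult_mono) auto
      then show ?thesis by (simp add: d_def abs_mult)
    qed
    have far: "d s = 0" if "s \<notin> {x - M..x + M}" "s \<notin> {x + v - M..x + v + M}" for s
    proof (cases "v \<le> 0")
      case True
      then show ?thesis by (simp add: d_def disc.I_empty)
    next
      case False
      have "s < x - M \<or> x + v + M < s \<or> x + M < s \<and> s < x + v - M"
        using that False M_ge_1 unfolding atLeastAtMost_iff by linarith
      then consider "s < x - M" | "x + v + M < s" | "x + M < s" "s < x + v - M" by blast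
      then have "grid_cover s x v = indicat_real {x..<x + v} s"
        by cases (use disc.I_outside[of s x v] cont.I_outside[of s x v] disc.I_inside[of x s v] cont.I_inside[of x s v] in auto)
      then show ?thesis by (simp add: d_def)
    qed
    have b1: "\<bar>?d1 s\<bar> \<le> ?c j" "s \<notin> {x - M..x + M} \<Longrightarrow> ?d1 s = 0" for s
      using wb[of s] c0 by (auto simp: indicator_def)
    have b2: "\<bar>?d2 s\<bar> \<le> ?c j" "s \<notin> {x + v - M..x + v + M} \<Longrightarrow> ?d2 s = 0" for s
      using wb[of s] far[of s] c0 by (auto simp: indicator_def)
    have "disc.kernel j k x v - cont.kernel j k x v = (\<integral>s. d s \<partial>lborel)"
      unfolding disc.kernel_def cont.kernel_def d_def right_diff_distrib
      by (intro Bochner_Integration.integral_diff[symmetric] disc.integrable_kernel_integrand cont.integrable_kernel_integrand)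
    also have "\<dots> = (\<integral>s. ?d1 s + ?d2 s \<partial>lborel)" by (simp add: algebra_simps)
    also have "\<dots> = (\<integral>s. ?d1 s \<partial>lborel) + (\<integral>s. ?d2 s \<partial>lborel)"
    proof (rule Bochner_Integration.integral_add)
      show "integrable lborel ?d1"
        by (rule abs_integral_le_interval(1)[OF _ b1(1), where a="x - M" and b="x + M"]) (use b1(2) M_ge_1 in auto)
      show "integrable lborel ?d2"
        by (rule abs_integral_le_interval(1)[OF _ b2(1), where a="x + v - M" and b="x + v + M"]) (use b2(2) M_ge_1 in auto)
    qed
    finally have eq: "disc.kernel j k x v - cont.kernel j k x v = (\<integral>s. ?d1 s \<partial>lborel) + (\<integral>s. ?d2 s \<partial>lborel)" .
    have "\<bar>\<integral>s. ?d1 s \<partial>lborel\<bar> \<le> ?c j * ((x + M) - (x - M))"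
      by (rule abs_integral_le_interval(2)[OF _ b1(1), where a="x - M" and b="x + M"]) (use b1(2) M_ge_1 in auto)
    moreover have "\<bar>\<integral>s. ?d2 s \<partial>lborel\<bar> \<le> ?c j * ((x + v + M) - (x + v - M))"
      by (rule abs_integral_le_interval(2)[OF _ b2(1), where a="x + v - M" and b="x + v + M"]) (use b2(2) M_ge_1 in auto)
    ultimately have "\<bar>disc.kernel j k x v - cont.kernel j k x v\<bar> \<le> ?c j * ((x + M) - (x - M)) + ?c j * ((x + v + M) - (x + v - M))"
      unfolding eq by (intro order_trans[OF abs_triangle_ineq] add_mono)
    then show ?thesis by (simp add: algebra_simps)
  qed
  have "0 \<le> B * (grid_bound + 1) * (4 * M)" using B disc.Imax_nonneg M_ge_1 by simp
  then show thesis using main that by blast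
qed

text \<open>Write the difference of squares as a product: the kernel difference of order 2^(-j/2)
  meets weighted first moments of order 2^(j/2), and the scale cancels.\<close>

lemma disc_second_moment_bound:
  obtains C where "0 \<le> C" "\<And>j k. \<bar>(\<integral>z. (disc.shot j k z)\<^sup>2 \<partial>intensity) - (\<integral>z. (cont.shot j k z)\<^sup>2 \<partial>intensity)\<bar> \<le> C"
proof -
  obtain E where E: "0 \<le> E" "\<And>j k x v. \<bar>disc.kernel j k x v - cont.kernel j k x v\<bar> \<le> E * 2 powr (- real j / 2)"
    using kernel_difference by blast
  let ?a = "6 * M * disc.kernel_const * disc.mark_mom 2" and ?b = "6 * M * cont.kernel_const * cont.mark_mom 2"
  have main: "\<bar>(\<integral>z. (disc.shot j k z)\<^sup>2 \<partial>intensity) - (\<integral>z. (cont.shot j k z)\<^sup>2 \<partial>intensity)\<bar> \<le> E * (?a + ?b)" for j k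
  proof -
    let ?e = "E * 2 powr (- real j / 2)"
    let ?h = "\<lambda>z. ?e * (\<bar>snd (snd z)\<bar> * \<bar>disc.shot j k z\<bar> + \<bar>snd (snd z)\<bar> * \<bar>cont.shot j k z\<bar>)"
    have ih: "integrable intensity ?h"
      by (intro integrable_mult_right Bochner_Integration.integrable_add disc.weighted_shot_integrable cont.weighted_shot_integrable)
    have id: "integrable intensity (\<lambda>z. (disc.shot j k z)\<^sup>2 - (cont.shot j k z)\<^sup>2)"
      by (intro Bochner_Integration.integrable_diff disc.shot_square_integrable cont.shot_square_integrable)
    have ptw: "\<bar>(disc.shot j k z)\<^sup>2 - (cont.shot j k z)\<^sup>2\<bar> \<le> ?h z" for z
    proof -
      have "disc.shot j k z - cont.shot j k z = snd (snd z) * (disc.kernel j k (fst z) (fst (snd z)) - cont.kernel j k (fst z) (fst (snd z)))"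
        by (simp add: disc.shot_def cont.shot_def right_diff_distrib)
      then have "\<bar>disc.shot j k z - cont.shot j k z\<bar> \<le> \<bar>snd (snd z)\<bar> * ?e"
        using E(2)[of j k "fst z" "fst (snd z)"] by (simp only: abs_mult mult_left_mono abs_ge_zero)
      moreover have "(disc.shot j k z)\<^sup>2 - (cont.shot j k z)\<^sup>2 = (disc.shot j k z - cont.shot j k z) * (disc.shot j k z + cont.shot j k z)"
        by (simp add: power2_eq_square algebra_simps)
      then have "\<bar>(disc.shot j k z)\<^sup>2 - (cont.shot j k z)\<^sup>2\<bar> = \<bar>disc.shot j k z - cont.shot j k z\<bar> * \<bar>disc.shot j k z + cont.shot j k z\<bar>"
        by (simp only: abs_mult)
      moreover have "\<dots> \<le> (\<bar>snd (snd z)\<bar> * ?e) * (\<bar>disc.shot j k z\<bar> + \<bar>cont.shot j k z\<bar>)" if "\<bar>disc.shot j k z - cont.shot j k z\<bar> \<le> \<bar>snd (snd z)\<bar> * ?e"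
        using that abs_triangle_ineq[of "disc.shot j k z" "cont.shot j k z"] E(1) by (intro mult_mono) auto
      ultimately have "\<bar>(disc.shot j k z)\<^sup>2 - (cont.shot j k z)\<^sup>2\<bar> \<le> (\<bar>snd (snd z)\<bar> * ?e) * (\<bar>disc.shot j k z\<bar> + \<bar>cont.shot j k z\<bar>)"
        by simp
      then show ?thesis by (simp add: algebra_simps)
    qed
    have "\<bar>(\<integral>z. (disc.shot j k z)\<^sup>2 \<partial>intensity) - (\<integral>z. (cont.shot j k z)\<^sup>2 \<partial>intensity)\<bar> = \<bar>\<integral>z. (disc.shot j k z)\<^sup>2 - (cont.shot j k z)\<^sup>2 \<partial>intensity\<bar>"
      by (simp add: disc.shot_square_integrable cont.shot_square_integrable)
    also have "\<dots> \<le> (\<integral>z. \<bar>(disc.shot j k z)\<^sup>2 - (cont.shot j k z)\<^sup>2\<bar> \<partial>intensity)" by (rule integral_abs_bound)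
    also have "\<dots> \<le> (\<integral>z. ?h z \<partial>intensity)"
      using id ih ptw by (intro Bochner_Integration.integral_mono) auto
    also have "\<dots> = ?e * ((\<integral>z. \<bar>snd (snd z)\<bar> * \<bar>disc.shot j k z\<bar> \<partial>intensity) + (\<integral>z. \<bar>snd (snd z)\<bar> * \<bar>cont.shot j k z\<bar> \<partial>intensity))"
      using disc.weighted_shot_integrable cont.weighted_shot_integrable by simp
    also have "\<dots> \<le> ?e * (?a * 2 powr (j / 2) + ?b * 2 powr (j / 2))"
      using E(1) by (intro mult_left_mono add_mono disc.weighted_shot_integral cont.weighted_shot_integral) auto
    also have "\<dots> = E * (?a + ?b) * (2 powr (- real j / 2) * 2 powr (j / 2))" by (simp add: algebra_simps)
    also have "2 powr (- real j / 2) * 2 powr (j / 2) = 1" by (simp flip: powr_add)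
    finally show ?thesis by simp
  qed
  then have "0 \<le> E * (?a + ?b)" by (rule order_trans[OF abs_ge_zero])
  then show thesis using main that by blast
qed

end

theorem theorem4p2:
  fixes P :: "'a measure"
    and t \<eta> U :: "int \<Rightarrow> 'a \<Rightarrow> real"
    and \<nu> :: "(real \<times> real) measure"
    and L :: "nat \<Rightarrow> real \<Rightarrow> real"
    and \<psi> \<phi> :: "real \<Rightarrow> real"
    and M \<alpha> \<beta> c :: real
  assumes "infinite_source_poisson P t \<eta> U \<nu> \<alpha> 4 L"
    and "wavelet_setting M \<psi> \<phi>"
    and "1 < \<alpha>" and "\<alpha> < 2"
    and "bounded (L 4 ` {0<..})"
    and "0 < c" and "0 < \<beta>"
    and "(\<lambda>z. scale_fun \<alpha> \<nu> \<psi> z - c) \<in> O[at_top](\<lambda>z. z powr (-\<beta>))"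
  shows
    "(\<forall>\<alpha>hat :: real \<Rightarrow> 'a \<Rightarrow> real.
        (\<forall>T. \<forall>\<omega>\<in>space P.
           let J = max_scale M T; J0 = nat \<lfloor>real J / (2 * \<beta> + \<alpha>)\<rfloor>; J1 = J
           in whittle_estimate (coeff_cont \<psi> (source_process t \<eta> U \<omega>))
                (scale_indices J J0 J1) (\<alpha>hat T \<omega>)) \<longrightarrow>
        bigO_P P at_top (\<lambda>T \<omega>. \<alpha>hat T \<omega> - \<alpha>) (\<lambda>T. T powr (- \<beta> / (2 * \<beta> + \<alpha>))))
     \<and>
     (\<forall>\<alpha>hat :: nat \<Rightarrow> 'a \<Rightarrow> real.
        let \<gamma> = min \<beta> (2 - \<alpha>) in
        (\<forall>T. \<forall>\<omega>\<in>space P.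
           let J = max_scale M (real T); J0 = nat \<lfloor>real J / (2 * \<gamma> + \<alpha>)\<rfloor>; J1 = J
           in whittle_estimate (coeff_disc \<psi> \<phi> (source_process t \<eta> U \<omega>))
                (scale_indices J J0 J1) (\<alpha>hat T \<omega>)) \<longrightarrow>
        bigO_P P sequentially (\<lambda>T \<omega>. \<alpha>hat T \<omega> - \<alpha>) (\<lambda>T. real T powr (- \<gamma> / (2 * \<gamma> + \<alpha>))))"
proof -
  interpret whittle_setting P t \<eta> U \<nu> \<alpha> L M \<psi> \<phi>
    using assms by (intro whittle_setting.intro whittle_setting_axioms.intro)
  obtain C where C: "0 \<le> C" "\<And>j k. \<bar>(\<integral>z. (cont.shot j k z)\<^sup>2 \<partial>intensity) - c * 2 powr ((2 - \<alpha>) * j)\<bar> \<le> C * 2 powr ((2 - \<alpha> - \<beta>) * j)"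
    using cont_second_moment_bound[OF assms(8)] by blast
  obtain E where E: "0 \<le> E" "\<And>j k. \<bar>(\<integral>z. (disc.shot j k z)\<^sup>2 \<partial>intensity) - (\<integral>z. (cont.shot j k z)\<^sup>2 \<partial>intensity)\<bar> \<le> E"
    using disc_second_moment_bound by blast
  define \<gamma> where "\<gamma> = min \<beta> (2 - \<alpha>)"
  have \<gamma>: "0 < \<gamma>" "\<gamma> \<le> \<beta>" "\<gamma> \<le> 2 - \<alpha>" using assms by (auto simp: \<gamma>_def)
  have disc_bound: "\<bar>(\<integral>z. (disc.shot j k z)\<^sup>2 \<partial>intensity) - c * 2 powr ((2 - \<alpha>) * j)\<bar> \<le> (C + E) * 2 powr ((2 - \<alpha> - \<gamma>) * j)" for j k
  proof -
    have "C * 2 powr ((2 - \<alpha> - \<beta>) * j) \<le> C * 2 powr ((2 - \<alpha> - \<gamma>) * j)"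
      using C(1) \<gamma> by (intro mult_left_mono powr_mono mult_right_mono) auto
    \<comment> \<open>\<gamma> \<le> 2 - \<alpha> makes this exponent nonnegative, so the constant
      discretisation error is absorbed; this is where the minimum with 2 - \<alpha>
      originates.\<close>
    moreover have "E * 1 \<le> E * 2 powr ((2 - \<alpha> - \<gamma>) * j)"
      using E(1) \<gamma> by (intro mult_left_mono ge_one_powr_ge_zero mult_nonneg_nonneg) auto
    ultimately show ?thesis using C(2)[of j k] E(2)[of j k] by (simp add: distrib_right)
  qed
  have ae_cont: "AE \<omega> in P. \<forall>J j k. k \<in> cont.shifts J j \<longrightarrow> coeff_cont \<psi> (source_process t \<eta> U \<omega>) j k = point_sum [cont.present j k] \<omega>"
    using AE_regular by eventually_elim (auto intro: coeff_cont_eq)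
  have ae_disc: "AE \<omega> in P. \<forall>J j k. k \<in> disc.shifts J j \<longrightarrow> coeff_disc \<psi> \<phi> (source_process t \<eta> U \<omega>) j k = point_sum [disc.present j k] \<omega>"
    using AE_regular by eventually_elim (auto intro: coeff_disc_eq)
  have 1: "bigO_P P at_top (\<lambda>T \<omega>. \<alpha>hat T \<omega> - \<alpha>) (\<lambda>T. T powr (- \<beta> / (2 * \<beta> + \<alpha>)))"
    if "\<And>T \<omega>. \<omega> \<in> space P \<Longrightarrow> whittle_estimate (coeff_cont \<psi> (source_process t \<eta> U \<omega>))
      (scale_indices (max_scale M T) (nat \<lfloor>real (max_scale M T) / (2 * \<beta> + \<alpha>)\<rfloor>) (max_scale M T)) (\<alpha>hat T \<omega>)"
    for \<alpha>hat :: "real \<Rightarrow> 'a \<Rightarrow> real"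
    by (rule cont.whittle_rate[OF C(2) assms(6,7) filterlim_ident ae_cont that])
  have 2: "bigO_P P sequentially (\<lambda>T \<omega>. \<alpha>hat T \<omega> - \<alpha>) (\<lambda>T. real T powr (- \<gamma> / (2 * \<gamma> + \<alpha>)))"
    if "\<And>T \<omega>. \<omega> \<in> space P \<Longrightarrow> whittle_estimate (coeff_disc \<psi> \<phi> (source_process t \<eta> U \<omega>))
      (scale_indices (max_scale M (real T)) (nat \<lfloor>real (max_scale M (real T)) / (2 * \<gamma> + \<alpha>)\<rfloor>) (max_scale M (real T))) (\<alpha>hat T \<omega>)"
    for \<alpha>hat :: "nat \<Rightarrow> 'a \<Rightarrow> real"
    by (rule disc.whittle_rate[OF disc_bound assms(6) \<gamma>(1) filterlim_real_sequentially ae_disc that])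
  show ?thesis
    unfolding Let_def \<gamma>_def[symmetric] using 1 2 by blast
qed

end
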